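(* Under the standing assumptions of the context, the killed McKean–Vlasov equation $$X_t=X_0+\int_0^t b\Big(\int_0^sK*\nu_r(X_s)\,dr,\ \int_0^s\nabla K*\nu_r(X_s)\,dr\Big)ds+\sqrt2\,W_t,\quad t\in[0,\tau)\cap[0,T];\qquad X_t=\Delta,\quad t\ge\tau,$$ with $$\nu_t(A)=\mathbb P(X_t\in A,\ t<\tau)\ (A\in\mathcal B_{\mathbb{R}}),\qquad \tau:=\inf\Big\{t\ge0:\int_0^t\lambda c_0\exp\Big(-\lambda\int_0^sK*\nu_r(X_s)\,dr\Big)ds\ge Z\Big\},$$ admits a strong solution $X$ which is pathwise unique; moreover it admits a weak solution which is unique in law.
   Context: Standing assumptions. $T>0$; $(\Omega,\mathcal F,(\mathcal F_t),\mathbb P)$ is a filtered probability space carrying a one-dimensional Brownian motion $W$, an $\mathcal F_0$-measurable real random variable $X_0$ independent of $W$ with $\mathbb E|X_0|^2<\infty$ and law $\nu_0(dx)=\rho_0(x)dx$, $\rho_0\in L^2(\mathbb{R})\cap C_b(\mathbb{R})$, and a random variable $Z\sim\mathrm{Exp}(1)$ independent of $X_0$ and $W$. $\Delta$ is a cemetery state isolated from $\mathbb{R}$; functions on $\mathbb{R}$ are extended by $f(\Delta)=0$; $X_\tau:=\lim_{t\to\tau^-}X_t$. $K:\mathbb{R}\to\mathbb{R}_+$ is a smooth mollifier: $K\in C^\infty$; $|K|\le M_K$, $|\nabla K|\le M_K'$, $|\nabla^2K|\le M_K''$; $K$ and $\nabla K$ are Lipschitz with constants $L_K,L_K'$; $\int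 K=1$. Parameters $\lambda>0$, $c_0>0$, $\varphi_0>0$, $\varphi_1\in\mathbb{R}$ are such that there exist constants $0<m\le M$ with $m\le\varphi_0+\varphi_1c_0e^{-\lambda x}\le M$ for all $x\in[0,M_KT]$. The drift is $b(x,y):=-\varphi_1\lambda c_0\dfrac{e^{-\lambda x}y}{\varphi_0+\varphi_1c_0e^{-\lambda x}}$. For a finite measure $\nu$ on $\mathbb{R}$, $K*\nu(x):=\int K(x-y)\nu(dy)$ and $\nabla K*\nu(x):=\int\nabla K(x-y)\nu(dy)$. *)

theory Defs
  imports "HOL-Probability.Probability"
begin

definition filtration_on :: "'a measure \<Rightarrow> (real \<Rightarrow> 'a measure) \<Rightarrow> bool" where
  "filtration_on M F \<longleftrightarrow>
     (\<forall>t\<ge>0. subalgebra M (F t)) \<and> (\<forall>s t. 0 \<le> s \<longrightarrow> s \<le> t \<longrightarrow> sets (F s) \<subseteq> sets (F t))"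

definition gen_sigma :: "'a measure \<Rightarrow> ('a \<Rightarrow> real) set \<Rightarrow> 'a set set" where
  "gen_sigma M Vs = sigma_sets (space M) (\<Union>V\<in>Vs. {V -` A \<inter> space M | A. A \<in> sets borel})"

definition brownian_motion :: "'a measure \<Rightarrow> (real \<Rightarrow> 'a measure) \<Rightarrow> (real \<Rightarrow> 'a \<Rightarrow> real) \<Rightarrow> bool" where
  "brownian_motion M F W \<longleftrightarrow>
     (\<forall>t\<ge>0. W t \<in> borel_measurable (F t)) \<and>
     (AE \<omega> in M. W 0 \<omega> = 0 \<and> continuous_on {0..} (\<lambda>t. W t \<omega>)) \<and>
     (\<forall>s t. 0 \<le> s \<longrightarrow> s < t \<longrightarrow>
        distr M borel (\<lambda>\<omega>. W t \<omega> - W s \<omega>) = density lborel (\<lambda>x. ennreal (normal_density 0 (sqrt (t - s)) x)) \<and>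
        prob_space.indep_sets M (\<lambda>i. if i then sets (F s) else gen_sigma M {\<lambda>\<omega>. W t \<omega> - W s \<omega>}) UNIV)"

definition data_setup :: "(real \<Rightarrow> real) \<Rightarrow> 'a measure \<Rightarrow> (real \<Rightarrow> 'a measure) \<Rightarrow>
    ('a \<Rightarrow> real) \<Rightarrow> (real \<Rightarrow> 'a \<Rightarrow> real) \<Rightarrow> ('a \<Rightarrow> real) \<Rightarrow> bool" where
  "data_setup \<rho>0 M F X0 W Z \<longleftrightarrow>
     prob_space M \<and> filtration_on M F \<and> brownian_motion M F W \<and>
     X0 \<in> borel_measurable (F 0) \<and>
     distr M borel X0 = density lborel (\<lambda>x. ennreal (\<rho>0 x)) \<and>
     integrable M (\<lambda>\<omega>. (X0 \<omega>)\<^sup>2) \<and>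
     Z \<in> borel_measurable M \<and>
     distr M borel Z = density lborel (\<lambda>x. ennreal (exponential_density 1 x)) \<and>
     prob_space.indep_sets M
       (\<lambda>i::nat. if i = 0 then gen_sigma M {X0}
                 else if i = 1 then gen_sigma M {W t | t. 0 \<le> t}
                 else gen_sigma M {Z}) {0, 1, 2}"

text \<open>The cemetery state \<Delta> is represented by None; the killed process is
  X_t = Some (Y_t) for t < tau and X_t = None (= \<Delta>) for t \<ge> tau.\<close>
definition killed :: "('a \<Rightarrow> ereal) \<Rightarrow> (real \<Rightarrow> 'a \<Rightarrow> real) \<Rightarrow> real \<Rightarrow> 'a \<Rightarrow> real option" where
  "killed \<tau> Y t \<omega> = (if ereal t < \<tau> \<omega> then Some (Y t \<omega>) else None)"

definition nu :: "'a measure \<Rightarrow> ('a \<Rightarrow> ereal) \<Rightarrow> (real \<Rightarrow> 'a \<Rightarrow> real) \<Rightarrow> real \<Rightarrow> real measure" where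
  "nu M \<tau> Y t = distr (density M (indicator {\<omega> \<in> space M. ereal t < \<tau> \<omega>})) borel (Y t)"

definition conv :: "(real \<Rightarrow> real) \<Rightarrow> real measure \<Rightarrow> real \<Rightarrow> real" where
  "conv f \<mu> x = (\<integral>y. f (x - y) \<partial>\<mu>)"

definition conv_D :: "(real \<Rightarrow> real) \<Rightarrow> real measure \<Rightarrow> real option \<Rightarrow> real" where
  "conv_D f \<mu> z = (case z of None \<Rightarrow> 0 | Some x \<Rightarrow> conv f \<mu> x)"

definition int_conv :: "(real \<Rightarrow> real) \<Rightarrow> 'a measure \<Rightarrow> ('a \<Rightarrow> ereal) \<Rightarrow> (real \<Rightarrow> 'a \<Rightarrow> real)
    \<Rightarrow> real \<Rightarrow> 'a \<Rightarrow> real" where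
  "int_conv f M \<tau> Y s \<omega> = integral {0..s} (\<lambda>r. conv_D f (nu M \<tau> Y r) (killed \<tau> Y s \<omega>))"

definition drift :: "real \<Rightarrow> real \<Rightarrow> real \<Rightarrow> real \<Rightarrow> real \<Rightarrow> real \<Rightarrow> real" where
  "drift lam c0 \<phi>0 \<phi>1 x y =
     - \<phi>1 * lam * c0 * (exp (- lam * x) * y) / (\<phi>0 + \<phi>1 * c0 * exp (- lam * x))"

definition kmv_solution ::
  "real \<Rightarrow> (real \<Rightarrow> real) \<Rightarrow> real \<Rightarrow> real \<Rightarrow> real \<Rightarrow> real \<Rightarrow>
   'a measure \<Rightarrow> ('a \<Rightarrow> real) \<Rightarrow> (real \<Rightarrow> 'a \<Rightarrow> real) \<Rightarrow> ('a \<Rightarrow> real) \<Rightarrow>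
   (real \<Rightarrow> 'a \<Rightarrow> real) \<Rightarrow> ('a \<Rightarrow> ereal) \<Rightarrow> bool" where
  "kmv_solution T K lam c0 \<phi>0 \<phi>1 M X0 W Z Y \<tau> \<longleftrightarrow>
     (\<forall>t\<in>{0..T}. Y t \<in> borel_measurable M) \<and> \<tau> \<in> borel_measurable M \<and>
     (AE \<omega> in M. \<forall>t\<in>{0..T}. ereal t < \<tau> \<omega> \<longrightarrow>
        (\<lambda>s. drift lam c0 \<phi>0 \<phi>1 (int_conv K M \<tau> Y s \<omega>) (int_conv (deriv K) M \<tau> Y s \<omega>))
           integrable_on {0..t} \<and>
        Y t \<omega> = X0 \<omega> + integral {0..t}
           (\<lambda>s. drift lam c0 \<phi>0 \<phi>1 (int_conv K M \<tau> Y s \<omega>) (int_conv (deriv K) M \<tau> Y s \<omega>))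
           + sqrt 2 * W t \<omega>) \<and>
     (AE \<omega> in M. (\<forall>t\<in>{0..T}. (\<lambda>s. lam * c0 * exp (- lam * int_conv K M \<tau> Y s \<omega>)) integrable_on {0..t}) \<and>
        \<tau> \<omega> = Inf {ereal t | t. t \<in> {0..T} \<and>
              integral {0..t} (\<lambda>s. lam * c0 * exp (- lam * int_conv K M \<tau> Y s \<omega>)) \<ge> Z \<omega>})"

definition natural_filtration :: "'a measure \<Rightarrow> ('a \<Rightarrow> real) \<Rightarrow> (real \<Rightarrow> 'a \<Rightarrow> real) \<Rightarrow> ('a \<Rightarrow> real)
    \<Rightarrow> real \<Rightarrow> 'a set set" where
  "natural_filtration M X0 W Z t =
     sigma_sets (space M)
       ((\<Union>V\<in>{X0, Z} \<union> {W s | s. 0 \<le> s \<and> s \<le> t}. {V -` A \<inter> space M | A. A \<in> sets borel})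
        \<union> null_sets M)"

definition strong_kmv_solution ::
  "real \<Rightarrow> (real \<Rightarrow> real) \<Rightarrow> real \<Rightarrow> real \<Rightarrow> real \<Rightarrow> real \<Rightarrow>
   'a measure \<Rightarrow> ('a \<Rightarrow> real) \<Rightarrow> (real \<Rightarrow> 'a \<Rightarrow> real) \<Rightarrow> ('a \<Rightarrow> real) \<Rightarrow>
   (real \<Rightarrow> 'a \<Rightarrow> real) \<Rightarrow> ('a \<Rightarrow> ereal) \<Rightarrow> bool" where
  "strong_kmv_solution T K lam c0 \<phi>0 \<phi>1 M X0 W Z Y \<tau> \<longleftrightarrow>
     kmv_solution T K lam c0 \<phi>0 \<phi>1 M X0 W Z Y \<tau> \<and>
     (\<forall>t\<in>{0..T}. \<forall>A\<in>sets borel. Y t -` A \<inter> space M \<in> natural_filtration M X0 W Z t) \<and>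
     (\<forall>t\<in>{0..T}. {\<omega>\<in>space M. \<tau> \<omega> \<le> ereal t} \<in> natural_filtration M X0 W Z t)"

definition weak_kmv_solution ::
  "real \<Rightarrow> (real \<Rightarrow> real) \<Rightarrow> real \<Rightarrow> real \<Rightarrow> real \<Rightarrow> real \<Rightarrow> (real \<Rightarrow> real) \<Rightarrow>
   'a measure \<Rightarrow> (real \<Rightarrow> 'a measure) \<Rightarrow> ('a \<Rightarrow> real) \<Rightarrow> (real \<Rightarrow> 'a \<Rightarrow> real) \<Rightarrow> ('a \<Rightarrow> real) \<Rightarrow>
   (real \<Rightarrow> 'a \<Rightarrow> real) \<Rightarrow> ('a \<Rightarrow> ereal) \<Rightarrow> bool" where
  "weak_kmv_solution T K lam c0 \<phi>0 \<phi>1 \<rho>0 M F X0 W Z Y \<tau> \<longleftrightarrow>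
     data_setup \<rho>0 M F X0 W Z \<and> kmv_solution T K lam c0 \<phi>0 \<phi>1 M X0 W Z Y \<tau>"

definition borel_Delta :: "real option measure" where
  "borel_Delta = sigma UNIV (insert {None} ((`) Some ` sets borel))"

definition path_law :: "real \<Rightarrow> 'a measure \<Rightarrow> ('a \<Rightarrow> ereal) \<Rightarrow> (real \<Rightarrow> 'a \<Rightarrow> real)
    \<Rightarrow> (real \<Rightarrow> real option) measure" where
  "path_law T M \<tau> Y = distr M (PiM {0..T} (\<lambda>_. borel_Delta)) (\<lambda>\<omega>. \<lambda>t\<in>{0..T}. killed \<tau> Y t \<omega>)"

end

theory Submission
  imports Defs
begin

text \<open>
  The law of the killed process enters the equation only through the deterministic field
  F(s, x) = (u, v)(s, x), where u(s, x) is the integral of K * nu_r(x) over r in [0, s] and v is the same with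
  the derivative of K; killing keeps every such F bounded and Lipschitz in (s, x). For a given
  F the equation has additive noise, so it is a Lipschitz integral equation path by path, and killing means that
  the clock, the integral of the intensity along the path, reaches Z. Solutions therefore correspond to fixed
  points of the map \<Phi> which sends F to the field of the killed process driven by F.

  If two fields differ by at most A e^(beta s), then so do, up to a factor C / beta, the driven paths and their
  clocks, and this bound is deterministic. Z is exponential and independent of the clock, so it
  falls between two clocks at distance d with probability at most 2 d. Hence \<Phi> contracts a weighted supremum
  norm for large beta, which gives existence and pathwise uniqueness.

  The driven path is built from Riemann sums and sequential limits, hence it is a measurable
  functional of the initial value and the driving path up to time t. This yields adaptedness,
  independence of Z, and the fact that \<Phi> and the law of the killed process depend only on the law of
  (X_0, W, Z), which is determined by the setup; so solutions on different spaces have the same law.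
\<close>

section \<open>Weighted Picard iteration\<close>

text \<open>Killing is discontinuous in the path: two nearly equal clocks may kill one process and
  spare the other, and then the killed states are not close at all. Comparing processes path by path
  therefore gives no contraction. Deterministic fields can be compared, since in them the indicator
  of survival is averaged.

  Two further obstacles shape the set-up. The equation fixes the state only before killing, while
  the clock in the definition of \<tau> continues afterwards with the cemetery rate
  \<open>lam * c0\<close>; it coincides with the clock of the driven path only up to \<tau>. And the
  law field is a time integral of expectations whose integrability is not part of the notion of
  solution: it has to be read off from right continuity of the killed paths, before anything is
  known about the regularity of the drift.\<close>

lemma weighted_picard:
  fixes \<Phi> :: "('i \<Rightarrow> 'c::banach) \<Rightarrow> 'i \<Rightarrow> 'c" and wt :: "'i \<Rightarrow> real"
  assumes maps: "\<And>f. f \<in> S \<Longrightarrow> \<Phi> f \<in> S"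
    and contr: "\<And>f g A. f \<in> S \<Longrightarrow> g \<in> S \<Longrightarrow> 0 \<le> A \<Longrightarrow> (\<And>i. i \<in> D \<Longrightarrow> norm (f i - g i) \<le> A * wt i)
        \<Longrightarrow> (\<And>i. i \<in> D \<Longrightarrow> norm (\<Phi> f i - \<Phi> g i) \<le> A / 2 * wt i)"
    and closed: "\<And>fs f. (\<And>n::nat. fs n \<in> S) \<Longrightarrow> uniform_limit D fs f sequentially \<Longrightarrow> f \<in> S"
    and wt: "\<And>i. i \<in> D \<Longrightarrow> 0 \<le> wt i" "\<And>i. i \<in> D \<Longrightarrow> wt i \<le> C"
    and f0: "f0 \<in> S" "0 \<le> A" "\<And>i. i \<in> D \<Longrightarrow> norm (\<Phi> f0 i - f0 i) \<le> A * wt i"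
  defines "f \<equiv> (\<lambda>i. lim (\<lambda>n. (\<Phi> ^^ n) f0 i))"
  shows "f \<in> S" "\<And>i. i \<in> D \<Longrightarrow> \<Phi> f i = f i"
proof -
  \<comment> \<open>The geometric series is summed by hand because norms are controlled on
    \<open>D\<close> only: elements of \<open>S\<close> are arbitrary functions elsewhere, so the
    weighted bound is no metric on \<open>S\<close>. The limit is the explicit \<open>lim\<close> of
    the iterates, the form in which \<open>flow\<close> is defined.\<close>
  define g where "g n = (\<Phi> ^^ n) f0" for n
  have gS: "g n \<in> S" for n by (induction n) (auto simp: g_def f0 maps)
  have step: "norm (g (Suc n) i - g n i) \<le> A / 2 ^ n * wt i" if "i \<in> D" for n i
    using that
  proof (induction n arbitrary: i)
    case (Suc n)
    have "norm (\<Phi> (g (Suc n)) i - \<Phi> (g n) i) \<le> (A / 2 ^ n) / 2 * wt i"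
      by (rule contr[OF gS gS _ Suc.IH Suc.prems]) (use f0 in auto)
    then show ?case by (simp add: g_def field_simps)
  qed (use f0 in \<open>simp add: g_def\<close>)
  \<comment> \<open>\<open>1 - 1 / 2 ^ k\<close> is the partial geometric sum; it lets the induction
    on \<open>k\<close> close and is estimated by 1 in \<open>tail'\<close>.\<close>
  have tail: "norm (g (n + k) i - g n i) \<le> 2 * A / 2 ^ n * (1 - 1 / 2 ^ k) * wt i" if i: "i \<in> D" for n k i
  proof (induction k)
    case (Suc k)
    have "norm (g (n + Suc k) i - g n i) \<le> norm (g (Suc (n + k)) i - g (n+k) i) + norm (g (n + k) i - g n i)"
      using norm_triangle_ineq[of "g (Suc (n + k)) i - g (n + k) i" "g (n + k) i - g n i"] by simp
    also have "\<dots> \<le> A / 2 ^ (n + k) * wt i + 2 * A / 2 ^ n * (1 - 1 / 2 ^ k) * wt i"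
      by (intro add_mono step Suc i)
    also have "\<dots> = 2 * A / 2 ^ n * (1 - 1 / 2 ^ Suc k) * wt i"
      by (simp add: field_simps power_add)
    finally show ?case .
  qed simp
  have tail': "norm (g m i - g n i) \<le> 2 * A / 2 ^ n * wt i" if i: "i \<in> D" and "n \<le> m" for n m i
  proof -
    obtain k where m: "m = n + k" using \<open>n \<le> m\<close> le_Suc_ex by blast
    have "2 * A / 2 ^ n * (1 - 1 / 2 ^ k) * wt i \<le> 2 * A / 2 ^ n * 1 * wt i"
      by (intro mult_right_mono mult_left_mono) (use f0 wt i in auto)
    with tail[OF i, of n k] show ?thesis by (simp add: m)
  qed
  have zero: "(\<lambda>n. 2 * A / 2 ^ n * c) \<longlonglongrightarrow> 0" for c :: real
  proof -
    have "(\<lambda>n. 2 * A * c * (1 / 2) ^ n) \<longlonglongrightarrow> 2 * A * c * 0"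
      by (intro tendsto_mult_left LIMSEQ_power_zero) auto
    then show ?thesis by (simp add: field_simps)
  qed
  have conv: "(\<lambda>n. g n i) \<longlonglongrightarrow> f i" if i: "i \<in> D" for i
  proof -
    have "Cauchy (\<lambda>n. g n i)"
    proof (rule CauchyI')
      fix e :: real assume "0 < e"
      with zero[of "wt i"] have "\<forall>\<^sub>F n in sequentially. 2 * A / 2 ^ n * wt i < e"
        by (rule order_tendstoD(2))
      then obtain N where N: "\<And>n. n \<ge> N \<Longrightarrow> 2 * A / 2 ^ n * wt i < e"
        by (auto simp: eventually_sequentially)
      have "dist (g m i) (g n i) < e" if "m \<ge> N" "m < n" for m n
        using tail'[OF i, of m n] N[of m] that by (simp add: dist_norm norm_minus_commute)
      then show "\<exists>M. \<forall>m\<ge>M. \<forall>n>m. dist (g m i) (g n i) < e" by blast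
    qed
    then have "convergent (\<lambda>n. g n i)" by (rule Cauchy_convergent)
    then show ?thesis unfolding f_def g_def by (simp add: convergent_LIMSEQ_iff)
  qed
  have lim: "norm (f i - g n i) \<le> 2 * A / 2 ^ n * wt i" if i: "i \<in> D" for n i
  proof (rule Lim_norm_ubound)
    show "(\<lambda>m. g m i - g n i) \<longlonglongrightarrow> f i - g n i" by (intro tendsto_intros conv i)
    show "\<forall>\<^sub>F m in sequentially. norm (g m i - g n i) \<le> 2 * A / 2 ^ n * wt i"
      using tail'[OF i] by (auto simp: eventually_sequentially)
  qed simp
  have "uniform_limit D g f sequentially"
  proof (rule uniform_limitI)
    fix e :: real assume "0 < e"
    with zero[of C] have "\<forall>\<^sub>F n in sequentially. 2 * A / 2 ^ n * C < e" by (rule order_tendstoD(2))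
    then show "\<forall>\<^sub>F n in sequentially. \<forall>i\<in>D. dist (g n i) (f i) < e"
    proof eventually_elim
      case (elim n)
      have "dist (g n i) (f i) \<le> 2 * A / 2 ^ n * C" if i: "i \<in> D" for i
        using lim[OF i, of n] mult_left_mono[OF wt(2)[OF i], of "2 * A / 2 ^ n"] f0(2)
        by (simp add: dist_norm norm_minus_commute)
      with elim show ?case by force
    qed
  qed
  then show fS: "f \<in> S" by (rule closed[OF gS])
  show "\<Phi> f i = f i" if i: "i \<in> D" for i
  proof (rule LIMSEQ_unique)
    show "(\<lambda>n. g (Suc n) i) \<longlonglongrightarrow> f i" using conv[OF i] by (rule LIMSEQ_Suc)
    have "norm (g (Suc n) i - \<Phi> f i) \<le> 2 * A / 2 ^ n * wt i" for n
    proof -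
      have "norm (\<Phi> f i - \<Phi> (g n) i) \<le> (2 * A / 2 ^ n) / 2 * wt i"
        by (rule contr[OF fS gS _ lim i]) (use f0 in auto)
      also have "\<dots> \<le> 2 * A / 2 ^ n * wt i" using f0 wt(1)[OF i] by (simp add: field_simps)
      finally show ?thesis by (simp add: g_def norm_minus_commute)
    qed
    then have "(\<lambda>n. g (Suc n) i - \<Phi> f i) \<longlonglongrightarrow> 0"
      by (intro Lim_null_comparison[OF _ zero[of "wt i"]]) simp
    then show "(\<lambda>n. g (Suc n) i) \<longlonglongrightarrow> \<Phi> f i" by (subst Lim_null)
  qed
qed

text \<open>Halving \<open>n\<close> times gives the bound \<open>A / 2 ^ n\<close>, which tends to
  0; the a priori bound \<open>A\<close> starts the iteration. Contraction is asked for the pair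
  \<open>f\<close>, \<open>g\<close> alone, which covers functions that are fixed points only on
  \<open>D\<close>.\<close>

lemma weighted_picard_unique:
  fixes f g :: "'i \<Rightarrow> 'c::real_normed_vector" and wt :: "'i \<Rightarrow> real"
  assumes contr: "\<And>A i. 0 \<le> A \<Longrightarrow> (\<And>i. i \<in> D \<Longrightarrow> norm (f i - g i) \<le> A * wt i)
        \<Longrightarrow> i \<in> D \<Longrightarrow> norm (f i - g i) \<le> A / 2 * wt i"
    and A: "0 \<le> A" "\<And>i. i \<in> D \<Longrightarrow> norm (f i - g i) \<le> A * wt i" and i: "i \<in> D"
  shows "f i = g i"
proof -
  have *: "norm (f i - g i) \<le> A / 2 ^ n * wt i" if "i \<in> D" for i n
    using that
  proof (induction n arbitrary: i)
    case (Suc n)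
    have "norm (f i - g i) \<le> (A / 2 ^ n) / 2 * wt i" 
      by (rule contr[OF _ Suc.IH Suc.prems]) (use A in auto)
    then show ?case by (simp add: field_simps)
  qed (use A in simp)
  have "(\<lambda>n. A * wt i * (1 / 2) ^ n) \<longlonglongrightarrow> A * wt i * 0"
    by (intro tendsto_mult_left LIMSEQ_power_zero) auto
  then have "(\<lambda>n. A / 2 ^ n * wt i) \<longlonglongrightarrow> 0" by (simp add: field_simps)
  then have "norm (f i - g i) \<le> 0"
    by (rule tendsto_lowerbound) (use *[OF i] in auto)
  then show ?thesis by simp
qed

section \<open>Riemann integrals as limits of sums\<close>

text \<open>A sequential limit of finite sums of values of \<open>g\<close>: measurability in a
  parameter is inherited from the single \<open>g s\<close>, with no joint measurability in time.
  \<open>Suc n\<close> keeps the denominator away from zero.\<close>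

definition rint :: "real \<Rightarrow> (real \<Rightarrow> real) \<Rightarrow> real" where
  "rint t g = lim (\<lambda>n. t / real (Suc n) * (\<Sum>i<Suc n. g (real i * t / real (Suc n))))"

lemma rint_eq_integral:
  assumes t: "0 \<le> t" and g: "continuous_on {0..t} g"
  shows "rint t g = integral {0..t} g"
proof -
  let ?R = "\<lambda>n. t / real (Suc n) * (\<Sum>i<Suc n. g (real i * t / real (Suc n)))"
  have "?R \<longlonglongrightarrow> integral {0..t} g"
  proof (rule LIMSEQ_I)
    fix e :: real assume e: "0 < e"
    \<comment> \<open>The cells together contribute at most \<open>t * e'\<close>; the
      \<open>+ 1\<close> keeps this strictly below \<open>e\<close> and allows
      \<open>t = 0\<close>.\<close>
    define e' where "e' = e / (t + 1)"
    have e': "0 < e'" using e t by (simp add: e'_def)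
    have "uniformly_continuous_on {0..t} g" by (rule compact_uniformly_continuous[OF g]) simp
    then obtain d where d: "d > 0" "\<And>x y. x \<in> {0..t} \<Longrightarrow> y \<in> {0..t} \<Longrightarrow> \<bar>x - y\<bar> < d \<Longrightarrow> \<bar>g x - g y\<bar> < e'"
      using e' unfolding uniformly_continuous_on_def dist_real_def by metis
    obtain N :: nat where N: "t / d < real N" using reals_Archimedean2 by blast
    have "norm (?R n - integral {0..t} g) < e" if n: "n \<ge> N" for n
    proof -
      define \<delta> where "\<delta> = t / real (Suc n)"
      have \<delta>: "0 \<le> \<delta>" "\<delta> < d" "real (Suc n) * \<delta> = t"
      proof -
        have "t / d < real (Suc n)" using N n by linarith
        then show "\<delta> < d" using d(1) by (simp add: \<delta>_def field_simps)
      qed (use t in \<open>auto simp: \<delta>_def\<close>)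
      have "\<bar>integral {0..real k * \<delta>} g - \<delta> * (\<Sum>i<k. g (real i * \<delta>))\<bar> \<le> real k * \<delta> * e'" if "k \<le> Suc n" for k
        using that
      proof (induction k)
        case (Suc k)
        have le: "real k * \<delta> \<le> real (Suc k) * \<delta>" "real (Suc k) * \<delta> \<le> t" "0 \<le> real k * \<delta>"
          using \<delta> Suc.prems mult_right_mono[of "real (Suc k)" "real (Suc n)" \<delta>] by (auto simp: algebra_simps)
        have int: "g integrable_on {0..real (Suc k) * \<delta>}" "g integrable_on {real k * \<delta>..real (Suc k) * \<delta>}"
          by (rule integrable_continuous_real, rule continuous_on_subset[OF g], use le in auto)+
        have "integral {0..real (Suc k) * \<delta>} g = integral {0..real k * \<delta>} g + integral {real k * \<delta>..real (Suc k) * \<delta>} g"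
          using le int by (intro Henstock_Kurzweil_Integration.integral_combine[symmetric]) auto
        moreover have "\<bar>integral {real k * \<delta>..real (Suc k) * \<delta>} g - \<delta> * g (real k * \<delta>)\<bar> \<le> e' * \<delta>"
        proof -
          have "integral {real k * \<delta>..real (Suc k) * \<delta>} g - \<delta> * g (real k * \<delta>)
              = integral {real k * \<delta>..real (Suc k) * \<delta>} (\<lambda>s. g s - g (real k * \<delta>))"
            using int(2) le(1) by (subst Henstock_Kurzweil_Integration.integral_diff) (auto simp: algebra_simps)
          also have "norm \<dots> \<le> e' * (real (Suc k) * \<delta> - real k * \<delta>)"
          proof (rule integral_bound)
            show "continuous_on {real k * \<delta>..real (Suc k) * \<delta>} (\<lambda>s. g s - g (real k * \<delta>))"
              by (intro continuous_intros continuous_on_subset[OF g]) (use le in auto)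
            show "norm (g s - g (real k * \<delta>)) \<le> e'" if "s \<in> {real k * \<delta>..real (Suc k) * \<delta>}" for s
            proof -
              have "real k * \<delta> \<le> s" "s \<le> real k * \<delta> + \<delta>" using that by (auto simp: distrib_right)
              then have "\<bar>g s - g (real k * \<delta>)\<bar> < e'"
                by (intro d(2)) (use le \<delta>(1,2) that in \<open>simp_all only: atLeastAtMost_iff, linarith+\<close>)
              then show ?thesis by simp
            qed
          qed (use le in auto)
          finally show ?thesis by (simp add: algebra_simps)
        qed
        ultimately show ?case using Suc by (simp add: algebra_simps)
      qed simp
      from this[of "Suc n"] \<delta>(3) have "\<bar>integral {0..t} g - \<delta> * (\<Sum>i<Suc n. g (real i * \<delta>))\<bar> \<le> t * e'"
        by simp
      moreover have "t * e' < e" using e t by (simp add: e'_def field_simps)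
      ultimately show ?thesis by (simp add: \<delta>_def abs_minus_commute)
    qed
    then show "\<exists>no. \<forall>n\<ge>no. norm (?R n - integral {0..t} g) < e" by blast
  qed
  then show ?thesis unfolding rint_def by (rule limI)
qed

lemma rint_arg: "0 \<le> t \<Longrightarrow> i < Suc n \<Longrightarrow> real i * t / real (Suc n) \<in> {0..t}"
  using mult_left_mono[of "real i" "real (Suc n)" t] by (auto simp: field_simps)

lemma rint_cong: "0 \<le> t \<Longrightarrow> (\<And>s. s \<in> {0..t} \<Longrightarrow> g s = g' s) \<Longrightarrow> rint t g = rint t g'"
  unfolding rint_def using rint_arg by (auto intro!: arg_cong[where f=lim] ext sum.cong)

lemma measurable_rint:
  assumes "0 \<le> t" "\<And>s. s \<in> {0..t} \<Longrightarrow> (\<lambda>\<omega>. g \<omega> s) \<in> borel_measurable N"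
  shows "(\<lambda>\<omega>. rint t (g \<omega>)) \<in> borel_measurable N"
  unfolding rint_def using rint_arg[OF assms(1)] assms(2)
  by (intro borel_measurable_lim_metric borel_measurable_times borel_measurable_const borel_measurable_sum) auto

section \<open>Additive-noise integral equations, path by path\<close>

text \<open>Integrating the weight gains the factor \<open>1 / \<beta>\<close>. A large
  \<open>\<beta>\<close> thus makes the later estimates contract on the whole of [0, T] at once,
  without cutting it into short intervals.\<close>

lemma norm_integral_exp_le:
  fixes f :: "real \<Rightarrow> 'b::banach"
  assumes "f integrable_on {0..t}" "0 \<le> t" "0 < \<beta>" "0 \<le> A"
    and le: "\<And>s. s \<in> {0..t} \<Longrightarrow> norm (f s) \<le> A * exp (\<beta> * s)"
  shows "norm (integral {0..t} f) \<le> A / \<beta> * exp (\<beta> * t)"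
proof -
  have I: "((\<lambda>s. A * exp (\<beta> * s)) has_integral (A / \<beta> * exp (\<beta> * t) - A / \<beta> * exp (\<beta> * 0))) {0..t}"
    by (rule fundamental_theorem_of_calculus)
       (use assms in \<open>auto intro!: derivative_eq_intros simp: has_real_derivative_iff_has_vector_derivative[symmetric]\<close>)
  have "norm (integral {0..t} f) \<le> integral {0..t} (\<lambda>s. A * exp (\<beta> * s))"
    using I assms(1) le by (intro integral_norm_bound_integral) auto
  also have "\<dots> \<le> A / \<beta> * exp (\<beta> * t)" using assms(3,4) by (subst integral_unique[OF I]) auto
  finally show ?thesis .
qed

definition picard :: "(real \<Rightarrow> real \<Rightarrow> real) \<Rightarrow> real \<Rightarrow> (real \<Rightarrow> real) \<Rightarrow> (real \<Rightarrow> real) \<Rightarrow> real \<Rightarrow> real" where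
  "picard B x0 w f t = x0 + rint t (\<lambda>s. B s (f s)) + sqrt 2 * w t"

text \<open>Built from Riemann sums and limits of sequences only, so that it is measurable with respect to every
  sigma-algebra which makes the initial value and the single \<^term>\<open>w s\<close> measurable, without any
  continuity in time.\<close>
definition flow :: "(real \<Rightarrow> real \<Rightarrow> real) \<Rightarrow> real \<Rightarrow> (real \<Rightarrow> real) \<Rightarrow> real \<Rightarrow> real" where
  "flow B x0 w t = lim (\<lambda>n. (picard B x0 w ^^ n) (\<lambda>t. x0 + sqrt 2 * w t) t)"

text \<open>Every iterate at time \<open>s\<close> looks at the data on [0, s] only. Hence fields
  need to agree only on [0, T], and the driving path may be any function on the reals: its negative
  arguments later store \<open>X0\<close> and \<open>Z\<close>.\<close>

lemma flow_cong:
  assumes t: "0 \<le> t" and eq: "\<And>s. s \<in> {0..t} \<Longrightarrow> w s = w' s" "\<And>s x. s \<in> {0..t} \<Longrightarrow> B s x = B' s x"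
  shows "flow B x0 w t = flow B' x0 w' t"
proof -
  have "(picard B x0 w ^^ n) (\<lambda>t. x0 + sqrt 2 * w t) s = (picard B' x0 w' ^^ n) (\<lambda>t. x0 + sqrt 2 * w' t) s"
    if "s \<in> {0..t}" for n s
    using that
  proof (induction n arbitrary: s)
    case (Suc n)
    then show ?case by (auto simp: picard_def eq intro!: rint_cong)
  qed (simp add: eq)
  then show ?thesis using t by (simp add: flow_def)
qed

lemma measurable_flow:
  assumes t: "0 \<le> t" and [measurable]: "X0 \<in> borel_measurable N"
    and W: "\<And>s. s \<in> {0..t} \<Longrightarrow> W s \<in> borel_measurable N"
    and B: "\<And>s. s \<in> {0..t} \<Longrightarrow> B s \<in> borel_measurable borel"
  shows "(\<lambda>\<omega>. flow B (X0 \<omega>) (\<lambda>s. W s \<omega>) t) \<in> borel_measurable N"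
proof -
  define P where "P n \<omega> = (picard B (X0 \<omega>) (\<lambda>s. W s \<omega>) ^^ n) (\<lambda>t. X0 \<omega> + sqrt 2 * W t \<omega>)" for n \<omega>
  have P_Suc: "P (Suc n) \<omega> s = X0 \<omega> + rint s (\<lambda>r. B r (P n \<omega> r)) + sqrt 2 * W s \<omega>" for n \<omega> s
    by (simp add: P_def) (simp add: picard_def)
  have "(\<lambda>\<omega>. P n \<omega> s) \<in> borel_measurable N" if "s \<in> {0..t}" for n s
    using that
  proof (induction n arbitrary: s)
    case 0
    note [measurable] = W[OF 0]
    show ?case by (simp add: P_def)
  next
    case (Suc n)
    note [measurable] = W[OF Suc.prems]
    have "(\<lambda>\<omega>. B r (P n \<omega> r)) \<in> borel_measurable N" if "r \<in> {0..s}" for r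
      by (rule measurable_compose[OF Suc.IH B]) (use that Suc.prems in auto)
    then have [measurable]: "(\<lambda>\<omega>. rint s (\<lambda>r. B r (P n \<omega> r))) \<in> borel_measurable N"
      using Suc.prems by (intro measurable_rint) auto
    show ?case unfolding P_Suc by measurable
  qed
  then show ?thesis unfolding flow_def P_def[symmetric] using t by (intro borel_measurable_lim_metric) auto
qed

lemma flow_solves:
  assumes T: "0 \<le> T" and L: "0 \<le> L"
    and cont: "continuous_on ({0..T} \<times> UNIV) (\<lambda>(s, x). B s x)"
    and lip: "\<And>s x y. s \<in> {0..T} \<Longrightarrow> \<bar>B s x - B s y\<bar> \<le> L * \<bar>x - y\<bar>"
    and w: "continuous_on {0..T} w"
  shows "continuous_on {0..T} (flow B x0 w)"
    and "t \<in> {0..T} \<Longrightarrow> flow B x0 w t = x0 + integral {0..t} (\<lambda>s. B s (flow B x0 w s)) + sqrt 2 * w t"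
proof -
  \<comment> \<open>Makes the contraction factor \<open>L / \<beta>\<close> at most 1/2; the
    \<open>+ 1\<close> keeps \<open>\<beta>\<close> positive for \<open>L = 0\<close>.\<close>
  define \<beta> where "\<beta> = 2 * L + 1"
  have \<beta>: "0 < \<beta>" "L / \<beta> \<le> 1 / 2" using L by (auto simp: \<beta>_def field_simps)
  let ?S = "{f. continuous_on {0..T} f}" and ?f0 = "\<lambda>t. x0 + sqrt 2 * w t"
  have comp: "continuous_on {0..T} (\<lambda>s. B s (f s))" if "continuous_on {0..T} f" for f
  proof -
    have "continuous_on {0..T} (\<lambda>s. (s, f s))" by (intro continuous_intros that)
    from continuous_on_compose2[OF cont this] show ?thesis by auto
  qed
  have comp': "continuous_on {0..t} (\<lambda>s. B s (f s))" if "continuous_on {0..T} f" "t \<in> {0..T}" for f t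
    using comp[OF that(1)] by (rule continuous_on_subset) (use that in auto)
  have pic: "picard B x0 w f t = x0 + integral {0..t} (\<lambda>s. B s (f s)) + sqrt 2 * w t"
    if "continuous_on {0..T} f" "t \<in> {0..T}" for f t
    using rint_eq_integral[OF _ comp'[OF that]] that by (simp add: picard_def)
  have maps: "picard B x0 w f \<in> ?S" if f: "f \<in> ?S" for f
  proof -
    have "continuous_on {0..T} (\<lambda>t. x0 + integral {0..t} (\<lambda>s. B s (f s)) + sqrt 2 * w t)"
      using f comp by (intro continuous_intros w indefinite_integral_continuous_1 integrable_continuous_real) auto
    then have "continuous_on {0..T} (picard B x0 w f)"
      by (rule iffD2[OF continuous_on_cong[OF refl pic], rotated 2]) (use f in auto)
    then show ?thesis by simp
  qed
  have contr: "norm (picard B x0 w f t - picard B x0 w g t) \<le> A / 2 * exp (\<beta> * t)"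
    if f: "f \<in> ?S" and g: "g \<in> ?S" and A: "0 \<le> A"
      and le: "\<And>i. i \<in> {0..T} \<Longrightarrow> norm (f i - g i) \<le> A * exp (\<beta> * i)" and t: "t \<in> {0..T}" for f g A t
  proof -
    have cf: "continuous_on {0..t} (\<lambda>s. B s (f s))" and cg: "continuous_on {0..t} (\<lambda>s. B s (g s))"
      using f g t comp' by auto
    have "picard B x0 w f t - picard B x0 w g t = integral {0..t} (\<lambda>s. B s (f s) - B s (g s))"
      using f g t cf cg by (simp add: pic Henstock_Kurzweil_Integration.integral_diff integrable_continuous_real)
    also have "norm \<dots> \<le> (L * A) / \<beta> * exp (\<beta> * t)"
    proof (rule norm_integral_exp_le)
      fix s assume s: "s \<in> {0..t}"
      have "\<bar>B s (f s) - B s (g s)\<bar> \<le> L * \<bar>f s - g s\<bar>" using s t by (intro lip) auto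
      also have "\<dots> \<le> L * (A * exp (\<beta> * s))" using le[of s] s t L by (intro mult_left_mono) auto
      finally show "norm (B s (f s) - B s (g s)) \<le> L * A * exp (\<beta> * s)" by simp
    qed (use cf cg t \<beta> L A in \<open>auto intro!: integrable_continuous_real continuous_intros\<close>)
    also have "\<dots> \<le> A / 2 * exp (\<beta> * t)"
      using mult_right_mono[OF \<beta>(2) A] by (intro mult_right_mono) auto
    finally show ?thesis .
  qed
  have f0: "?f0 \<in> ?S" by (auto intro!: continuous_intros w)
  have "continuous_on {0..T} (\<lambda>t. picard B x0 w ?f0 t - ?f0 t)"
    using maps[OF f0] by (intro continuous_intros w) auto
  then have "bounded ((\<lambda>t. picard B x0 w ?f0 t - ?f0 t) ` {0..T})"
    by (intro compact_imp_bounded compact_continuous_image) auto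
  then obtain A where A: "\<And>t. t \<in> {0..T} \<Longrightarrow> norm (picard B x0 w ?f0 t - ?f0 t) \<le> A"
    unfolding bounded_iff by (meson imageI)
  have A0: "0 \<le> A" using order_trans[OF norm_ge_zero A[of 0]] T by simp
  have A': "norm (picard B x0 w ?f0 t - ?f0 t) \<le> A * exp (\<beta> * t)" if t: "t \<in> {0..T}" for t
    using A[OF t] mult_left_mono[of 1 "exp (\<beta> * t)" A] A0 t \<beta> by auto
  have closed: "f \<in> ?S" if "\<And>n::nat. fs n \<in> ?S" "uniform_limit {0..T} fs f sequentially" for fs f
    using uniform_limit_theorem[OF _ that(2)] that(1) by simp
  have flow: "flow B x0 w = (\<lambda>t. lim (\<lambda>n. (picard B x0 w ^^ n) ?f0 t))" by (simp add: fun_eq_iff flow_def)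
  have bd: "exp (\<beta> * t) \<le> exp (\<beta> * T)" if "t \<in> {0..T}" for t using that \<beta> by auto
  have P1: "flow B x0 w \<in> ?S"
    unfolding flow by (rule weighted_picard(1)[where D="{0..T}" and wt="\<lambda>t. exp (\<beta> * t)"])
      (fact maps, fact contr, fact closed, simp, fact bd, fact f0, fact A0, fact A')
  have P2: "picard B x0 w (flow B x0 w) t = flow B x0 w t" if "t \<in> {0..T}" for t
    unfolding flow by (rule weighted_picard(2)[where D="{0..T}" and wt="\<lambda>t. exp (\<beta> * t)"])
      (fact maps, fact contr, fact closed, simp, fact bd, fact f0, fact A0, fact A', fact that)
  show c: "continuous_on {0..T} (flow B x0 w)" using P1 by auto
  show "flow B x0 w t = x0 + integral {0..t} (\<lambda>s. B s (flow B x0 w s)) + sqrt 2 * w t" if t: "t \<in> {0..T}"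
    using P2[OF t] pic[OF c t] by auto
qed

text \<open>Gronwall by a maximum: the largest weighted difference \<open>a\<close> exists by
  compactness and satisfies \<open>a \<le> (L * a + A) / \<beta>\<close>; since
  \<open>2 * L \<le> \<beta>\<close>, the term with \<open>L\<close> is absorbed at the price of a
  factor 2. With \<open>A = 0\<close> this is uniqueness, otherwise stability under a change of the
  field.\<close>

lemma solution_compare:
  fixes y1 y2 :: "real \<Rightarrow> real"
  assumes c: "continuous_on {0..t} y1" "continuous_on {0..t} y2"
    and cB: "continuous_on {0..t} (\<lambda>s. B1 s (y1 s))" "continuous_on {0..t} (\<lambda>s. B2 s (y2 s))"
    and y: "\<And>s. s \<in> {0..t} \<Longrightarrow> y1 s = x0 + integral {0..s} (\<lambda>r. B1 r (y1 r)) + sqrt 2 * w s"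
      "\<And>s. s \<in> {0..t} \<Longrightarrow> y2 s = x0 + integral {0..s} (\<lambda>r. B2 r (y2 r)) + sqrt 2 * w s"
    and lip: "\<And>s x y. s \<in> {0..t} \<Longrightarrow> \<bar>B1 s x - B1 s y\<bar> \<le> L * \<bar>x - y\<bar>"
    and diff: "\<And>s x. s \<in> {0..t} \<Longrightarrow> \<bar>B1 s x - B2 s x\<bar> \<le> A * exp (\<beta> * s)"
    and L: "0 \<le> L" "2 * L \<le> \<beta>" "0 < \<beta>" and A: "0 \<le> A" and s: "s \<in> {0..t}"
  shows "\<bar>y1 s - y2 s\<bar> \<le> 2 * A / \<beta> * exp (\<beta> * s)"
proof -
  have "continuous_on {0..t} (\<lambda>s. \<bar>y1 s - y2 s\<bar> * exp (- (\<beta> * s)))"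
    by (intro continuous_intros c)
  then obtain r where r: "r \<in> {0..t}"
      "\<And>s. s \<in> {0..t} \<Longrightarrow> \<bar>y1 s - y2 s\<bar> * exp (- (\<beta> * s)) \<le> \<bar>y1 r - y2 r\<bar> * exp (- (\<beta> * r))"
    using continuous_attains_sup[of "{0..t}" "\<lambda>s. \<bar>y1 s - y2 s\<bar> * exp (- (\<beta> * s))"] s by auto
  define a where "a = \<bar>y1 r - y2 r\<bar> * exp (- (\<beta> * r))"
  have a0: "0 \<le> a" by (simp add: a_def)
  have a: "\<bar>y1 s - y2 s\<bar> \<le> a * exp (\<beta> * s)" if "s \<in> {0..t}" for s
    using mult_right_mono[OF r(2)[OF that], of "exp (\<beta> * s)"]
    by (simp add: a_def[symmetric] mult.assoc exp_add[symmetric])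
  have sub: "continuous_on {0..r} (\<lambda>s. B1 s (y1 s))" "continuous_on {0..r} (\<lambda>s. B2 s (y2 s))"
    by (rule continuous_on_subset[OF cB(1)] continuous_on_subset[OF cB(2)], use r in auto)+
  have "y1 r - y2 r = integral {0..r} (\<lambda>s. B1 s (y1 s) - B2 s (y2 s))"
    using y[OF r(1)] sub by (simp add: Henstock_Kurzweil_Integration.integral_diff integrable_continuous_real)
  also have "norm \<dots> \<le> (L * a + A) / \<beta> * exp (\<beta> * r)"
  proof (rule norm_integral_exp_le)
    fix s assume "s \<in> {0..r}"
    then have s: "s \<in> {0..t}" using r by auto
    have "\<bar>B1 s (y1 s) - B2 s (y2 s)\<bar> \<le> L * \<bar>y1 s - y2 s\<bar> + A * exp (\<beta> * s)"
      using lip[OF s, of "y1 s" "y2 s"] diff[OF s, of "y2 s"] by linarith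
    also have "\<dots> \<le> L * (a * exp (\<beta> * s)) + A * exp (\<beta> * s)"
      using a[OF s] L by (intro add_right_mono mult_left_mono)
    finally show "norm (B1 s (y1 s) - B2 s (y2 s)) \<le> (L * a + A) * exp (\<beta> * s)"
      by (simp add: algebra_simps)
  qed (use sub r L A a0 in \<open>auto intro!: integrable_continuous_real continuous_intros\<close>)
  finally have "a \<le> (L * a + A) / \<beta>"
    using mult_right_mono[of "norm (y1 r - y2 r)" "(L * a + A) / \<beta> * exp (\<beta> * r)" "exp (- (\<beta> * r))"]
    by (simp add: a_def[symmetric] mult.assoc exp_add[symmetric])
  then have "a * \<beta> \<le> L * a + A" using L by (simp add: field_simps)
  moreover have "2 * (L * a) \<le> a * \<beta>" using mult_right_mono[OF L(2) a0] by (simp add: mult_ac)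
  ultimately have "a * \<beta> \<le> 2 * A" by linarith
  then have "a \<le> 2 * A / \<beta>" using L by (simp add: field_simps)
  then have "a * exp (\<beta> * s) \<le> 2 * A / \<beta> * exp (\<beta> * s)" by (rule mult_right_mono) simp
  with a[OF s] show ?thesis by linarith
qed

section \<open>First passage times\<close>

text \<open>Only times up to \<open>T\<close> compete, so a clock that stays below \<open>z\<close>
  gives the infimum of the empty set, infinity: this encodes survival through [0, T].\<close>

definition passage :: "real \<Rightarrow> (real \<Rightarrow> real) \<Rightarrow> real \<Rightarrow> ereal" where
  "passage T f z = Inf {ereal t | t. t \<in> {0..T} \<and> f t \<ge> z}"

lemma passage_le: "t \<in> {0..T} \<Longrightarrow> z \<le> f t \<Longrightarrow> passage T f z \<le> ereal t"
  unfolding passage_def by (intro Inf_lower) auto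

lemma passage_infinity:
  assumes "\<And>t. t \<in> {0..T} \<Longrightarrow> \<not> z \<le> f t"
  shows "passage T f z = \<infinity>"
proof -
  have "{ereal t | t. t \<in> {0..T} \<and> f t \<ge> z} = {}" using assms by blast
  then show ?thesis unfolding passage_def by (simp only: Inf_empty top_ereal_def)
qed

text \<open>The times in [0, t] with \<open>z \<le> f s\<close> form a compact set, so the infimum
  is a minimum; times beyond \<open>t\<close> cannot lower it.\<close>

lemma passage_attained:
  assumes f: "continuous_on {0..T} f" and t: "t \<in> {0..T}" "z \<le> f t"
  obtains t0 where "t0 \<in> {0..t}" "z \<le> f t0" "passage T f z = ereal t0"
proof -
  define A where "A = {s \<in> {0..t}. z \<le> f s}"
  have ct: "continuous_on {0..t} f" using f by (rule continuous_on_subset) (use t in auto)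
  have "closed A"
    using continuous_closed_preimage[OF ct, of "{z..}"] by (simp add: A_def vimage_def Int_def)
  moreover have "bounded A"
    by (rule bounded_subset[OF bounded_closed_interval[of 0 t]]) (auto simp: A_def)
  ultimately have "compact A" by (simp add: compact_eq_bounded_closed)
  moreover have "t \<in> A" using t by (auto simp: A_def)
  ultimately obtain t0 where t0: "t0 \<in> A" "\<And>s. s \<in> A \<Longrightarrow> t0 \<le> s"
    using compact_attains_inf[of A] by auto
  have "passage T f z = ereal t0"
  proof (rule antisym)
    show "passage T f z \<le> ereal t0" using t0 t by (intro passage_le) (auto simp: A_def)
    have "t0 \<le> s" if "s \<in> {0..T}" "z \<le> f s" for s
      using that t0 by (cases "s \<le> t") (auto simp: A_def)
    then show "ereal t0 \<le> passage T f z" unfolding passage_def by (intro Inf_greatest) auto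
  qed
  with t0 that show thesis by (auto simp: A_def)
qed

text \<open>Intended for \<open>g\<close> the clock in the definition of \<tau>, which runs on at
  another rate after killing, and \<open>f\<close> the clock along the uninterrupted path. At the
  passage time itself both still agree, so \<open>f\<close> has reached \<open>z\<close> there, and
  monotonicity keeps it above.\<close>

lemma less_passage_iff:
  assumes f: "continuous_on {0..T} f" and g: "continuous_on {0..T} g"
    and mono: "\<And>s t. 0 \<le> s \<Longrightarrow> s \<le> t \<Longrightarrow> t \<le> T \<Longrightarrow> f s \<le> f t"
    and eq: "\<And>t. t \<in> {0..T} \<Longrightarrow> ereal t \<le> passage T g z \<Longrightarrow> f t = g t" and t: "t \<in> {0..T}"
  shows "ereal t < passage T g z \<longleftrightarrow> f t < z"
proof
  assume *: "ereal t < passage T g z"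
  then have "\<not> z \<le> g t" using passage_le[OF t, of z g] by auto
  with eq[OF t] * show "f t < z" by simp
next
  assume *: "f t < z"
  show "ereal t < passage T g z"
  proof (rule ccontr)
    assume n: "\<not> ereal t < passage T g z"
    have "\<exists>s\<in>{0..T}. z \<le> g s"
    proof (rule ccontr)
      assume "\<not> ?thesis"
      then have "passage T g z = \<infinity>" by (intro passage_infinity) blast
      with n show False by simp
    qed
    then obtain s where "s \<in> {0..T}" "z \<le> g s" by blast
    then obtain t0 where t0: "t0 \<in> {0..s}" "z \<le> g t0" "passage T g z = ereal t0"
      by (rule passage_attained[OF g])
    with \<open>s \<in> {0..T}\<close> have t0: "t0 \<in> {0..T}" "z \<le> g t0" "passage T g z = ereal t0" by simp_all
    then have "z \<le> f t0" by (subst eq) simp_all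
    also have "\<dots> \<le> f t" using t0 n t by (intro mono) auto
    finally show False using * by simp
  qed
qed

text \<open>The counterpart for building a solution: now \<open>f\<close> is the clock of the driven
  path. Whatever \<open>g\<close> does after the passage time of \<open>f\<close> is harmless, since
  a later time cannot undercut that infimum.\<close>

lemma passage_cong:
  assumes f: "continuous_on {0..T} f"
    and eq: "\<And>t. t \<in> {0..T} \<Longrightarrow> ereal t \<le> passage T f z \<Longrightarrow> g t = f t"
  shows "passage T g z = passage T f z"
proof (rule antisym)
  show "passage T g z \<le> passage T f z"
  proof (cases "\<exists>t\<in>{0..T}. z \<le> f t")
    case True
    then obtain t where "t \<in> {0..T}" "z \<le> f t" by blast
    then obtain t0 where "t0 \<in> {0..t}" "z \<le> f t0" "passage T f z = ereal t0"
      by (rule passage_attained[OF f])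
    with \<open>t \<in> {0..T}\<close> have "t0 \<in> {0..T}" "z \<le> f t0" "passage T f z = ereal t0" by simp_all
    moreover then have "g t0 = f t0" by (intro eq) simp_all
    ultimately show ?thesis using passage_le[of t0 T z g] by simp
  next
    case False
    then have "passage T f z = \<infinity>" by (intro passage_infinity) blast
    then show ?thesis by simp
  qed
  have "passage T f z \<le> ereal t" if t: "t \<in> {0..T}" "z \<le> g t" for t
  proof (cases "ereal t \<le> passage T f z")
    case True
    with eq[OF t(1)] t(2) have "z \<le> f t" by simp
    then show ?thesis by (rule passage_le[OF t(1)])
  qed simp
  then show "passage T f z \<le> passage T g z" unfolding passage_def[of T g] by (intro Inf_greatest) auto
qed

section \<open>Flow and killing clock driven by a field\<close>

text \<open>The convolutions with \<open>K\<close> and with its derivative are bundled into one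
  field with values in \<open>'e\<close>, so that the estimates are done once. \<open>b\<close> and
  \<open>h\<close> turn a field value into drift and killing rate; \<open>\<kappa>\<close> is the
  bundled kernel.\<close>

locale killed_mv =
  fixes T Lb Lh Lk CK :: real and b h :: "'e::euclidean_space \<Rightarrow> real" and \<kappa> :: "real \<Rightarrow> 'e"
  assumes T_pos: "0 < T"
    and b_lip: "\<bar>b p - b q\<bar> \<le> Lb * norm (p - q)" and Lb: "0 \<le> Lb"
    and h_lip: "\<bar>h p - h q\<bar> \<le> Lh * norm (p - q)" and Lh: "0 \<le> Lh"
    and h_nonneg: "0 \<le> h p"
    and \<kappa>_lip: "norm (\<kappa> x - \<kappa> y) \<le> Lk * \<bar>x - y\<bar>" and Lk: "0 \<le> Lk"
    and \<kappa>_bound: "norm (\<kappa> x) \<le> CK"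
begin

lemma CK: "0 \<le> CK" using order_trans[OF norm_ge_zero \<kappa>_bound] .

text \<open>The constants are those of a time integral of kernel averages with mass at most one: the
  kernel bound \<open>CK\<close> becomes the Lipschitz constant in time, and the Lipschitz constant
  \<open>Lk\<close> of the kernel gives \<open>Lk * T\<close> in space.\<close>

definition adm :: "(real \<times> real \<Rightarrow> 'e) set" where
  "adm = {F. \<forall>s\<in>{0..T}. \<forall>x. norm (F (s, x)) \<le> CK * T \<and>
     (\<forall>s'\<in>{0..T}. \<forall>x'. norm (F (s, x) - F (s', x')) \<le> CK * \<bar>s - s'\<bar> + Lk * T * \<bar>x - x'\<bar>)}"

definition Y :: "(real \<times> real \<Rightarrow> 'e) \<Rightarrow> real \<Rightarrow> (real \<Rightarrow> real) \<Rightarrow> real \<Rightarrow> real" where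
  "Y F x0 w = flow (\<lambda>s x. b (F (s, x))) x0 w"

definition \<Lambda> :: "(real \<times> real \<Rightarrow> 'e) \<Rightarrow> real \<Rightarrow> (real \<Rightarrow> real) \<Rightarrow> real \<Rightarrow> real" where
  "\<Lambda> F x0 w t = rint t (\<lambda>s. h (F (s, Y F x0 w s)))"

lemma lipschitz_b: "Lb-lipschitz_on UNIV b"
  by (rule lipschitz_onI) (use b_lip Lb in \<open>auto simp: dist_norm\<close>)

lemma lipschitz_h: "Lh-lipschitz_on UNIV h"
  by (rule lipschitz_onI) (use h_lip Lh in \<open>auto simp: dist_norm\<close>)

lemma cont_\<kappa>: "continuous_on A \<kappa>"
proof -
  have "Lk-lipschitz_on UNIV \<kappa>"
    by (rule lipschitz_onI) (use \<kappa>_lip Lk in \<open>auto simp: dist_norm dist_real_def\<close>)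
  then show ?thesis using lipschitz_on_continuous_on continuous_on_subset by blast
qed

lemma measurable_\<kappa>[measurable]: "\<kappa> \<in> borel_measurable borel"
  by (intro borel_measurable_continuous_onI cont_\<kappa>)

lemma adm_lip: "F \<in> adm \<Longrightarrow> s \<in> {0..T} \<Longrightarrow> norm (F (s, x) - F (s, y)) \<le> Lk * T * \<bar>x - y\<bar>"
  unfolding adm_def by fastforce

lemma cont_adm:
  assumes "F \<in> adm"
  shows "continuous_on ({0..T} \<times> UNIV) F"
proof -
  have "(CK + Lk * T)-lipschitz_on ({0..T} \<times> UNIV) F"
  proof (rule lipschitz_onI)
    fix p q :: "real \<times> real" assume "p \<in> {0..T} \<times> UNIV" "q \<in> {0..T} \<times> UNIV"
    then have "dist (F p) (F q) \<le> CK * \<bar>fst p - fst q\<bar> + Lk * T * \<bar>snd p - snd q\<bar>"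
      using assms by (cases p; cases q) (auto simp: adm_def dist_norm)
    also have "\<dots> \<le> CK * dist p q + Lk * T * dist p q"
      using dist_fst_le[of p q] dist_snd_le[of p q] CK Lk T_pos
      by (intro add_mono mult_left_mono) (auto simp: dist_real_def)
    finally show "dist (F p) (F q) \<le> (CK + Lk * T) * dist p q" by (simp add: algebra_simps)
  qed (use CK Lk T_pos in auto)
  then show ?thesis by (rule lipschitz_on_continuous_on)
qed

lemma cont_comp:
  assumes F: "F \<in> adm" and y: "continuous_on A y" and A: "A \<subseteq> {0..T}"
  shows "continuous_on A (\<lambda>s. b (F (s, y s)))" "continuous_on A (\<lambda>s. h (F (s, y s)))"
proof -
  have "continuous_on A (\<lambda>s. (s, y s))" by (intro continuous_intros y)
  then have c: "continuous_on A (\<lambda>s. F (s, y s))"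
    by (rule continuous_on_compose2[OF cont_adm[OF F]]) (use A in auto)
  show "continuous_on A (\<lambda>s. b (F (s, y s)))" "continuous_on A (\<lambda>s. h (F (s, y s)))"
    using lipschitz_on_continuous_on[OF lipschitz_b] lipschitz_on_continuous_on[OF lipschitz_h]
    by (auto intro: continuous_on_compose2[OF _ c])
qed

lemma measurable_coeff:
  assumes F: "F \<in> adm" and s: "s \<in> {0..T}"
  shows "(\<lambda>x. b (F (s, x))) \<in> borel_measurable borel" "(\<lambda>x. h (F (s, x))) \<in> borel_measurable borel"
proof -
  have "continuous_on UNIV (\<lambda>x. (s, x))" by (intro continuous_intros)
  then have c: "continuous_on UNIV (\<lambda>x. F (s, x))"
    by (rule continuous_on_compose2[OF cont_adm[OF F]]) (use s in auto)
  show "(\<lambda>x. b (F (s, x))) \<in> borel_measurable borel" "(\<lambda>x. h (F (s, x))) \<in> borel_measurable borel"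
    using lipschitz_on_continuous_on[OF lipschitz_b] lipschitz_on_continuous_on[OF lipschitz_h]
    by (auto intro!: borel_measurable_continuous_onI intro: continuous_on_compose2[OF _ c])
qed

lemma drift_lip:
  assumes F: "F \<in> adm" and s: "s \<in> {0..T}"
  shows "\<bar>b (F (s, x)) - b (F (s, y))\<bar> \<le> Lb * (Lk * T) * \<bar>x - y\<bar>"
  using order_trans[OF b_lip mult_left_mono[OF adm_lip[OF F s] Lb]] by (simp add: mult.assoc)

lemma
  assumes "0 \<le> t" and "\<And>s. s \<in> {0..t} \<Longrightarrow> w s = w' s" and "\<And>s x. s \<in> {0..t} \<Longrightarrow> F (s, x) = F' (s, x)"
  shows Y_cong: "Y F x0 w t = Y F' x0 w' t" and \<Lambda>_cong: "\<Lambda> F x0 w t = \<Lambda> F' x0 w' t"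
proof -
  have *: "Y F x0 w s = Y F' x0 w' s" if "s \<in> {0..t}" for s
    unfolding Y_def using assms that by (intro flow_cong) auto
  then show "Y F x0 w t = Y F' x0 w' t" "\<Lambda> F x0 w t = \<Lambda> F' x0 w' t"
    using assms by (auto simp: \<Lambda>_def intro!: rint_cong)
qed

lemma
  assumes F: "F \<in> adm" and t: "t \<in> {0..T}" and "X0 \<in> borel_measurable N"
    and "\<And>s. s \<in> {0..t} \<Longrightarrow> W s \<in> borel_measurable N"
  shows measurable_Y: "(\<lambda>\<omega>. Y F (X0 \<omega>) (\<lambda>s. W s \<omega>) t) \<in> borel_measurable N"
    and measurable_\<Lambda>: "(\<lambda>\<omega>. \<Lambda> F (X0 \<omega>) (\<lambda>s. W s \<omega>) t) \<in> borel_measurable N"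
proof -
  have *: "(\<lambda>\<omega>. Y F (X0 \<omega>) (\<lambda>s. W s \<omega>) s) \<in> borel_measurable N" if "s \<in> {0..t}" for s
    unfolding Y_def using assms that by (intro measurable_flow measurable_coeff) auto
  then show "(\<lambda>\<omega>. Y F (X0 \<omega>) (\<lambda>s. W s \<omega>) t) \<in> borel_measurable N" using t by auto
  show "(\<lambda>\<omega>. \<Lambda> F (X0 \<omega>) (\<lambda>s. W s \<omega>) t) \<in> borel_measurable N"
    unfolding \<Lambda>_def using t
    by (intro measurable_rint measurable_compose[OF * measurable_coeff(2)[OF F]]) auto
qed

context
  fixes F :: "real \<times> real \<Rightarrow> 'e" and w :: "real \<Rightarrow> real"
  assumes F: "F \<in> adm" and w: "continuous_on {0..T} w"
begin

lemma cont_drift: "continuous_on ({0..T} \<times> UNIV) (\<lambda>(s, x). b (F (s, x)))"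
  using lipschitz_on_continuous_on[OF lipschitz_b] cont_adm[OF F]
  by (auto simp: split_def intro: continuous_on_compose2)

lemma
  shows cont_Y: "continuous_on {0..T} (Y F x0 w)"
    and Y_eq: "t \<in> {0..T} \<Longrightarrow> Y F x0 w t = x0 + integral {0..t} (\<lambda>s. b (F (s, Y F x0 w s))) + sqrt 2 * w t"
  unfolding Y_def
  using flow_solves[OF _ _ cont_drift drift_lip[OF F] w] Lb Lk T_pos by auto

lemma cont_hY: "continuous_on {0..T} (\<lambda>s. h (F (s, Y F x0 w s)))"
  by (rule cont_comp[OF F cont_Y]) simp

lemma \<Lambda>_eq: "t \<in> {0..T} \<Longrightarrow> \<Lambda> F x0 w t = integral {0..t} (\<lambda>s. h (F (s, Y F x0 w s)))"
  unfolding \<Lambda>_def by (intro rint_eq_integral continuous_on_subset[OF cont_hY]) auto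

lemma cont_\<Lambda>: "continuous_on {0..T} (\<Lambda> F x0 w)"
proof -
  have "continuous_on {0..T} (\<lambda>t. integral {0..t} (\<lambda>s. h (F (s, Y F x0 w s))))"
    by (intro indefinite_integral_continuous_1 integrable_continuous_real cont_hY)
  then show ?thesis by (rule iffD2[OF continuous_on_cong[OF refl \<Lambda>_eq], rotated]) auto
qed

lemma mono_\<Lambda>:
  assumes "0 \<le> s" "s \<le> t" "t \<le> T"
  shows "\<Lambda> F x0 w s \<le> \<Lambda> F x0 w t"
proof -
  have "integral {0..s} (\<lambda>s. h (F (s, Y F x0 w s))) \<le> integral {0..t} (\<lambda>s. h (F (s, Y F x0 w s)))"
    using assms h_nonneg
    by (intro integral_subset_le integrable_continuous_real continuous_on_subset[OF cont_hY]) auto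
  then show ?thesis using assms by (simp add: \<Lambda>_eq)
qed

text \<open>Posed on each [0, t] separately, because a solution obeys the equation only as long as
  it is alive.\<close>

lemma Y_unique:
  assumes t: "t \<in> {0..T}" and y: "continuous_on {0..t} y"
    and eq: "\<And>s. s \<in> {0..t} \<Longrightarrow> y s = x0 + integral {0..s} (\<lambda>r. b (F (r, y r))) + sqrt 2 * w s"
  shows "y t = Y F x0 w t"
proof -
  have sub: "{0..t} \<subseteq> {0..T}" using t by auto
  have cY: "continuous_on {0..t} (Y F x0 w)" by (rule continuous_on_subset[OF cont_Y sub])
  have Y': "Y F x0 w s = x0 + integral {0..s} (\<lambda>r. b (F (r, Y F x0 w r))) + sqrt 2 * w s"
    and lip: "\<bar>b (F (s, u)) - b (F (s, v))\<bar> \<le> Lb * (Lk * T) * \<bar>u - v\<bar>" if "s \<in> {0..t}" for s u v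
    using Y_eq drift_lip[OF F] that sub by blast+
  have "\<bar>y t - Y F x0 w t\<bar> \<le> 2 * 0 / (2 * (Lb * (Lk * T)) + 1) * exp ((2 * (Lb * (Lk * T)) + 1) * t)"
    by (rule solution_compare[where t=t and ?B1.0="\<lambda>s x. b (F (s, x))" and ?B2.0="\<lambda>s x. b (F (s, x))" and ?x0.0=x0 and w=w, OF y cY cont_comp(1)[OF F y sub] cont_comp(1)[OF F cY sub] eq Y' lip])
       (use t Lb Lk T_pos in \<open>auto intro!: add_nonneg_pos\<close>)
  then show ?thesis by simp
qed

end

text \<open>The noise is additive and cancels in the difference, so the constants are the same for
  every continuous \<open>w\<close>; this makes the bound on the distance of two clocks
  deterministic.\<close>

lemma
  assumes F: "F \<in> adm" and G: "G \<in> adm" and w: "continuous_on {0..T} w"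
    and le: "\<And>s x. s \<in> {0..T} \<Longrightarrow> norm (F (s, x) - G (s, x)) \<le> A * exp (\<beta> * s)"
    and A: "0 \<le> A" and \<beta>: "0 < \<beta>" "2 * (Lb * (Lk * T)) \<le> \<beta>" and t: "t \<in> {0..T}"
  shows Y_compare: "\<bar>Y F x0 w t - Y G x0 w t\<bar> \<le> 2 * (Lb * A) / \<beta> * exp (\<beta> * t)"
    and \<Lambda>_compare: "\<bar>\<Lambda> F x0 w t - \<Lambda> G x0 w t\<bar> \<le> 2 * (Lh * A) / \<beta> * exp (\<beta> * t)"
proof -
  have Y: "\<bar>Y F x0 w s - Y G x0 w s\<bar> \<le> 2 * (Lb * A) / \<beta> * exp (\<beta> * s)" if s: "s \<in> {0..T}" for s
  proof (rule solution_compare[where t=T and ?B1.0="\<lambda>s x. b (F (s, x))" and ?B2.0="\<lambda>s x. b (G (s, x))" and ?x0.0=x0 and w=w,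
        OF cont_Y[OF F w] cont_Y[OF G w] cont_comp(1)[OF F cont_Y[OF F w] order.refl]
        cont_comp(1)[OF G cont_Y[OF G w] order.refl] Y_eq[OF F w] Y_eq[OF G w] drift_lip[OF F]])
    fix s x assume s: "s \<in> {0..T}"
    show "\<bar>b (F (s, x)) - b (G (s, x))\<bar> \<le> Lb * A * exp (\<beta> * s)"
      using order_trans[OF b_lip mult_left_mono[OF le[OF s] Lb]] by (simp add: mult.assoc)
  qed (use Lb Lk T_pos A \<beta> s in auto)
  then show "\<bar>Y F x0 w t - Y G x0 w t\<bar> \<le> 2 * (Lb * A) / \<beta> * exp (\<beta> * t)" using t by blast
  have c: "continuous_on {0..t} (\<lambda>s. h (F (s, Y F x0 w s)))" "continuous_on {0..t} (\<lambda>s. h (G (s, Y G x0 w s)))"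
    using t by (auto intro: continuous_on_subset[OF cont_hY[OF F w]] continuous_on_subset[OF cont_hY[OF G w]])
  have "\<Lambda> F x0 w t - \<Lambda> G x0 w t = integral {0..t} (\<lambda>s. h (F (s, Y F x0 w s)) - h (G (s, Y G x0 w s)))"
    using c t by (simp add: \<Lambda>_eq[OF F w] \<Lambda>_eq[OF G w] Henstock_Kurzweil_Integration.integral_diff integrable_continuous_real)
  also have "norm \<dots> \<le> (2 * (Lh * A)) / \<beta> * exp (\<beta> * t)"
  proof (rule norm_integral_exp_le)
    fix s assume "s \<in> {0..t}"
    then have s: "s \<in> {0..T}" using t by auto
    have "norm (F (s, Y F x0 w s) - G (s, Y G x0 w s))
        \<le> norm (F (s, Y F x0 w s) - F (s, Y G x0 w s)) + norm (F (s, Y G x0 w s) - G (s, Y G x0 w s))"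
      using norm_triangle_ineq[of "F (s, Y F x0 w s) - F (s, Y G x0 w s)" "F (s, Y G x0 w s) - G (s, Y G x0 w s)"]
      by simp
    also have "\<dots> \<le> Lk * T * (2 * (Lb * A) / \<beta> * exp (\<beta> * s)) + A * exp (\<beta> * s)"
      using adm_lip[OF F s, of "Y F x0 w s" "Y G x0 w s"] mult_left_mono[OF Y[OF s], of "Lk * T"] le[OF s] Lk T_pos
      by (intro add_mono) auto
    also have "Lk * T * (2 * (Lb * A) / \<beta> * exp (\<beta> * s)) = 2 * (Lb * (Lk * T)) / \<beta> * (A * exp (\<beta> * s))"
      by (simp add: field_simps)
    \<comment> \<open>Here \<open>2 * (Lb * (Lk * T)) \<le> \<beta>\<close> enters: the part caused
      by different paths is at most the bound for the part caused by different fields, hence the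
      total \<open>2 * A\<close>.\<close>
    also have "\<dots> \<le> 1 * (A * exp (\<beta> * s))" using \<beta> A by (intro mult_right_mono) auto
    finally have "norm (F (s, Y F x0 w s) - G (s, Y G x0 w s)) \<le> 2 * A * exp (\<beta> * s)" by simp
    from order_trans[OF h_lip mult_left_mono[OF this Lh]]
    show "norm (h (F (s, Y F x0 w s)) - h (G (s, Y G x0 w s))) \<le> 2 * (Lh * A) * exp (\<beta> * s)"
      by (simp add: mult_ac)
  qed (use c t \<beta> Lh A in \<open>auto intro!: integrable_continuous_real continuous_intros\<close>)
  finally show "\<bar>\<Lambda> F x0 w t - \<Lambda> G x0 w t\<bar> \<le> 2 * (Lh * A) / \<beta> * exp (\<beta> * t)" by simp
qed

lemma zero_adm: "(\<lambda>_. 0) \<in> adm"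
  using CK Lk T_pos by (auto simp: adm_def)

lemma adm_closed:
  assumes fs: "\<And>n::nat. fs n \<in> adm" and lim: "uniform_limit ({0..T} \<times> UNIV) fs F sequentially"
  shows "F \<in> adm"
proof -
  have lim: "(\<lambda>n. fs n (s, x)) \<longlonglongrightarrow> F (s, x)" if "s \<in> {0..T}" for s x
    using tendsto_uniform_limitI[OF lim] that by auto
  have "norm (F (s, x)) \<le> CK * T" if "s \<in> {0..T}" for s x
    by (rule Lim_norm_ubound[OF _ lim[OF that]]) (use fs that in \<open>auto simp: adm_def\<close>)
  moreover have "norm (F (s, x) - F (s', x')) \<le> CK * \<bar>s - s'\<bar> + Lk * T * \<bar>x - x'\<bar>"
    if "s \<in> {0..T}" "s' \<in> {0..T}" for s s' x x'
    by (rule Lim_norm_ubound[OF _ tendsto_diff[OF lim[OF that(1)] lim[OF that(2)]]])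
       (use fs that in \<open>auto simp: adm_def\<close>)
  ultimately show ?thesis by (auto simp: adm_def)
qed

end

text \<open>The clock is observed up to \<open>T\<close>, so a threshold beyond \<open>T\<close>
  asks for its value at \<open>T\<close>. This expresses \<tau> through clock values at fixed times,
  from which its measurability and adaptedness are obtained.\<close>

lemma passage_le_iff:
  assumes f: "continuous_on {0..T} f" and mono: "\<And>s t. 0 \<le> s \<Longrightarrow> s \<le> t \<Longrightarrow> t \<le> T \<Longrightarrow> f s \<le> f t"
    and "0 \<le> T" "0 \<le> y"
  shows "passage T f z \<le> ereal y \<longleftrightarrow> z \<le> f (min y T)"
proof
  have my: "min y T \<in> {0..T}" using assms by auto
  show "passage T f z \<le> ereal y" if "z \<le> f (min y T)"
    using passage_le[of "min y T" T z f, OF my that] order_trans[of _ "ereal (min y T)" "ereal y"] by simp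
  assume le: "passage T f z \<le> ereal y"
  show "z \<le> f (min y T)"
  proof (rule ccontr)
    assume n: "\<not> z \<le> f (min y T)"
    then have l: "ereal (min y T) < passage T f z" using less_passage_iff[OF f f mono refl my] by simp
    show False
    proof (cases "y \<le> T")
      case False
      then have "min y T = T" by simp
      with n have "\<not> z \<le> f t" if "t \<in> {0..T}" for t using mono[of t T] that by auto
      then have "passage T f z = \<infinity>" by (rule passage_infinity)
      with le show False by simp
    qed (use l le in \<open>simp add: min_absorb1\<close>)
  qed
qed

lemma passage_nonneg: "0 \<le> passage T f z"
  unfolding passage_def by (intro Inf_greatest) auto

section \<open>Expectations of right-continuous processes\<close>

text \<open>Right continuity makes \<open>f\<close> a pointwise limit of step functions that sample
  it on grids to the right, hence measurable; boundedness does the rest.\<close>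

lemma right_continuous_integrable:
  fixes f :: "real \<Rightarrow> 'e::euclidean_space"
  assumes lim: "\<And>t. t \<in> {0..<T} \<Longrightarrow> (f \<longlongrightarrow> f t) (at_right t)"
    and bound: "\<And>t. t \<in> {0..T} \<Longrightarrow> norm (f t) \<le> C"
  shows "f integrable_on {0..T}"
proof -
  \<comment> \<open>The next grid point strictly to the right of \<open>t\<close>: floor plus one
    instead of a ceiling, since \<open>at_right\<close> excludes \<open>t\<close> itself. The cap
    keeps the samples of \<open>t\<close> in \<open>{0..<T}\<close> inside [0, T].\<close>
  define p where "p n t = min T ((real_of_int \<lfloor>real (Suc n) * t\<rfloor> + 1) / real (Suc n))" for n t
  have p: "filterlim (\<lambda>n. p n t) (at_right t) sequentially" if t: "t \<in> {0..<T}" for t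
  proof -
    have gt: "t < p n t" for n
    proof -
      have "real (Suc n) * t < real_of_int \<lfloor>real (Suc n) * t\<rfloor> + 1" by linarith
      then show ?thesis using t by (simp add: p_def field_simps del: of_nat_Suc)
    qed
    moreover have "p n t \<le> t + 1 / real (Suc n)" for n
    proof -
      have "real_of_int \<lfloor>real (Suc n) * t\<rfloor> + 1 \<le> real (Suc n) * t + 1" by linarith
      then have "(real_of_int \<lfloor>real (Suc n) * t\<rfloor> + 1) / real (Suc n) \<le> (real (Suc n) * t + 1) / real (Suc n)"
        by (intro divide_right_mono) auto
      also have "\<dots> = t + 1 / real (Suc n)" by (simp add: add_divide_distrib del: of_nat_Suc)
      finally show ?thesis by (simp add: p_def min.coboundedI2)
    qed
    moreover have "(\<lambda>n. t + 1 / real (Suc n)) \<longlonglongrightarrow> t + 0"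
      by (intro tendsto_intros LIMSEQ_Suc[OF lim_1_over_n])
    ultimately have "(\<lambda>n. p n t) \<longlonglongrightarrow> t"
      by (intro real_tendsto_sandwich[of "\<lambda>_. t" "\<lambda>n. p n t" sequentially "\<lambda>n. t + 1 / real (Suc n)" t])
         (auto intro: always_eventually less_imp_le)
    then show ?thesis using gt by (auto simp: filterlim_at less_imp_neq[symmetric])
  qed
  have [measurable]: "(\<lambda>t. f (p n t)) \<in> borel_measurable borel" for n
  proof -
    have "(\<lambda>z::int. f (min T ((real_of_int z + 1) / real (Suc n)))) \<in> measurable (count_space UNIV) borel"
      by simp
    then show ?thesis unfolding p_def by measurable
  qed
  have [measurable]: "(\<lambda>t. indicator {0..<T} t *\<^sub>R f t) \<in> borel_measurable borel"
  proof (rule borel_measurable_LIMSEQ_metric)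
    show "(\<lambda>n. indicator {0..<T} t *\<^sub>R f (p n t)) \<longlonglongrightarrow> indicator {0..<T} t *\<^sub>R f t" for t
      using filterlim_compose[OF lim p] by (cases "t \<in> {0..<T}") (auto intro: tendsto_intros)
  qed measurable
  have "integrable lborel (\<lambda>t. indicator {0..<T} t *\<^sub>R (indicator {0..<T} t *\<^sub>R f t))"
  proof (rule integrableI_bounded_set_indicator[where B=C])
    show "emeasure lborel {0..<T} < \<infinity>" by (cases "0 \<le> T") auto
  qed (use bound in auto)
  then have "(\<lambda>t. indicator {0..<T} t *\<^sub>R (indicator {0..<T} t *\<^sub>R f t)) integrable_on UNIV"
    by (rule integrable_on_lborel)
  also have "(\<lambda>t. indicator {0..<T} t *\<^sub>R (indicator {0..<T} t *\<^sub>R f t)) = (\<lambda>t. if t \<in> {0..<T} then f t else 0)"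
    by (auto simp: indicator_def)
  finally have "f integrable_on {0..<T}" by (simp only: integrable_restrict_UNIV)
  \<comment> \<open>The endpoint \<open>T\<close>, where no right limit is given, is
    negligible.\<close>
  then show ?thesis
    by (rule integrable_spike_set) (auto intro: negligible_subset[of "{T}"])
qed

lemma continuous_at_right:
  fixes f :: "real \<Rightarrow> real"
  assumes "continuous_on {0..t} f" "0 \<le> r" "r < t"
  shows "(f \<longlongrightarrow> f r) (at_right r)"
proof -
  have "continuous_on {r..t} f" by (rule continuous_on_subset[OF assms(1)]) (use assms in auto)
  then have "(f \<longlongrightarrow> f r) (at r within {r..t})" using assms by (auto simp: continuous_on_def)
  then show ?thesis using assms by (simp add: at_within_Icc_at_right)
qed

lemma (in prob_space) norm_expectation_le:
  fixes f :: "'a \<Rightarrow> 'e::euclidean_space"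
  assumes "AE \<omega> in M. norm (f \<omega>) \<le> C" "0 \<le> C"
  shows "norm (\<integral>\<omega>. f \<omega> \<partial>M) \<le> C"
proof (cases "integrable M f")
  case True
  have "norm (\<integral>\<omega>. f \<omega> \<partial>M) \<le> (\<integral>\<omega>. norm (f \<omega>) \<partial>M)" by (rule integral_norm_bound)
  also have "\<dots> \<le> C" using True assms by (intro integral_le_const) auto
  finally show ?thesis .
\<comment> \<open>A non-integrable \<open>f\<close> has Bochner integral 0, which satisfies the
  bound as well.\<close>
qed (use assms in \<open>simp add: not_integrable_integral_eq\<close>)

text \<open>Right continuity of the paths passes to the expectation by dominated convergence along
  sequences. It takes the place of Fubini, for which measurability jointly in time and \<omega>
  would have to be known.\<close>

lemma (in prob_space) expectation_right_continuous_integrable: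
  fixes \<xi> :: "real \<Rightarrow> 'a \<Rightarrow> 'e::euclidean_space"
  assumes meas: "\<And>r. r \<in> {0..T} \<Longrightarrow> \<xi> r \<in> borel_measurable M"
    and bound: "\<And>r \<omega>. norm (\<xi> r \<omega>) \<le> C"
    and lim: "AE \<omega> in M. \<forall>r\<in>{0..<T}. ((\<lambda>s. \<xi> s \<omega>) \<longlongrightarrow> \<xi> r \<omega>) (at_right r)"
  shows "(\<lambda>r. \<integral>\<omega>. \<xi> r \<omega> \<partial>M) integrable_on {0..T}"
proof (rule right_continuous_integrable)
  have C: "0 \<le> C" using order_trans[OF norm_ge_zero bound] .
  show "norm (\<integral>\<omega>. \<xi> r \<omega> \<partial>M) \<le> C" for r by (rule norm_expectation_le) (use bound C in auto)
  fix r assume r: "r \<in> {0..<T}"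
  show "((\<lambda>s. \<integral>\<omega>. \<xi> s \<omega> \<partial>M) \<longlongrightarrow> (\<integral>\<omega>. \<xi> r \<omega> \<partial>M)) (at_right r)"
  proof (rule tendsto_at_right_sequentially[where b=T])
    fix S :: "nat \<Rightarrow> real" assume S: "\<And>n. r < S n" "\<And>n. S n < T" "S \<longlonglongrightarrow> r"
    have S': "filterlim S (at_right r) sequentially" using S by (auto simp: filterlim_at less_imp_neq[symmetric])
    show "(\<lambda>n. \<integral>\<omega>. \<xi> (S n) \<omega> \<partial>M) \<longlonglongrightarrow> (\<integral>\<omega>. \<xi> r \<omega> \<partial>M)"
    proof (rule integral_dominated_convergence[where w="\<lambda>_. C"])
      show "\<xi> r \<in> borel_measurable M" "\<And>n. \<xi> (S n) \<in> borel_measurable M"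
        using r order_trans[OF _ less_imp_le[OF S(1)]] less_imp_le[OF S(2)] by (auto intro!: meas)
      show "AE \<omega> in M. (\<lambda>n. \<xi> (S n) \<omega>) \<longlonglongrightarrow> \<xi> r \<omega>"
        using lim
      proof eventually_elim
        case (elim \<omega>)
        then have "((\<lambda>s. \<xi> s \<omega>) \<longlongrightarrow> \<xi> r \<omega>) (at_right r)" using r by blast
        then show ?case by (rule filterlim_compose[OF _ S'])
      qed
    qed (use bound in auto)
  qed (use r in auto)
qed

lemma norm_integral_le:
  fixes f :: "real \<Rightarrow> 'e::euclidean_space"
  assumes "f integrable_on {s..t}" "s \<le> t" "0 \<le> C" "\<And>r. r \<in> {s..t} \<Longrightarrow> norm (f r) \<le> C"
  shows "norm (integral {s..t} f) \<le> C * (t - s)"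
  using has_integral_bound_real[OF assms(3) finite.emptyI integrable_integral[OF assms(1)]] assms by auto

section \<open>The field generated by a killed process\<close>

lemma sets_gen_sigma[simp]: "sets (sigma (space M) (gen_sigma M Vs)) = gen_sigma M Vs"
proof -
  have G: "(\<Union>V\<in>Vs. {V -` A \<inter> space M | A. A \<in> sets borel}) \<subseteq> Pow (space M)" by auto
  show ?thesis using sigma_sets_into_sp[OF G] sigma_sets_sigma_sets_eq[OF G]
    by (subst sets_measure_of) (auto simp: gen_sigma_def)
qed

lemma measurable_gen_sigma:
  assumes "V \<in> Vs"
  shows "V \<in> borel_measurable (sigma (space M) (gen_sigma M Vs))"
proof (rule measurableI)
  fix A :: "real set" assume "A \<in> sets borel"
  then have "V -` A \<inter> space M \<in> gen_sigma M Vs"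
    unfolding gen_sigma_def using assms by (intro sigma_sets.Basic) blast
  then show "V -` A \<inter> space (sigma (space M) (gen_sigma M Vs)) \<in> sets (sigma (space M) (gen_sigma M Vs))"
    by (simp add: space_measure_of_conv)
qed simp

text \<open>\<open>h0\<close> is the speed of the clock in the cemetery state, where all
  convolutions vanish; it is instantiated by \<open>lam * c0\<close>.\<close>

locale killed_mv_data = killed_mv T Lb Lh Lk CK b h \<kappa> + prob_space M
  for T Lb Lh Lk CK and b h :: "'e::euclidean_space \<Rightarrow> real" and \<kappa> and M :: "'a measure" +
  fixes h0 :: real and X0 Z :: "'a \<Rightarrow> real" and W :: "real \<Rightarrow> 'a \<Rightarrow> real"
  assumes X0[measurable]: "X0 \<in> borel_measurable M"
    and W: "0 \<le> t \<Longrightarrow> W t \<in> borel_measurable M"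
    and Z[measurable]: "Z \<in> borel_measurable M"
    and W_cont: "AE \<omega> in M. continuous_on {0..T} (\<lambda>t. W t \<omega>)"
    and indep: "indep_set (gen_sigma M (insert X0 {W t | t. 0 \<le> t})) (gen_sigma M {Z})"
    and Z_exp: "distr M borel Z = density lborel (\<lambda>x. ennreal (exponential_density 1 x))"
begin

abbreviation W_path :: "'a \<Rightarrow> real \<Rightarrow> real" where "W_path \<omega> \<equiv> (\<lambda>t. W t \<omega>)"

text \<open>By independence the law of the pair is a product. For a fixed clock value the event
  confines \<open>Z\<close> to an interval of length \<open>2 * d\<close>, and the exponential
  density is at most 1.\<close>

lemma prob_window:
  assumes L: "L \<in> borel_measurable (sigma (space M) (gen_sigma M (insert X0 {W t | t. 0 \<le> t})))" and d: "0 \<le> d"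
  shows "measure M {\<omega> \<in> space M. L \<omega> - d < Z \<omega> \<and> Z \<omega> \<le> L \<omega> + d} \<le> 2 * d"
proof -
  let ?N = "sigma (space M) (gen_sigma M (insert X0 {W t | t. 0 \<le> t}))"
  have sub: "gen_sigma M (insert X0 {W t | t. 0 \<le> t}) \<subseteq> sets M" using indep by (rule indep_setD_ev1)
  have LN: "L -` A \<inter> space M \<in> gen_sigma M (insert X0 {W t | t. 0 \<le> t})" if "A \<in> sets borel" for A
    using measurable_sets[OF L that] by (simp add: space_measure_of_conv)
  have LM[measurable]: "L \<in> borel_measurable M" using LN sub by (intro measurableI) auto
  have "indep_set (sigma_sets (space M) {L -` A \<inter> space M |A. A \<in> sets borel})
     (sigma_sets (space M) {Z -` A \<inter> space M |A. A \<in> sets borel})"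
    unfolding indep_set_def
  proof (rule indep_sets_mono_sets[OF indep[unfolded indep_set_def]])
    have "{L -` A \<inter> space M |A. A \<in> sets borel} \<subseteq> sets ?N" using LN by auto
    then have "sigma_sets (space ?N) {L -` A \<inter> space M |A. A \<in> sets borel} \<subseteq> sets ?N"
      by (rule sets.sigma_sets_subset)
    then show "case_bool (sigma_sets (space M) {L -` A \<inter> space M |A. A \<in> sets borel})
        (sigma_sets (space M) {Z -` A \<inter> space M |A. A \<in> sets borel}) i
      \<subseteq> case_bool (gen_sigma M (insert X0 {W t | t. 0 \<le> t})) (gen_sigma M {Z}) i" for i
      by (cases i) (simp_all add: space_measure_of_conv, simp add: gen_sigma_def)
  qed
  then have "indep_var borel L borel Z" by (simp add: indep_var_eq)
  then have eq: "distr M (borel \<Otimes>\<^sub>M borel) (\<lambda>\<omega>. (L \<omega>, Z \<omega>)) = distr M borel L \<Otimes>\<^sub>M distr M borel Z"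
    by (simp add: indep_var_distribution_eq)
  interpret DL: prob_space "distr M borel L" by (rule prob_space_distr) simp
  interpret DZ: prob_space "distr M borel Z" by (rule prob_space_distr) simp
  define A where "A = {p :: real \<times> real. fst p - d < snd p \<and> snd p \<le> fst p + d}"
  have A: "A = {p \<in> space (borel \<Otimes>\<^sub>M borel). fst p - d < snd p \<and> snd p \<le> fst p + d}"
    by (simp add: A_def space_pair_measure)
  have [measurable]: "A \<in> sets (borel \<Otimes>\<^sub>M borel)" unfolding A by measurable
  have "emeasure M {\<omega> \<in> space M. L \<omega> - d < Z \<omega> \<and> Z \<omega> \<le> L \<omega> + d}
      = emeasure (distr M (borel \<Otimes>\<^sub>M borel) (\<lambda>\<omega>. (L \<omega>, Z \<omega>))) A"
  proof (subst emeasure_distr)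
    show "emeasure M {\<omega> \<in> space M. L \<omega> - d < Z \<omega> \<and> Z \<omega> \<le> L \<omega> + d}
        = emeasure M ((\<lambda>\<omega>. (L \<omega>, Z \<omega>)) -` A \<inter> space M)"
      by (rule arg_cong[where f="emeasure M"]) (auto simp: A_def)
  qed measurable
  also have "\<dots> = (\<integral>\<^sup>+ l. emeasure (distr M borel Z) (Pair l -` A) \<partial>distr M borel L)"
    unfolding eq by (rule DZ.emeasure_pair_measure_alt) simp
  also have "\<dots> \<le> (\<integral>\<^sup>+ l. ennreal (2 * d) \<partial>distr M borel L)"
  proof (rule nn_integral_mono)
    fix l
    have "emeasure (distr M borel Z) (Pair l -` A) = (\<integral>\<^sup>+x. ennreal (exponential_density 1 x) * indicator {l - d<..l + d} x \<partial>lborel)"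
      unfolding Z_exp by (subst emeasure_density) (auto simp: A_def intro!: nn_integral_cong split: split_indicator)
    also have "\<dots> \<le> (\<integral>\<^sup>+x. indicator {l - d<..l + d} x \<partial>lborel)"
    proof (rule nn_integral_mono)
      fix x :: real
      have "exponential_density 1 x \<le> 1" by (auto simp: exponential_density_def)
      then have "ennreal (exponential_density 1 x) \<le> 1" by (simp add: ennreal_le_1)
      then show "ennreal (exponential_density 1 x) * indicator {l - d<..l + d} x \<le> indicator {l - d<..l + d} x"
        by (auto split: split_indicator)
    qed
    also have "\<dots> = ennreal (2 * d)" using d by simp
    finally show "emeasure (distr M borel Z) (Pair l -` A) \<le> ennreal (2 * d)" .
  qed
  also have "\<dots> = ennreal (2 * d)" using DL.emeasure_space_1 by simp
  finally show ?thesis using d by (simp add: emeasure_eq_measure)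
qed

text \<open>Survival \<open>S\<close> and state \<open>V\<close> are left abstract: the same
  construction serves a given solution, with \<open>ereal r < \<tau> \<omega>\<close>, and the
  driven path, with its clock below \<open>Z\<close>.\<close>

definition dens :: "(real \<Rightarrow> 'a \<Rightarrow> bool) \<Rightarrow> (real \<Rightarrow> 'a \<Rightarrow> real) \<Rightarrow> real \<Rightarrow> real \<Rightarrow> 'e" where
  "dens S V r x = (\<integral>\<omega>. (if S r \<omega> then \<kappa> (x - V r \<omega>) else 0) \<partial>M)"

definition field :: "(real \<Rightarrow> 'a \<Rightarrow> bool) \<Rightarrow> (real \<Rightarrow> 'a \<Rightarrow> real) \<Rightarrow> real \<times> real \<Rightarrow> 'e" where
  "field S V = (\<lambda>(t, x). integral {0..t} (\<lambda>r. dens S V r x))"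

definition meas :: "(real \<Rightarrow> 'a \<Rightarrow> bool) \<Rightarrow> (real \<Rightarrow> 'a \<Rightarrow> real) \<Rightarrow> bool" where
  "meas S V \<longleftrightarrow> (\<forall>r\<in>{0..T}. V r \<in> borel_measurable M \<and> Measurable.pred M (S r))"

text \<open>Right continuity of the killed path with the cemetery as an isolated state; the values
  of \<open>V\<close> after death are left free.\<close>

definition right_regular :: "(real \<Rightarrow> 'a \<Rightarrow> bool) \<Rightarrow> (real \<Rightarrow> 'a \<Rightarrow> real) \<Rightarrow> 'a \<Rightarrow> bool" where
  "right_regular S V \<omega> \<longleftrightarrow> (\<forall>r\<in>{0..<T}.
     if S r \<omega> then (\<forall>\<^sub>F s in at_right r. S s \<omega>) \<and> ((\<lambda>s. V s \<omega>) \<longlongrightarrow> V r \<omega>) (at_right r)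
     else (\<forall>\<^sub>F s in at_right r. \<not> S s \<omega>))"

lemma norm_dens: "norm (dens S V r x) \<le> CK"
  unfolding dens_def using \<kappa>_bound CK by (intro norm_expectation_le) auto

lemma measurable_dens:
  assumes "meas S V" "r \<in> {0..T}"
  shows "(\<lambda>\<omega>. if S r \<omega> then \<kappa> (x - V r \<omega>) else 0) \<in> borel_measurable M"
proof -
  have [measurable]: "V r \<in> borel_measurable M" "Measurable.pred M (S r)" using assms by (auto simp: meas_def)
  show ?thesis by measurable
qed

lemma integrable_dens:
  assumes "meas S V" "r \<in> {0..T}"
  shows "integrable M (\<lambda>\<omega>. if S r \<omega> then \<kappa> (x - V r \<omega>) else 0)"
  using \<kappa>_bound CK by (intro integrable_const_bound[where B=CK] measurable_dens assms) auto

lemma dens_lip: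
  assumes "meas S V" "r \<in> {0..T}"
  shows "norm (dens S V r x - dens S V r y) \<le> Lk * \<bar>x - y\<bar>"
proof -
  have "dens S V r x - dens S V r y
      = (\<integral>\<omega>. (if S r \<omega> then \<kappa> (x - V r \<omega>) else 0) - (if S r \<omega> then \<kappa> (y - V r \<omega>) else 0) \<partial>M)"
    unfolding dens_def by (intro Bochner_Integration.integral_diff[symmetric] integrable_dens assms)
  also have "norm \<dots> \<le> Lk * \<bar>x - y\<bar>"
  proof (rule norm_expectation_le)
    have "norm (\<kappa> (x - v) - \<kappa> (y - v)) \<le> Lk * \<bar>x - y\<bar>" for v using \<kappa>_lip[of "x - v" "y - v"] by simp
    then show "AE \<omega> in M. norm ((if S r \<omega> then \<kappa> (x - V r \<omega>) else 0) - (if S r \<omega> then \<kappa> (y - V r \<omega>) else 0)) \<le> Lk * \<bar>x - y\<bar>"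
      using Lk by auto
  qed (use Lk in auto)
  finally show ?thesis .
qed

lemma dens_integrable:
  assumes m: "meas S V" and reg: "AE \<omega> in M. right_regular S V \<omega>"
  shows "(\<lambda>r. dens S V r x) integrable_on {0..T}"
  unfolding dens_def
proof (rule expectation_right_continuous_integrable[OF measurable_dens[OF m]])
  show "norm (if S r \<omega> then \<kappa> (x - V r \<omega>) else 0) \<le> CK" for r \<omega> using \<kappa>_bound CK by simp
  show "AE \<omega> in M. \<forall>r\<in>{0..<T}. ((\<lambda>s. if S s \<omega> then \<kappa> (x - V s \<omega>) else 0)
      \<longlongrightarrow> (if S r \<omega> then \<kappa> (x - V r \<omega>) else 0)) (at_right r)"
    using reg
  proof eventually_elim
    case (elim \<omega>)
    show ?case
    proof
      fix r assume r: "r \<in> {0..<T}"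
      show "((\<lambda>s. if S s \<omega> then \<kappa> (x - V s \<omega>) else 0)
          \<longlongrightarrow> (if S r \<omega> then \<kappa> (x - V r \<omega>) else 0)) (at_right r)"
      proof (cases "S r \<omega>")
        case True
        with elim r have ev: "\<forall>\<^sub>F s in at_right r. S s \<omega>" and V: "((\<lambda>s. V s \<omega>) \<longlongrightarrow> V r \<omega>) (at_right r)"
          by (auto simp: right_regular_def)
        have "isCont \<kappa> (x - V r \<omega>)" using cont_\<kappa>[of UNIV] by (simp add: continuous_on_eq_continuous_at)
        then have "((\<lambda>s. \<kappa> (x - V s \<omega>)) \<longlongrightarrow> \<kappa> (x - V r \<omega>)) (at_right r)"
          by (rule isCont_tendsto_compose) (intro tendsto_intros V)
        then have "((\<lambda>s. if S s \<omega> then \<kappa> (x - V s \<omega>) else 0) \<longlongrightarrow> \<kappa> (x - V r \<omega>)) (at_right r)"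
          by (rule Lim_transform_eventually) (use ev in eventually_elim, simp)
        with True show ?thesis by simp
      next
        case False
        with elim r have ev: "\<forall>\<^sub>F s in at_right r. \<not> S s \<omega>" by (auto simp: right_regular_def)
        have "((\<lambda>s. if S s \<omega> then \<kappa> (x - V s \<omega>) else 0) \<longlongrightarrow> 0) (at_right r)"
          by (rule tendsto_eventually) (use ev in eventually_elim, simp)
        with False show ?thesis by simp
      qed
    qed
  qed
qed

lemma field_adm:
  assumes m: "meas S V" and reg: "AE \<omega> in M. right_regular S V \<omega>"
  shows "field S V \<in> adm"
proof -
  have int: "(\<lambda>r. dens S V r x) integrable_on {s..t}" if "0 \<le> s" "t \<le> T" for s t x
    by (rule integrable_on_subinterval[OF dens_integrable[OF m reg]]) (use that in auto)
  have time: "norm (field S V (t, x) - field S V (s, x)) \<le> CK * (t - s)" if "0 \<le> s" "s \<le> t" "t \<le> T" for s t x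
  proof -
    have "integral {0..s} (\<lambda>r. dens S V r x) + integral {s..t} (\<lambda>r. dens S V r x) = integral {0..t} (\<lambda>r. dens S V r x)"
      using that int by (intro Henstock_Kurzweil_Integration.integral_combine) auto
    then have "field S V (t, x) - field S V (s, x) = integral {s..t} (\<lambda>r. dens S V r x)"
      by (simp add: field_def algebra_simps)
    then show ?thesis using that int CK by (auto intro!: norm_integral_le norm_dens)
  qed
  have space: "norm (field S V (t, x) - field S V (t, y)) \<le> Lk * T * \<bar>x - y\<bar>" if "t \<in> {0..T}" for t x y
  proof -
    have "field S V (t, x) - field S V (t, y) = integral {0..t} (\<lambda>r. dens S V r x - dens S V r y)"
      using that int by (simp add: field_def Henstock_Kurzweil_Integration.integral_diff)
    also have "norm \<dots> \<le> Lk * \<bar>x - y\<bar> * (t - 0)"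
      using that int Lk by (intro norm_integral_le dens_lip m integrable_diff) auto
    also have "\<dots> \<le> Lk * \<bar>x - y\<bar> * T" using that Lk by (intro mult_left_mono) auto
    finally show ?thesis by (simp add: mult_ac)
  qed
  have "norm (field S V (t, x)) \<le> CK * T" if "t \<in> {0..T}" for t x
    using time[of 0 t x] that mult_left_mono[of t T CK] CK by (simp add: field_def)
  moreover have "norm (field S V (t, x) - field S V (s, y)) \<le> CK * \<bar>t - s\<bar> + Lk * T * \<bar>x - y\<bar>"
    if "t \<in> {0..T}" "s \<in> {0..T}" for t s x y
  proof -
    have "norm (field S V (t, x) - field S V (s, x)) \<le> CK * \<bar>t - s\<bar>"
      using time[of s t x] time[of t s x] that by (cases "s \<le> t") (auto simp: norm_minus_commute)
    then show ?thesis
      using space[OF that(2), of x y] norm_triangle_ineq[of "field S V (t, x) - field S V (s, x)" "field S V (s, x) - field S V (s, y)"]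
      by simp
  qed
  ultimately show ?thesis by (auto simp: adm_def)
qed

lemma field_cong:
  assumes m: "meas S V" and m': "meas S' V'"
    and eq: "AE \<omega> in M. \<forall>r\<in>{0..T}. S r \<omega> = S' r \<omega> \<and> (S r \<omega> \<longrightarrow> V r \<omega> = V' r \<omega>)"
    and t: "t \<in> {0..T}"
  shows "field S V (t, x) = field S' V' (t, x)"
proof -
  have "dens S V r x = dens S' V' r x" if r: "r \<in> {0..t}" for r
    unfolding dens_def
  proof (rule integral_cong_AE)
    show "AE \<omega> in M. (if S r \<omega> then \<kappa> (x - V r \<omega>) else 0) = (if S' r \<omega> then \<kappa> (x - V' r \<omega>) else 0)"
      using eq by eventually_elim (use r t in force)
  qed (use m m' r t in \<open>auto intro!: measurable_dens\<close>)
  then show ?thesis by (auto simp: field_def intro!: integral_cong)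
qed

end

section \<open>The fixed-point map on fields and its contraction\<close>

context killed_mv_data
begin

definition alive :: "(real \<times> real \<Rightarrow> 'e) \<Rightarrow> real \<Rightarrow> 'a \<Rightarrow> bool" where
  "alive F r \<omega> \<longleftrightarrow> \<Lambda> F (X0 \<omega>) (W_path \<omega>) r < Z \<omega>"

definition state :: "(real \<times> real \<Rightarrow> 'e) \<Rightarrow> real \<Rightarrow> 'a \<Rightarrow> real" where
  "state F r \<omega> = Y F (X0 \<omega>) (W_path \<omega>) r"

definition \<Phi> :: "(real \<times> real \<Rightarrow> 'e) \<Rightarrow> real \<times> real \<Rightarrow> 'e" where
  "\<Phi> F = field (alive F) (state F)"

lemma measurable_clock:
  assumes "F \<in> adm" "r \<in> {0..T}"
  shows "(\<lambda>\<omega>. \<Lambda> F (X0 \<omega>) (W_path \<omega>) r) \<in> borel_measurable M"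
  using assms by (intro measurable_\<Lambda>) (auto intro: W)

lemma meas_flow: "F \<in> adm \<Longrightarrow> meas (alive F) (state F)"
  unfolding meas_def alive_def state_def
proof (intro ballI conjI)
  fix r assume F: "F \<in> adm" and r: "r \<in> {0..T}"
  note [measurable] = measurable_clock[OF F r]
  show "(\<lambda>\<omega>. Y F (X0 \<omega>) (W_path \<omega>) r) \<in> borel_measurable M"
    using F r by (intro measurable_Y) (auto intro: W)
  show "Measurable.pred M (\<lambda>\<omega>. \<Lambda> F (X0 \<omega>) (W_path \<omega>) r < Z \<omega>)" by measurable
qed

lemma right_regular_flow:
  assumes F: "F \<in> adm"
  shows "AE \<omega> in M. right_regular (alive F) (state F) \<omega>"
  using W_cont
proof eventually_elim
  case (elim \<omega>)
  show ?case
    unfolding right_regular_def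
  proof
    fix r assume r: "r \<in> {0..<T}"
    have Y: "((\<lambda>s. state F s \<omega>) \<longlongrightarrow> state F r \<omega>) (at_right r)"
      unfolding state_def using r by (intro continuous_at_right[OF cont_Y[OF F elim]]) auto
    have L: "(\<Lambda> F (X0 \<omega>) (W_path \<omega>) \<longlongrightarrow> \<Lambda> F (X0 \<omega>) (W_path \<omega>) r) (at_right r)"
      using r by (intro continuous_at_right[OF cont_\<Lambda>[OF F elim]]) auto
    show "if alive F r \<omega> then (\<forall>\<^sub>F s in at_right r. alive F s \<omega>) \<and> ((\<lambda>s. state F s \<omega>) \<longlongrightarrow> state F r \<omega>) (at_right r)
      else (\<forall>\<^sub>F s in at_right r. \<not> alive F s \<omega>)"
    proof (cases "alive F r \<omega>")
      case True
      then have "\<forall>\<^sub>F s in at_right r. alive F s \<omega>" unfolding alive_def by (rule order_tendstoD(2)[OF L])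
      with True Y show ?thesis by simp
    next
      case False
      have "\<not> alive F s \<omega>" if "s \<in> {r<..<T}" for s
        using False mono_\<Lambda>[OF F elim, of r s "X0 \<omega>"] that r by (auto simp: alive_def)
      then have "\<forall>\<^sub>F s in at_right r. \<not> alive F s \<omega>" by (rule eventually_at_rightI) (use r in auto)
      with False show ?thesis by simp
    qed
  qed
qed

lemma \<Phi>_adm: "F \<in> adm \<Longrightarrow> \<Phi> F \<in> adm"
  unfolding \<Phi>_def by (intro field_adm meas_flow right_regular_flow)

text \<open>\<open>2 * (Lb * (Lk * T))\<close> is required by \<open>Y_compare\<close> and
  \<open>\<Lambda>_compare\<close>; \<open>4 * Lk * Lb\<close> and \<open>8 * CK * Lh\<close> are
  the contributions of displaced states and of disputed survival in \<open>dens_contraction\<close>;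
  the 1 makes \<open>1 / rate\<close> at most 1.\<close>

definition rate :: real where
  "rate = 1 + 2 * (Lb * (Lk * T)) + 4 * Lk * Lb + 8 * CK * Lh"

lemma rate: "1 \<le> rate" "2 * (Lb * (Lk * T)) \<le> rate" "4 * Lk * Lb + 8 * CK * Lh \<le> rate"
  using Lb Lk Lh CK T_pos by (auto simp: rate_def intro!: mult_nonneg_nonneg add_nonneg_nonneg)

text \<open>Where both fields agree on survival, the Lipschitz kernel sees only the displacement
  \<open>dY\<close>. Where they disagree the integrand may jump by \<open>CK\<close>, but then
  \<open>Z\<close> lies between the two clocks, an event of probability at most
  \<open>2 * dL\<close>. Both errors are of order \<open>A / rate\<close>.\<close>

lemma dens_contraction:
  assumes F: "F \<in> adm" and G: "G \<in> adm" and A: "0 \<le> A"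
    and le: "\<And>s x. s \<in> {0..T} \<Longrightarrow> norm (F (s, x) - G (s, x)) \<le> A * exp (rate * s)" and r: "r \<in> {0..T}"
  shows "norm (dens (alive F) (state F) r x - dens (alive G) (state G) r x) \<le> A / 2 * exp (rate * r)"
proof -
  define dY where "dY = 2 * (Lb * A) / rate * exp (rate * r)"
  define dL where "dL = 2 * (Lh * A) / rate * exp (rate * r)"
  have d0: "0 \<le> dY" "0 \<le> dL" using Lb Lh A rate(1) by (auto simp: dY_def dL_def)
  let ?L = "\<lambda>\<omega>. \<Lambda> F (X0 \<omega>) (W_path \<omega>) r"
  define E where "E = {\<omega> \<in> space M. ?L \<omega> - dL < Z \<omega> \<and> Z \<omega> \<le> ?L \<omega> + dL}"
  note [measurable] = measurable_clock[OF F r]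
  have E[measurable]: "E \<in> sets M" unfolding E_def by measurable
  let ?f = "\<lambda>F \<omega>. if alive F r \<omega> then \<kappa> (x - state F r \<omega>) else 0"
  have PE: "measure M E \<le> 2 * dL"
    unfolding E_def using F r d0
    by (intro prob_window measurable_\<Lambda>) (auto intro!: measurable_gen_sigma)
  have "AE \<omega> in M. norm (?f F \<omega> - ?f G \<omega>) \<le> Lk * dY + CK * indicator E \<omega>"
    using W_cont AE_space
  proof eventually_elim
    case (elim \<omega>)
    have yy: "\<bar>state F r \<omega> - state G r \<omega>\<bar> \<le> dY"
      unfolding state_def dY_def using rate r A by (intro Y_compare[OF F G elim(1) le]) auto
    have ll: "\<bar>?L \<omega> - \<Lambda> G (X0 \<omega>) (W_path \<omega>) r\<bar> \<le> dL"
      unfolding dL_def using rate r A by (intro \<Lambda>_compare[OF F G elim(1) le]) auto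
    show ?case
    proof (cases "alive F r \<omega> = alive G r \<omega>")
      case True
      have "norm (\<kappa> (x - state F r \<omega>) - \<kappa> (x - state G r \<omega>)) \<le> Lk * \<bar>state F r \<omega> - state G r \<omega>\<bar>"
        using \<kappa>_lip[of "x - state F r \<omega>" "x - state G r \<omega>"] by (simp add: abs_minus_commute)
      also have "\<dots> \<le> Lk * dY" using yy Lk by (rule mult_left_mono)
      finally have "norm (?f F \<omega> - ?f G \<omega>) \<le> Lk * dY" using True Lk d0 by auto
      then show ?thesis using CK by (auto intro: order_trans simp: indicator_def)
    next
      case False
      \<comment> \<open>One clock is below \<open>Z\<close> and the other has reached it, so
        \<open>Z\<close> lies within \<open>dL\<close> of the clock of \<open>F\<close>; the
        half-open window matches the strict inequality in \<open>alive\<close>.\<close>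
      then have "\<omega> \<in> E" using ll elim(2) by (auto simp: E_def alive_def)
      moreover have "norm (?f F \<omega> - ?f G \<omega>) \<le> CK" using False \<kappa>_bound by auto
      ultimately show ?thesis using Lk d0 by (simp add: add_increasing)
    qed
  qed
  note ae = this
  have intE: "integrable M (indicator E :: 'a \<Rightarrow> real)"
    by (intro integrable_real_indicator E) (simp add: less_top[symmetric])
  have int: "integrable M (?f F)" "integrable M (?f G)"
    using integrable_dens[OF meas_flow[OF F] r] integrable_dens[OF meas_flow[OF G] r] by auto
  have "norm (dens (alive F) (state F) r x - dens (alive G) (state G) r x) = norm (\<integral>\<omega>. ?f F \<omega> - ?f G \<omega> \<partial>M)"
    unfolding dens_def by (subst Bochner_Integration.integral_diff[OF int]) (rule refl)
  also have "\<dots> \<le> (\<integral>\<omega>. norm (?f F \<omega> - ?f G \<omega>) \<partial>M)" by (rule integral_norm_bound)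
  also have "\<dots> \<le> (\<integral>\<omega>. Lk * dY + CK * indicator E \<omega> \<partial>M)"
    using int ae intE by (intro integral_mono_AE) auto
  also have "\<dots> = Lk * dY + CK * measure M E" using intE by (simp add: prob_space)
  also have "\<dots> \<le> Lk * dY + CK * (2 * dL)" using PE CK by (intro add_left_mono mult_left_mono)
  also have "\<dots> = (4 * Lk * Lb + 8 * CK * Lh) / rate * (A / 2 * exp (rate * r))"
    using rate(1) by (simp add: dY_def dL_def field_simps)
  also have "\<dots> \<le> 1 * (A / 2 * exp (rate * r))"
    using rate A by (intro mult_right_mono) auto
  finally show ?thesis by simp
qed

lemma \<Phi>_contraction:
  assumes F: "F \<in> adm" and G: "G \<in> adm" and A: "0 \<le> A"
    and le: "\<And>s x. s \<in> {0..T} \<Longrightarrow> norm (F (s, x) - G (s, x)) \<le> A * exp (rate * s)" and t: "t \<in> {0..T}"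
  shows "norm (\<Phi> F (t, x) - \<Phi> G (t, x)) \<le> A / 2 * exp (rate * t)"
proof -
  have int: "(\<lambda>r. dens (alive H) (state H) r x) integrable_on {0..t}" if "H \<in> adm" for H
    by (rule integrable_on_subinterval[OF dens_integrable[OF meas_flow right_regular_flow]]) (use that t in auto)
  have "\<Phi> F (t, x) - \<Phi> G (t, x) = integral {0..t} (\<lambda>r. dens (alive F) (state F) r x - dens (alive G) (state G) r x)"
    using int F G by (simp add: \<Phi>_def field_def Henstock_Kurzweil_Integration.integral_diff)
  also have "norm \<dots> \<le> (A / 2) / rate * exp (rate * t)"
    using int F G t A rate(1) by (intro norm_integral_exp_le dens_contraction le integrable_diff) auto
  \<comment> \<open>The densities already contract, so the extra \<open>1 / rate\<close> from
    integrating the weight is simply estimated by 1.\<close>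
  also have "\<dots> \<le> A / 2 * exp (rate * t)"
    using rate(1) A by (intro mult_right_mono) (auto simp: divide_le_eq mult_left_mono[of 1 rate A, simplified])
  finally show ?thesis .
qed

lemma ex_fixed_point: "\<exists>F\<in>adm. \<forall>t\<in>{0..T}. \<forall>x. \<Phi> F (t, x) = F (t, x)"
proof -
  let ?D = "{0..T} \<times> (UNIV :: real set)" and ?wt = "\<lambda>p :: real \<times> real. exp (rate * fst p)"
  let ?F = "\<lambda>i. lim (\<lambda>n. (\<Phi> ^^ n) (\<lambda>_. 0) i)"
  have contr: "norm (\<Phi> f i - \<Phi> g i) \<le> A / 2 * ?wt i"
    if "f \<in> adm" "g \<in> adm" "0 \<le> A" "\<And>i. i \<in> ?D \<Longrightarrow> norm (f i - g i) \<le> A * ?wt i" "i \<in> ?D" for f g A i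
    using \<Phi>_contraction[OF that(1-3), of "fst i" "snd i"] that(4)[of "(_, _)"] that(5) by (cases i) auto
  have wt: "0 \<le> ?wt i" "?wt i \<le> exp (rate * T)" "norm (\<Phi> (\<lambda>_. 0) i - 0) \<le> CK * T * ?wt i" if "i \<in> ?D" for i
  proof -
    have "norm (\<Phi> (\<lambda>_. 0) i) \<le> CK * T * 1" using \<Phi>_adm[OF zero_adm] that by (cases i) (auto simp: adm_def)
    also have "\<dots> \<le> CK * T * ?wt i" using CK T_pos that rate(1) by (intro mult_left_mono) auto
    finally show "norm (\<Phi> (\<lambda>_. 0) i - 0) \<le> CK * T * ?wt i" by simp
  qed (use that rate(1) in auto)
  have A: "0 \<le> CK * T" using CK T_pos by auto
  have "?F \<in> adm"
    by (rule weighted_picard(1)[where D="?D" and wt="?wt"])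
      (fact \<Phi>_adm, fact contr, fact adm_closed, fact wt, fact wt, fact zero_adm, fact A, fact wt)
  moreover have "\<Phi> ?F i = ?F i" if "i \<in> ?D" for i
    by (rule weighted_picard(2)[where D="?D" and wt="?wt"])
      (fact \<Phi>_adm, fact contr, fact adm_closed, fact wt, fact wt, fact zero_adm, fact A, fact wt, fact that)
  ultimately show ?thesis by blast
qed

lemma fixed_point_unique:
  assumes F: "F \<in> adm" "\<And>t x. t \<in> {0..T} \<Longrightarrow> \<Phi> F (t, x) = F (t, x)"
    and G: "G \<in> adm" "\<And>t x. t \<in> {0..T} \<Longrightarrow> \<Phi> G (t, x) = G (t, x)" and t: "t \<in> {0..T}"
  shows "F (t, x) = G (t, x)"
proof (rule weighted_picard_unique[where D="{0..T} \<times> UNIV" and wt="\<lambda>p. exp (rate * fst p)" and A="2 * (CK * T)"])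
  fix A and i :: "real \<times> real"
  assume A: "0 \<le> A" "\<And>i. i \<in> {0..T} \<times> UNIV \<Longrightarrow> norm (F i - G i) \<le> A * exp (rate * fst i)" and i: "i \<in> {0..T} \<times> UNIV"
  show "norm (F i - G i) \<le> A / 2 * exp (rate * fst i)"
    using \<Phi>_contraction[OF F(1) G(1) A(1), of "fst i" "snd i"] A(2)[of "(_, _)"] i F(2) G(2) by (cases i) auto
next
  fix i :: "real \<times> real" assume i: "i \<in> {0..T} \<times> UNIV"
  have "norm (F i) \<le> CK * T" "norm (G i) \<le> CK * T" using F G i by (cases i, auto simp: adm_def)+
  then have "norm (F i - G i) \<le> 2 * (CK * T) * 1" using norm_triangle_ineq4[of "F i" "G i"] by simp
  also have "\<dots> \<le> 2 * (CK * T) * exp (rate * fst i)" using CK T_pos i rate(1) by (intro mult_left_mono) auto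
  finally show "norm (F i - G i) \<le> 2 * (CK * T) * exp (rate * fst i)" .
qed (use CK T_pos t in auto)

section \<open>Solutions and fixed points\<close>

definition law_field :: "('a \<Rightarrow> ereal) \<Rightarrow> (real \<Rightarrow> 'a \<Rightarrow> real) \<Rightarrow> real \<times> real \<Rightarrow> 'e" where
  "law_field \<tau> V = field (\<lambda>r \<omega>. ereal r < \<tau> \<omega>) V"

text \<open>The rate in the definition of \<tau> does not stop at killing: it continues as the
  constant \<open>h0\<close>.\<close>

definition intensity :: "('a \<Rightarrow> ereal) \<Rightarrow> (real \<Rightarrow> 'a \<Rightarrow> real) \<Rightarrow> 'a \<Rightarrow> real \<Rightarrow> real" where
  "intensity \<tau> V \<omega> s = (if ereal s < \<tau> \<omega> then h (law_field \<tau> V (s, V s \<omega>)) else h0)"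

definition sol :: "(real \<Rightarrow> 'a \<Rightarrow> real) \<Rightarrow> ('a \<Rightarrow> ereal) \<Rightarrow> bool" where
  "sol V \<tau> \<longleftrightarrow>
     (\<forall>t\<in>{0..T}. V t \<in> borel_measurable M) \<and> \<tau> \<in> borel_measurable M \<and>
     (AE \<omega> in M. \<forall>t\<in>{0..T}. ereal t < \<tau> \<omega> \<longrightarrow>
        (\<lambda>s. b (law_field \<tau> V (s, V s \<omega>))) integrable_on {0..t} \<and>
        V t \<omega> = X0 \<omega> + integral {0..t} (\<lambda>s. b (law_field \<tau> V (s, V s \<omega>))) + sqrt 2 * W t \<omega>) \<and>
     (AE \<omega> in M. (\<forall>t\<in>{0..T}. intensity \<tau> V \<omega> integrable_on {0..t}) \<and>
        \<tau> \<omega> = passage T (\<lambda>t. integral {0..t} (intensity \<tau> V \<omega>)) (Z \<omega>))"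

text \<open>\<open>g\<close> is arbitrary on purpose. Admissibility of the law field is derived from
  this regularity, so nothing may be assumed yet about how the drift depends on the field. The same
  statement serves the original and the clamped drift.\<close>

lemma
  assumes V: "AE \<omega> in M. \<forall>t\<in>{0..T}. ereal t < \<tau> \<omega> \<longrightarrow> g \<omega> integrable_on {0..t} \<and>
      V t \<omega> = X0 \<omega> + integral {0..t} (g \<omega>) + sqrt 2 * W t \<omega>"
  shows integral_process_continuous:
      "AE \<omega> in M. \<forall>t\<in>{0..T}. ereal t < \<tau> \<omega> \<longrightarrow> continuous_on {0..t} (\<lambda>s. V s \<omega>)" (is ?c)
    and integral_process_right_regular: "AE \<omega> in M. right_regular (\<lambda>r \<omega>. ereal r < \<tau> \<omega>) V \<omega>"
proof -
  show c: ?c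
    using W_cont V
  proof eventually_elim
    case (elim \<omega>)
    show ?case
    proof (intro ballI impI)
      fix t assume t: "t \<in> {0..T}" "ereal t < \<tau> \<omega>"
      have V_eq: "V s \<omega> = X0 \<omega> + integral {0..s} (g \<omega>) + sqrt 2 * W s \<omega>" if "s \<in> {0..t}" for s
      proof -
        have "ereal s < \<tau> \<omega>" using that t(2) le_less_trans[of "ereal s" "ereal t" "\<tau> \<omega>"] by simp
        then show ?thesis using elim(2) t that by auto
      qed
      have "continuous_on {0..t} (\<lambda>s. X0 \<omega> + integral {0..s} (g \<omega>) + sqrt 2 * W s \<omega>)"
        using elim(2) t by (intro continuous_intros indefinite_integral_continuous_1 continuous_on_subset[OF elim(1)]) auto
      then show "continuous_on {0..t} (\<lambda>s. V s \<omega>)" by (rule iffD2[OF continuous_on_cong[OF refl V_eq], rotated])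
    qed
  qed
  show "AE \<omega> in M. right_regular (\<lambda>r \<omega>. ereal r < \<tau> \<omega>) V \<omega>"
    using c
  proof eventually_elim
    case (elim \<omega>)
    show ?case
      unfolding right_regular_def
    proof
      fix r assume r: "r \<in> {0..<T}"
      show "if ereal r < \<tau> \<omega> then (\<forall>\<^sub>F s in at_right r. ereal s < \<tau> \<omega>) \<and> ((\<lambda>s. V s \<omega>) \<longlongrightarrow> V r \<omega>) (at_right r)
        else (\<forall>\<^sub>F s in at_right r. \<not> ereal s < \<tau> \<omega>)"
      proof (cases "ereal r < \<tau> \<omega>")
        case True
        \<comment> \<open>The equation is used on [0, t] with \<open>t\<close> strictly between
          \<open>r\<close> and \<tau>, since it says nothing at \<tau> itself; \<open>t\<close> is
          cut off at \<open>T\<close>.\<close>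
        then obtain c where "ereal r < ereal c" "ereal c < \<tau> \<omega>" using ereal_dense2 by blast
        then obtain t where t: "r < t" "ereal t < \<tau> \<omega>" "t \<le> T" 
          using r by (intro that[of "min c T"]) (auto intro: le_less_trans[of _ "ereal c"])
        have "ereal s < \<tau> \<omega>" if "s \<in> {r<..<t}" for s
          using that t(2) order.strict_trans[of "ereal s" "ereal t" "\<tau> \<omega>"] by simp
        then have "\<forall>\<^sub>F s in at_right r. ereal s < \<tau> \<omega>" by (rule eventually_at_rightI) (use t in auto)
        moreover have "((\<lambda>s. V s \<omega>) \<longlongrightarrow> V r \<omega>) (at_right r)"
          using r t by (intro continuous_at_right[OF elim[rule_format, of t]]) auto
        ultimately show ?thesis using True by simp
      next
        case False
        have "\<not> ereal s < \<tau> \<omega>" if "s \<in> {r<..<T}" for s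
          using False that order.strict_trans[of "ereal r" "ereal s" "\<tau> \<omega>"] by auto
        then have "\<forall>\<^sub>F s in at_right r. \<not> ereal s < \<tau> \<omega>" by (rule eventually_at_rightI) (use r in auto)
        with False show ?thesis by simp
      qed
    qed
  qed
qed

text \<open>Freeze the law field \<open>F\<close> of the solution. Before killing, pathwise
  uniqueness identifies the state with the path driven by \<open>F\<close>; then the clocks agree up
  to \<tau>, so survival is the same event. The killed driven path therefore generates the field of
  the solution, which is \<open>F\<close> itself.\<close>

lemma sol_fixed_point:
  assumes "sol V \<tau>"
  defines "F \<equiv> law_field \<tau> V"
  shows "F \<in> adm" "\<And>t x. t \<in> {0..T} \<Longrightarrow> \<Phi> F (t, x) = F (t, x)"
    "AE \<omega> in M. \<forall>t\<in>{0..T}. (ereal t < \<tau> \<omega> \<longleftrightarrow> alive F t \<omega>) \<and> (ereal t < \<tau> \<omega> \<longrightarrow> V t \<omega> = state F t \<omega>)"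
proof -
  let ?S = "\<lambda>r \<omega>. ereal r < \<tau> \<omega>"
  have V: "\<And>t. t \<in> {0..T} \<Longrightarrow> V t \<in> borel_measurable M" and [measurable]: "\<tau> \<in> borel_measurable M"
    and eqV: "AE \<omega> in M. \<forall>t\<in>{0..T}. ereal t < \<tau> \<omega> \<longrightarrow>
        (\<lambda>s. b (F (s, V s \<omega>))) integrable_on {0..t} \<and>
        V t \<omega> = X0 \<omega> + integral {0..t} (\<lambda>s. b (F (s, V s \<omega>))) + sqrt 2 * W t \<omega>"
    and eq\<tau>: "AE \<omega> in M. (\<forall>t\<in>{0..T}. intensity \<tau> V \<omega> integrable_on {0..t}) \<and>
        \<tau> \<omega> = passage T (\<lambda>t. integral {0..t} (intensity \<tau> V \<omega>)) (Z \<omega>)"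
    using assms(1) by (auto simp: sol_def F_def)
  have m: "meas ?S V" using V by (auto simp: meas_def)
  note c = integral_process_continuous[OF eqV] and reg = integral_process_right_regular[OF eqV]
  show F: "F \<in> adm" unfolding F_def law_field_def by (rule field_adm[OF m reg])
  show eq: "AE \<omega> in M. \<forall>t\<in>{0..T}. (ereal t < \<tau> \<omega> \<longleftrightarrow> alive F t \<omega>) \<and> (ereal t < \<tau> \<omega> \<longrightarrow> V t \<omega> = state F t \<omega>)"
    using W_cont eqV eq\<tau> c
  proof eventually_elim
    case (elim \<omega>)
    have V_eq: "V t \<omega> = state F t \<omega>" if t: "t \<in> {0..T}" "ereal t < \<tau> \<omega>" for t
      unfolding state_def
    proof (rule Y_unique[OF F elim(1) t(1) elim(4)[rule_format, OF t]])
      fix s assume s: "s \<in> {0..t}"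
      then have "ereal s < \<tau> \<omega>" using t(2) le_less_trans[of "ereal s" "ereal t" "\<tau> \<omega>"] by simp
      then show "V s \<omega> = X0 \<omega> + integral {0..s} (\<lambda>r. b (F (r, V r \<omega>))) + sqrt 2 * W s \<omega>" using elim(2) s t by auto
    qed
    have "alive F t \<omega> \<longleftrightarrow> ereal t < \<tau> \<omega>" if t: "t \<in> {0..T}" for t
      unfolding alive_def conjunct2[OF elim(3)]
    proof (rule less_passage_iff[symmetric, OF cont_\<Lambda>[OF F elim(1)] _ mono_\<Lambda>[OF F elim(1)] _ t])
      show "continuous_on {0..T} (\<lambda>t. integral {0..t} (intensity \<tau> V \<omega>))"
        using elim(3) T_pos by (intro indefinite_integral_continuous_1) auto
      fix t assume t: "t \<in> {0..T}" "ereal t \<le> passage T (\<lambda>t. integral {0..t} (intensity \<tau> V \<omega>)) (Z \<omega>)"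
      then have le: "ereal t \<le> \<tau> \<omega>" using elim(3) by simp
      have "integral {0..t} (\<lambda>s. h (F (s, Y F (X0 \<omega>) (W_path \<omega>) s))) = integral {0..t} (intensity \<tau> V \<omega>)"
      \<comment> \<open>\<open>t = \<tau> \<omega>\<close> is allowed, and there the intensity has
        already switched to \<open>h0\<close>; a single point does not change the integral.\<close>
      proof (rule integral_spike[of "{t}"])
        fix s assume s: "s \<in> {0..t} - {t}"
        then have "ereal s < \<tau> \<omega>" using le less_le_trans[of "ereal s" "ereal t" "\<tau> \<omega>"] by simp
        then show "intensity \<tau> V \<omega> s = h (F (s, Y F (X0 \<omega>) (W_path \<omega>) s))"
          using V_eq[of s] s t by (auto simp: intensity_def F_def[symmetric] state_def)
      qed simp
      then show "\<Lambda> F (X0 \<omega>) (W_path \<omega>) t = integral {0..t} (intensity \<tau> V \<omega>)"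
        by (simp add: \<Lambda>_eq[OF F elim(1) t(1)])
    qed
    with V_eq show ?case by blast
  qed
  have eq': "AE \<omega> in M. \<forall>r\<in>{0..T}. (ereal r < \<tau> \<omega>) = alive F r \<omega> \<and> (ereal r < \<tau> \<omega> \<longrightarrow> V r \<omega> = state F r \<omega>)"
    using eq by eventually_elim blast
  show "\<Phi> F (t, x) = F (t, x)" if "t \<in> {0..T}" for t x
    using field_cong[OF m meas_flow[OF F] eq' that, of x] by (simp add: \<Phi>_def F_def law_field_def)
qed

lemma sol_unique:
  assumes "sol V1 \<tau>1" "sol V2 \<tau>2"
  shows "AE \<omega> in M. \<forall>t\<in>{0..T}. killed \<tau>1 V1 t \<omega> = killed \<tau>2 V2 t \<omega>"
proof -
  note S1 = sol_fixed_point[OF assms(1)] and S2 = sol_fixed_point[OF assms(2)]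
  let ?F = "law_field \<tau>1 V1" and ?G = "law_field \<tau>2 V2"
  have eq: "?F (t, x) = ?G (t, x)" if "t \<in> {0..T}" for t x
    by (rule fixed_point_unique[OF S1(1,2) S2(1,2) that])
  have cong: "alive ?F t \<omega> = alive ?G t \<omega>" "state ?F t \<omega> = state ?G t \<omega>" if "t \<in> {0..T}" for t \<omega>
    unfolding alive_def state_def using that eq
    by (auto intro!: Y_cong arg_cong2[where f="(<)"] \<Lambda>_cong simp: \<Lambda>_cong[of t "W_path \<omega>" "W_path \<omega>" ?F ?G])
  show ?thesis
    using S1(3) S2(3)
  proof eventually_elim
    case (elim \<omega>)
    then show ?case by (auto simp: killed_def cong)
  qed
qed

text \<open>The events of \<tau> are described exactly, with the null set \<open>N\<close> named,
  because adaptedness of \<tau> is a statement about sets and not about almost every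
  \<omega>.\<close>

lemma fixed_point_sol:
  assumes F: "F \<in> adm" "\<And>t x. t \<in> {0..T} \<Longrightarrow> \<Phi> F (t, x) = F (t, x)"
  obtains \<tau> N where "sol (state F) \<tau>" "N \<in> null_sets M"
    "\<And>t. t \<in> {0..T} \<Longrightarrow> {\<omega> \<in> space M. \<tau> \<omega> \<le> ereal t} = {\<omega> \<in> space M. Z \<omega> \<le> \<Lambda> F (X0 \<omega>) (W_path \<omega>) t} - N"
proof -
  obtain N where N: "\<And>\<omega>. \<omega> \<in> space M - N \<Longrightarrow> continuous_on {0..T} (W_path \<omega>)" "N \<in> null_sets M"
    using W_cont by (rule AE_E3) auto
  have W': "continuous_on {0..T} (W_path \<omega>)" if "\<omega> \<in> space M" "\<omega> \<notin> N" for \<omega> using N that by auto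
  \<comment> \<open>On \<open>N\<close> the path may be discontinuous, and the passage time need not
    be determined by clock values at fixed times. The value infinity removes \<open>N\<close> from
    every event \<open>\<tau> \<omega> \<le> ereal y\<close>.\<close>
  define \<tau> where "\<tau> \<omega> = (if \<omega> \<in> N then \<infinity> else passage T (\<Lambda> F (X0 \<omega>) (W_path \<omega>)) (Z \<omega>))" for \<omega>
  have le_iff: "{\<omega> \<in> space M. \<tau> \<omega> \<le> ereal y} = {\<omega> \<in> space M. Z \<omega> \<le> \<Lambda> F (X0 \<omega>) (W_path \<omega>) (min y T)} - N" if "0 \<le> y" for y
    using passage_le_iff[OF cont_\<Lambda>[OF F(1) W'] mono_\<Lambda>[OF F(1) W'] _ that] T_pos by (auto simp: \<tau>_def)
  have [measurable]: "\<tau> \<in> borel_measurable M"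
  proof (rule borel_measurableI_le)
    fix y :: ereal
    have nonneg: "0 \<le> \<tau> \<omega>" for \<omega> by (auto simp: \<tau>_def passage_nonneg)
    consider "y < 0" | "y = \<infinity>" | r where "y = ereal r" "0 \<le> r" 
    proof (cases y)
      case (real r)
      then show thesis using that by (cases "r < 0") auto
    qed (use that in auto)
    then show "{\<omega> \<in> space M. \<tau> \<omega> \<le> y} \<in> sets M"
    proof cases
      case 1
      then have eq: "{\<omega> \<in> space M. \<tau> \<omega> \<le> y} = {}" using nonneg by (auto simp: not_le intro: less_le_trans)
      show ?thesis unfolding eq by simp
    next
      case 3
      have [measurable]: "(\<lambda>\<omega>. \<Lambda> F (X0 \<omega>) (W_path \<omega>) (min r T)) \<in> borel_measurable M"
        using 3 T_pos by (intro measurable_clock F) auto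
      have [measurable]: "N \<in> sets M" using N by auto
      show ?thesis unfolding 3(1) le_iff[OF 3(2)] by measurable
    qed simp
  qed
  have aeN: "AE \<omega> in M. \<omega> \<notin> N" using N(2) by (rule AE_not_in)
  have alive: "ereal t < \<tau> \<omega> \<longleftrightarrow> alive F t \<omega>" if "\<omega> \<in> space M" "\<omega> \<notin> N" "t \<in> {0..T}" for t \<omega>
    using less_passage_iff[OF cont_\<Lambda>[OF F(1) W'[OF that(1,2)]] cont_\<Lambda>[OF F(1) W'[OF that(1,2)]] mono_\<Lambda>[OF F(1) W'[OF that(1,2)]] refl that(3)] that(2)
    by (simp add: \<tau>_def alive_def)
  have V: "t \<in> {0..T} \<Longrightarrow> state F t \<in> borel_measurable M" for t using meas_flow[OF F(1)] by (auto simp: meas_def)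
  have "meas (\<lambda>r \<omega>. ereal r < \<tau> \<omega>) (state F)" using V by (auto simp: meas_def)
  moreover have "AE \<omega> in M. \<forall>r\<in>{0..T}. (ereal r < \<tau> \<omega>) = alive F r \<omega> \<and> (ereal r < \<tau> \<omega> \<longrightarrow> state F r \<omega> = state F r \<omega>)"
    using aeN AE_space by eventually_elim (simp add: alive)
  \<comment> \<open>The killed path just built has law field \<open>\<Phi> F\<close>; here the
    fixed-point equation turns it into \<open>F\<close>.\<close>
  ultimately have field: "law_field \<tau> (state F) (t, x) = F (t, x)" if "t \<in> {0..T}" for t x
    using field_cong[OF _ meas_flow[OF F(1)] _ that] F(2)[OF that] by (simp add: law_field_def \<Phi>_def)
  have "AE \<omega> in M. \<forall>t\<in>{0..T}. ereal t < \<tau> \<omega> \<longrightarrow>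
        (\<lambda>s. b (law_field \<tau> (state F) (s, state F s \<omega>))) integrable_on {0..t} \<and>
        state F t \<omega> = X0 \<omega> + integral {0..t} (\<lambda>s. b (law_field \<tau> (state F) (s, state F s \<omega>))) + sqrt 2 * W t \<omega>"
    using W_cont
  proof eventually_elim
    case (elim \<omega>)
    show ?case
    proof (intro ballI impI)
      fix t assume t: "t \<in> {0..T}"
      have eq: "b (F (s, state F s \<omega>)) = b (law_field \<tau> (state F) (s, state F s \<omega>))" if "s \<in> {0..t}" for s
        using field that t by auto
      have "(\<lambda>s. b (F (s, state F s \<omega>))) integrable_on {0..t}"
        unfolding state_def using t
        by (intro integrable_continuous_real cont_comp(1)[OF F(1)] continuous_on_subset[OF cont_Y[OF F(1) elim]]) auto
      then have "(\<lambda>s. b (law_field \<tau> (state F) (s, state F s \<omega>))) integrable_on {0..t}"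
        by (rule integrable_eq) (rule eq)
      moreover have "integral {0..t} (\<lambda>s. b (F (s, state F s \<omega>))) = integral {0..t} (\<lambda>s. b (law_field \<tau> (state F) (s, state F s \<omega>)))"
        by (rule Henstock_Kurzweil_Integration.integral_cong) (rule eq)
      moreover have "state F t \<omega> = X0 \<omega> + integral {0..t} (\<lambda>s. b (F (s, state F s \<omega>))) + sqrt 2 * W t \<omega>"
        unfolding state_def by (rule Y_eq[OF F(1) elim t])
      ultimately show "(\<lambda>s. b (law_field \<tau> (state F) (s, state F s \<omega>))) integrable_on {0..t} \<and>
        state F t \<omega> = X0 \<omega> + integral {0..t} (\<lambda>s. b (law_field \<tau> (state F) (s, state F s \<omega>))) + sqrt 2 * W t \<omega>"
        by simp
    qed
  qed
  moreover have "AE \<omega> in M. (\<forall>t\<in>{0..T}. intensity \<tau> (state F) \<omega> integrable_on {0..t}) \<and>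
        \<tau> \<omega> = passage T (\<lambda>t. integral {0..t} (intensity \<tau> (state F) \<omega>)) (Z \<omega>)"
    using aeN AE_space
  proof eventually_elim
    case (elim \<omega>)
    note w = W'[OF elim(2,1)]
    \<comment> \<open>Up to and including \<tau> the intensity is that of the driven path, except
      possibly at the endpoint, so the two clocks coincide.\<close>
    have before: "intensity \<tau> (state F) \<omega> integrable_on {0..t}"
      "integral {0..t} (intensity \<tau> (state F) \<omega>) = \<Lambda> F (X0 \<omega>) (W_path \<omega>) t" if t: "t \<in> {0..T}" "ereal t \<le> \<tau> \<omega>" for t
    proof -
      have eq: "intensity \<tau> (state F) \<omega> s = h (F (s, Y F (X0 \<omega>) (W_path \<omega>) s))" if s: "s \<in> {0..t} - {t}" for s
      proof -
        have "ereal s < \<tau> \<omega>" using t(2) s less_le_trans[of "ereal s" "ereal t" "\<tau> \<omega>"] by simp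
        then show ?thesis using field s t by (simp add: intensity_def state_def)
      qed
      have "(\<lambda>s. h (F (s, Y F (X0 \<omega>) (W_path \<omega>) s))) integrable_on {0..t}"
        using t by (intro integrable_continuous_real continuous_on_subset[OF cont_hY[OF F(1) w]]) auto
      then show "intensity \<tau> (state F) \<omega> integrable_on {0..t}"
        by (rule integrable_spike[of _ _ "{t}"]) (use eq in auto)
      have "integral {0..t} (intensity \<tau> (state F) \<omega>) = integral {0..t} (\<lambda>s. h (F (s, Y F (X0 \<omega>) (W_path \<omega>) s)))"
        by (rule integral_spike[of "{t}"]) (use eq in auto)
      then show "integral {0..t} (intensity \<tau> (state F) \<omega>) = \<Lambda> F (X0 \<omega>) (W_path \<omega>) t"
        using \<Lambda>_eq[OF F(1) w t(1)] by simp
    qed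
    have "intensity \<tau> (state F) \<omega> integrable_on {0..t}" if t: "t \<in> {0..T}" for t
    proof (cases "ereal t \<le> \<tau> \<omega>")
      case False
      moreover have "0 \<le> \<tau> \<omega>" by (auto simp: \<tau>_def passage_nonneg)
      ultimately obtain u where u: "\<tau> \<omega> = ereal u" "0 \<le> u" "u < t" by (cases "\<tau> \<omega>") auto
      \<comment> \<open>From \<tau> on the intensity is constant; the two pieces are glued at
        \<open>u\<close>.\<close>
      have "(\<lambda>s. h0) integrable_on {u..t}" by (rule integrable_const_ivl)
      then have "intensity \<tau> (state F) \<omega> integrable_on {u..t}"
        by (rule integrable_eq) (use u in \<open>auto simp: intensity_def\<close>)
      moreover have "intensity \<tau> (state F) \<omega> integrable_on {0..u}" using u t by (intro before) auto
      ultimately show ?thesis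
        using u by (intro Henstock_Kurzweil_Integration.integrable_combine[of 0 u t]) auto
    qed (use before t in blast)
    moreover have "passage T (\<lambda>t. integral {0..t} (intensity \<tau> (state F) \<omega>)) (Z \<omega>) = passage T (\<Lambda> F (X0 \<omega>) (W_path \<omega>)) (Z \<omega>)"
      by (rule passage_cong[OF cont_\<Lambda>[OF F(1) w]]) (use before elim in \<open>auto simp: \<tau>_def\<close>)
    ultimately show ?case using elim by (simp add: \<tau>_def)
  qed
  ultimately have "sol (state F) \<tau>" using V by (simp add: sol_def)
  then show thesis
  proof (rule that[OF _ N(2)])
    show "{\<omega> \<in> space M. \<tau> \<omega> \<le> ereal t} = {\<omega> \<in> space M. Z \<omega> \<le> \<Lambda> F (X0 \<omega>) (W_path \<omega>) t} - N" if "t \<in> {0..T}" for t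
      using le_iff[of t] that by simp
  qed
qed

end

section \<open>The law of the data\<close>

lemma brownian_motion_measurable:
  assumes "filtration_on M F" "brownian_motion M F W" "0 \<le> s" "s \<le> t"
  shows "W s \<in> borel_measurable (F t)" "W s \<in> borel_measurable M"
proof -
  have s: "W s \<in> borel_measurable (F s)" "subalgebra M (F s)" "subalgebra M (F t)" "sets (F s) \<subseteq> sets (F t)"
    using assms by (auto simp: brownian_motion_def filtration_on_def)
  then show "W s \<in> borel_measurable M" by (metis measurable_from_subalg)
  have "subalgebra (F t) (F s)" using s by (auto simp: subalgebra_def)
  then show "W s \<in> borel_measurable (F t)" using s(1) by (rule measurable_from_subalg)
qed

text \<open>\<open>s\<close> is the last time in \<open>D\<close>, so the values on \<open>D\<close>
  are measurable for \<open>F s\<close> and independent of the increment up to \<open>b\<close>;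
  \<open>G\<close> appends the new value. The right-hand side involves only the old
  finite-dimensional law and a Gaussian. \<open>lift\<close> makes the increment a function on one
  index, so that both variables of \<open>indep_var\<close> have the same value type.\<close>

lemma brownian_increment_law:
  fixes W :: "real \<Rightarrow> 'a \<Rightarrow> real"
  assumes M: "prob_space M" "filtration_on M F" "brownian_motion M F W"
    and D: "finite D" "D \<subseteq> {0..s}" "s \<in> D" and b: "s < b"
  defines "G \<equiv> \<lambda>(u, r). (\<lambda>(u, y). u(b := y)) (u, u s + r b)" and "lift \<equiv> \<lambda>r :: real. \<lambda>j\<in>{b}. r"
  shows "distr M (PiM (insert b D) (\<lambda>_. borel)) (\<lambda>\<omega>. \<lambda>j\<in>insert b D. W j \<omega>) =
    distr (distr M (PiM D (\<lambda>_. borel)) (\<lambda>\<omega>. \<lambda>j\<in>D. W j \<omega>)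
        \<Otimes>\<^sub>M distr (density lborel (\<lambda>x. ennreal (normal_density 0 (sqrt (b - s)) x))) (PiM {b} (\<lambda>_. borel)) lift)
      (PiM (insert b D) (\<lambda>_. borel)) G"
proof -
  interpret prob_space M by fact
  let ?U = "\<lambda>\<omega>. \<lambda>j\<in>D. W j \<omega>" and ?R = "\<lambda>\<omega>. W b \<omega> - W s \<omega>"
  let ?P = "PiM D (\<lambda>_. borel) :: (real \<Rightarrow> real) measure" and ?Q = "PiM {b} (\<lambda>_. borel) :: (real \<Rightarrow> real) measure"
  note Wm = brownian_motion_measurable[OF M(2,3)]
  have s0: "0 \<le> s" using D by auto
  have sub: "subalgebra M (F s)" using M(2) s0 by (auto simp: filtration_on_def)
  have sp: "space (F s) = space M" using sub by (simp add: subalgebra_def)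
  have UF: "?U \<in> measurable (F s) ?P" using D by (intro measurable_restrict Wm(1)) auto
  have U[measurable]: "?U \<in> measurable M ?P" using sub UF by (rule measurable_from_subalg)
  have [measurable]: "W b \<in> borel_measurable M" "W s \<in> borel_measurable M"
    using b s0 by (auto intro: Wm(2))
  have lift[measurable]: "lift \<in> measurable borel ?Q" unfolding lift_def by measurable
  have R: "lift \<circ> ?R \<in> measurable M ?Q" by (rule measurable_comp[OF _ lift]) measurable
  have RG: "lift \<circ> ?R \<in> measurable (sigma (space M) (gen_sigma M {?R})) ?Q"
    by (rule measurable_comp[OF measurable_gen_sigma lift]) simp
  have ind: "indep_sets (\<lambda>i. if i then sets (F s) else gen_sigma M {?R}) UNIV"
    and law: "distr M borel ?R = density lborel (\<lambda>x. ennreal (normal_density 0 (sqrt (b - s)) x))"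
    using M(3) s0 b by (auto simp: brownian_motion_def)
  have "indep_set (sigma_sets (space M) {?U -` A \<inter> space M | A. A \<in> sets ?P})
    (sigma_sets (space M) {(lift \<circ> ?R) -` A \<inter> space M | A. A \<in> sets ?Q})"
    unfolding indep_set_def
  proof (rule indep_sets_mono_sets[OF ind])
    have "{?U -` A \<inter> space M | A. A \<in> sets ?P} \<subseteq> sets (F s)"
      using measurable_sets[OF UF] unfolding sp by blast
    then have "sigma_sets (space (F s)) {?U -` A \<inter> space M | A. A \<in> sets ?P} \<subseteq> sets (F s)"
      by (rule sets.sigma_sets_subset)
    then have "sigma_sets (space M) {?U -` A \<inter> space M | A. A \<in> sets ?P} \<subseteq> sets (F s)"
      unfolding sp .
    moreover have "sigma_sets (space M) {(lift \<circ> ?R) -` A \<inter> space M | A. A \<in> sets ?Q} \<subseteq> gen_sigma M {?R}"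
    proof -
      let ?N = "sigma (space M) (gen_sigma M {?R})"
      have spN: "space ?N = space M" by (simp add: space_measure_of_conv)
      have "{(lift \<circ> ?R) -` A \<inter> space M | A. A \<in> sets ?Q} \<subseteq> sets ?N"
        using measurable_sets[OF RG] unfolding spN by blast
      then have "sigma_sets (space ?N) {(lift \<circ> ?R) -` A \<inter> space M | A. A \<in> sets ?Q} \<subseteq> sets ?N"
        by (rule sets.sigma_sets_subset)
      then show ?thesis unfolding spN sets_gen_sigma .
    qed
    ultimately show "case_bool (sigma_sets (space M) {?U -` A \<inter> space M | A. A \<in> sets ?P})
        (sigma_sets (space M) {(lift \<circ> ?R) -` A \<inter> space M | A. A \<in> sets ?Q}) i
      \<subseteq> (if i then sets (F s) else gen_sigma M {?R})" for i
      by (cases i) (simp_all only: bool.case if_True if_False)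
  qed
  then have "indep_var ?P ?U ?Q (lift \<circ> ?R)" unfolding indep_var_eq using U R by blast
  then have "distr M ?P ?U \<Otimes>\<^sub>M distr M ?Q (lift \<circ> ?R) = distr M (?P \<Otimes>\<^sub>M ?Q) (\<lambda>\<omega>. (?U \<omega>, (lift \<circ> ?R) \<omega>))"
    unfolding indep_var_distribution_eq by blast
  moreover have "distr M ?Q (lift \<circ> ?R) = distr (distr M borel ?R) ?Q lift"
    by (rule distr_distr[symmetric, OF lift]) measurable
  ultimately have joint: "distr M ?P ?U \<Otimes>\<^sub>M distr (distr M borel ?R) ?Q lift = distr M (?P \<Otimes>\<^sub>M ?Q) (\<lambda>\<omega>. (?U \<omega>, (lift \<circ> ?R) \<omega>))"
    by simp
  have G[measurable]: "G \<in> measurable (?P \<Otimes>\<^sub>M ?Q) (PiM (insert b D) (\<lambda>_. borel))"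
  proof -
    have [measurable]: "(\<lambda>u. u s) \<in> borel_measurable ?P" "(\<lambda>r. r b) \<in> borel_measurable ?Q"
      using D by (auto intro!: measurable_component_singleton)
    have "(\<lambda>(u, r). (u, u s + r b)) \<in> measurable (?P \<Otimes>\<^sub>M ?Q) (?P \<Otimes>\<^sub>M borel)" by measurable
    from measurable_compose[OF this measurable_add_dim[where I=D and M="\<lambda>_. borel" and i=b]]
    show ?thesis by (simp add: G_def split_def)
  qed
  have eq: "(\<lambda>j\<in>insert b D. W j \<omega>) = G (?U \<omega>, (lift \<circ> ?R) \<omega>)" for \<omega>
    using D b by (auto simp: G_def lift_def restrict_def fun_eq_iff)
  have UR: "(\<lambda>\<omega>. (?U \<omega>, (lift \<circ> ?R) \<omega>)) \<in> measurable M (?P \<Otimes>\<^sub>M ?Q)"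
    by (rule measurable_Pair[OF U R])
  show ?thesis
    unfolding law[symmetric] joint distr_distr[OF G UR] by (simp only: eq comp_def)
qed

text \<open>Times are added in increasing order, each by \<open>brownian_increment_law\<close>. Time
  0 is always included, so that the first positive time has a predecessor too.\<close>

lemma brownian_motion_law_unique:
  fixes W1 :: "real \<Rightarrow> 'b \<Rightarrow> real" and W2 :: "real \<Rightarrow> 'c \<Rightarrow> real"
  assumes M1: "prob_space M1" "filtration_on M1 F1" "brownian_motion M1 F1 W1"
    and M2: "prob_space M2" "filtration_on M2 F2" "brownian_motion M2 F2 W2"
    and "finite J" "J \<subseteq> {0..}"
  shows "distr M1 (PiM (insert 0 J) (\<lambda>_. borel)) (\<lambda>\<omega>. \<lambda>j\<in>insert 0 J. W1 j \<omega>) =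
    distr M2 (PiM (insert 0 J) (\<lambda>_. borel)) (\<lambda>\<omega>. \<lambda>j\<in>insert 0 J. W2 j \<omega>)"
  using assms(7,8)
proof (induction J rule: finite_linorder_max_induct)
  case empty
  have "distr M (PiM {0} (\<lambda>_. borel)) (\<lambda>\<omega>. \<lambda>j\<in>{0}. W j \<omega>) = return (PiM {0} (\<lambda>_. borel)) (\<lambda>j\<in>{0::real}. 0::real)"
    if M: "prob_space M" "filtration_on M F" "brownian_motion M F W"
    for M :: "'d measure" and F W
  proof -
    interpret prob_space M by fact
    have "AE \<omega> in M. W 0 \<omega> = 0" using M(3) by (auto simp: brownian_motion_def)
    then have "AE \<omega> in M. (\<lambda>j\<in>{0}. W j \<omega>) = (\<lambda>j\<in>{0}. 0)" by eventually_elim (auto simp: restrict_def)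
    then have "distr M (PiM {0} (\<lambda>_. borel)) (\<lambda>\<omega>. \<lambda>j\<in>{0}. W j \<omega>) = distr M (PiM {0} (\<lambda>_. borel)) (\<lambda>_. \<lambda>j\<in>{0}. 0)"
      using brownian_motion_measurable(2)[OF M(2,3)] by (intro distr_cong_AE measurable_restrict) auto
    then show ?thesis by (subst (asm) distr_const) (auto simp: space_PiM)
  qed
  from this[OF M1] this[OF M2] show ?case by (simp only:)
next
  case (insert b J)
  show ?case
  proof (cases "b = 0")
    case True
    \<comment> \<open>\<open>b = 0\<close> exceeds all elements of \<open>J\<close>, which are
      nonnegative.\<close>
    then have "J = {}" using insert by force
    then show ?thesis using insert.IH True by simp
  next
    case False
    then have b: "0 < b" using insert.prems by auto
    let ?D = "insert 0 J"
    have IH: "distr M1 (PiM ?D (\<lambda>_. borel)) (\<lambda>\<omega>. \<lambda>j\<in>?D. W1 j \<omega>) = distr M2 (PiM ?D (\<lambda>_. borel)) (\<lambda>\<omega>. \<lambda>j\<in>?D. W2 j \<omega>)"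
      using insert by blast
    have D: "finite ?D" "?D \<subseteq> {0..Max ?D}" "Max ?D \<in> ?D" "Max ?D < b"
    proof -
      show fin: "finite ?D" using insert by simp
      show "Max ?D \<in> ?D" using fin by (intro Max_in) auto
      show "?D \<subseteq> {0..Max ?D}" using fin insert.prems by (auto intro: Max_ge)
      show "Max ?D < b" using fin insert b by (subst Max_less_iff) auto
    qed
    show ?thesis
      unfolding insert_commute[of 0 b J]
      by (subst brownian_increment_law[OF M1 D], subst brownian_increment_law[OF M2 D]) (simp only: IH)
  qed
qed

text \<open>The driving path sits at the nonnegative indices, \<open>Z\<close> at \<open>- 1\<close> and \<open>X0\<close> at all other negative ones; it is read
  off at \<open>- 2\<close>. With index set \<open>UNIV\<close> no coordinate of the product space is undefined.\<close>
definition data_path :: "('a \<Rightarrow> real) \<Rightarrow> (real \<Rightarrow> 'a \<Rightarrow> real) \<Rightarrow> ('a \<Rightarrow> real) \<Rightarrow> 'a \<Rightarrow> real \<Rightarrow> real" where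
  "data_path X0 W Z \<omega> i = (if 0 \<le> i then W i \<omega> else if i = - 1 then Z \<omega> else X0 \<omega>)"

lemma measurable_data_path:
  assumes "X0 \<in> borel_measurable M" "\<And>t. 0 \<le> t \<Longrightarrow> W t \<in> borel_measurable M" "Z \<in> borel_measurable M"
  shows "data_path X0 W Z \<in> measurable M (PiM UNIV (\<lambda>_. borel))"
proof (rule measurable_PiM_single')
  show "(\<lambda>\<omega>. data_path X0 W Z \<omega> i) \<in> borel_measurable M" for i
    unfolding data_path_def using assms by (cases "0 \<le> i"; cases "i = - 1") auto
qed auto

context
  fixes \<rho>0 :: "real \<Rightarrow> real" and M :: "'a measure" and F X0 W Z
  assumes data: "data_setup \<rho>0 M F X0 W Z"
begin

lemma data_measurable:
  shows "X0 \<in> borel_measurable M" "0 \<le> t \<Longrightarrow> W t \<in> borel_measurable M" "Z \<in> borel_measurable M"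
proof -
  have "subalgebra M (F 0)" "X0 \<in> borel_measurable (F 0)"
    using data by (auto simp: data_setup_def filtration_on_def)
  then show "X0 \<in> borel_measurable M" by (rule measurable_from_subalg)
  show "Z \<in> borel_measurable M" using data by (auto simp: data_setup_def)
  show "W t \<in> borel_measurable M" if "0 \<le> t"
    using data that brownian_motion_measurable(2)[of M F W t t] by (auto simp: data_setup_def)
qed

text \<open>A cylinder splits into one event for each of \<open>X0\<close>, \<open>W\<close> and
  \<open>Z\<close>, and their probabilities multiply. All coordinates that copy \<open>X0\<close>
  collapse into the intersection \<open>B\<close>; \<open>D\<close> contains 0 to match
  \<open>brownian_motion_law_unique\<close>. The right-hand side sees the space only through the
  finite-dimensional law of \<open>W\<close>.\<close>

lemma data_finite_dimensional:
  assumes J: "finite J" and A: "\<And>i. i \<in> J \<Longrightarrow> A i \<in> sets borel"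
  defines "B \<equiv> \<Inter>i\<in>{i \<in> J. i < 0 \<and> i \<noteq> - 1}. A i" and "C \<equiv> if - 1 \<in> J then A (- 1) else UNIV"
    and "D \<equiv> insert 0 {i \<in> J. 0 \<le> i}"
  shows "emeasure (distr M (PiM UNIV (\<lambda>_. borel)) (data_path X0 W Z)) (prod_emb UNIV (\<lambda>_. borel) J (Pi\<^sub>E J A)) =
    ennreal (measure (density lborel (\<lambda>x. ennreal (\<rho>0 x))) B
      * measure (distr M (PiM D (\<lambda>_. borel)) (\<lambda>\<omega>. \<lambda>j\<in>D. W j \<omega>)) (\<Pi>\<^sub>E j\<in>D. if j \<in> J then A j else UNIV)
      * measure (density lborel (\<lambda>x. ennreal (exponential_density 1 x))) C)"
proof -
  interpret prob_space M using data by (simp add: data_setup_def)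
  note m = data_measurable
  have [measurable]: "C \<in> sets borel" using A by (simp add: C_def)
  have [measurable]: "B \<in> sets borel"
  proof (cases "{i \<in> J. i < 0 \<and> i \<noteq> - 1} = {}")
    case True
    then show ?thesis unfolding B_def True by simp
  next
    case False
    then show ?thesis unfolding B_def using J A by (intro sets.finite_INT) auto
  qed
  let ?V = "data_path X0 W Z"
  define E where "E k = (if k = 0 then X0 -` B \<inter> space M
    else if k = 1 then {\<omega> \<in> space M. \<forall>j\<in>{i \<in> J. 0 \<le> i}. W j \<omega> \<in> A j} else Z -` C \<inter> space M)" for k :: nat
  have emb: "prod_emb UNIV (\<lambda>_. borel) J (Pi\<^sub>E J A) \<in> sets (PiM UNIV (\<lambda>_. borel))"
    using J A by (intro sets_PiM_I) auto
  have "?V -` prod_emb UNIV (\<lambda>_. borel) J (Pi\<^sub>E J A) \<inter> space M = (\<Inter>k\<in>{0, 1, 2}. E k)"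
  proof -
    have "?V \<omega> \<in> prod_emb UNIV (\<lambda>_. borel) J (Pi\<^sub>E J A) \<longleftrightarrow> (\<forall>i\<in>J. ?V \<omega> i \<in> A i)" for \<omega>
      by (auto simp: prod_emb_def PiE_iff extensional_def)
    moreover have "(\<forall>i\<in>J. ?V \<omega> i \<in> A i) \<longleftrightarrow> X0 \<omega> \<in> B \<and> (\<forall>j\<in>{i \<in> J. 0 \<le> i}. W j \<omega> \<in> A j) \<and> Z \<omega> \<in> C" for \<omega>
    proof -
      have "?V \<omega> i = W i \<omega>" if "0 \<le> i" for i using that by (simp add: data_path_def)
      moreover have "?V \<omega> (- 1) = Z \<omega>" by (simp add: data_path_def)
      moreover have "?V \<omega> i = X0 \<omega>" if "i < 0" "i \<noteq> - 1" for i using that by (simp add: data_path_def)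
      moreover have "(\<forall>i\<in>J. ?V \<omega> i \<in> A i) \<longleftrightarrow> (\<forall>i\<in>{i \<in> J. i < 0 \<and> i \<noteq> - 1}. ?V \<omega> i \<in> A i)
          \<and> (\<forall>i\<in>{i \<in> J. 0 \<le> i}. ?V \<omega> i \<in> A i) \<and> (- 1 \<in> J \<longrightarrow> ?V \<omega> (- 1) \<in> A (- 1))"
        using not_less by fastforce
      ultimately show ?thesis by (simp add: B_def C_def)
    qed
    ultimately show ?thesis by (auto simp: E_def)
  qed
  then have "emeasure (distr M (PiM UNIV (\<lambda>_. borel)) ?V) (prod_emb UNIV (\<lambda>_. borel) J (Pi\<^sub>E J A))
      = ennreal (prob (\<Inter>k\<in>{0, 1, 2}. E k))"
    using measurable_data_path[OF m] emb by (simp add: emeasure_distr emeasure_eq_measure)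
  also have "prob (\<Inter>k\<in>{0, 1, 2}. E k) = (\<Prod>k\<in>{0, 1, 2}. prob (E k))"
  proof (rule indep_setsD)
    show "indep_sets (\<lambda>i::nat. if i = 0 then gen_sigma M {X0}
        else if i = 1 then gen_sigma M {W t | t. 0 \<le> t} else gen_sigma M {Z}) {0, 1, 2}"
      using data by (simp add: data_setup_def)
    have "X0 -` B \<inter> space M \<in> gen_sigma M {X0}"
      using measurable_sets[OF measurable_gen_sigma[of X0 "{X0}" M], of B] by (simp add: space_measure_of_conv)
    moreover have "Z -` C \<inter> space M \<in> gen_sigma M {Z}"
      using measurable_sets[OF measurable_gen_sigma[of Z "{Z}" M], of C] by (simp add: space_measure_of_conv)
    moreover have "{\<omega> \<in> space M. \<forall>j\<in>{i \<in> J. 0 \<le> i}. W j \<omega> \<in> A j} \<in> gen_sigma M {W t | t. 0 \<le> t}"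
    proof -
      let ?N = "sigma (space M) (gen_sigma M {W t | t. 0 \<le> t})"
      have "{\<omega> \<in> space ?N. \<forall>j\<in>{i \<in> J. 0 \<le> i}. W j \<omega> \<in> A j} \<in> sets ?N"
      proof (rule sets.sets_Collect_finite_All)
        fix j assume j: "j \<in> {i \<in> J. 0 \<le> i}"
        then have "W j -` A j \<inter> space ?N \<in> sets ?N"
          using A by (intro measurable_sets[OF measurable_gen_sigma]) auto
        then show "{\<omega> \<in> space ?N. W j \<omega> \<in> A j} \<in> sets ?N"
          by (simp add: vimage_def Int_def conj_commute)
      qed (use J in auto)
      then show ?thesis by (simp add: space_measure_of_conv)
    qed
    ultimately show "\<forall>k\<in>{0, 1, 2}. E k \<in> (if k = 0 then gen_sigma M {X0}
        else if k = 1 then gen_sigma M {W t | t. 0 \<le> t} else gen_sigma M {Z})"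
      by (simp add: E_def)
  qed auto
  also have "(\<Prod>k\<in>{0, 1, 2}. prob (E k)) = prob (E 0) * prob (E 1) * prob (E 2)" by simp
  also have "prob (E 0) = measure (density lborel (\<lambda>x. ennreal (\<rho>0 x))) B"
    using data m by (simp add: E_def data_setup_def measure_distr[symmetric])
  also have "prob (E 2) = measure (density lborel (\<lambda>x. ennreal (exponential_density 1 x))) C"
    using data m by (simp add: E_def data_setup_def measure_distr[symmetric])
  also have "prob (E 1) = measure (distr M (PiM D (\<lambda>_. borel)) (\<lambda>\<omega>. \<lambda>j\<in>D. W j \<omega>)) (\<Pi>\<^sub>E j\<in>D. if j \<in> J then A j else UNIV)"
  proof (subst measure_distr)
    show "(\<lambda>\<omega>. \<lambda>j\<in>D. W j \<omega>) \<in> measurable M (PiM D (\<lambda>_. borel))"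
      using m by (intro measurable_restrict) (auto simp: D_def)
    show "(\<Pi>\<^sub>E j\<in>D. if j \<in> J then A j else UNIV) \<in> sets (PiM D (\<lambda>_. borel))"
      using J A by (intro sets_PiM_I_finite) (auto simp: D_def)
    show "prob (E 1) = prob ((\<lambda>\<omega>. \<lambda>j\<in>D. W j \<omega>) -` (\<Pi>\<^sub>E j\<in>D. if j \<in> J then A j else UNIV) \<inter> space M)"
      by (rule arg_cong[where f=prob]) (auto simp: E_def D_def PiE_iff split: if_splits)
  qed
  finally show ?thesis by simp
qed

text \<open>Three jointly independent sigma-algebras are regrouped as two against one, which
  intersection stability of each permits.\<close>

lemma data_indep:
  "prob_space.indep_set M (gen_sigma M (insert X0 {W t | t. 0 \<le> t})) (gen_sigma M {Z})"
proof -
  interpret prob_space M using data by (simp add: data_setup_def)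
  let ?E = "\<lambda>i::nat. if i = 0 then gen_sigma M {X0}
    else if i = 1 then gen_sigma M {W t | t. 0 \<le> t} else gen_sigma M {Z}"
  let ?I = "case_bool {0, 1} {2::nat}"
  have stable: "Int_stable (gen_sigma M Vs)" for Vs
    using sets.Int_stable[of "sigma (space M) (gen_sigma M Vs)"] by simp
  have "indep_sets ?E (\<Union>j\<in>UNIV. ?I j)"
    using data by (simp add: data_setup_def UNIV_bool insert_commute)
  then have "indep_sets (\<lambda>j. sigma_sets (space M) (\<Union>i\<in>?I j. ?E i)) UNIV"
    by (rule indep_sets_collect_sigma) (auto simp: stable disjoint_family_on_def split: bool.splits)
  then show ?thesis
    unfolding indep_set_def
  proof (rule indep_sets_mono_sets)
    fix i :: bool
    have X0W: "gen_sigma M (insert X0 {W t | t. 0 \<le> t}) \<subseteq> sigma_sets (space M) (gen_sigma M {X0} \<union> gen_sigma M {W t | t. 0 \<le> t})"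
      unfolding gen_sigma_def[of M "insert X0 {W t | t. 0 \<le> t}"]
    proof (rule sigma_sets_mono, rule subsetI)
      fix S assume "S \<in> (\<Union>V\<in>insert X0 {W t | t. 0 \<le> t}. {V -` A \<inter> space M | A. A \<in> sets (borel :: real measure)})"
      then consider "S \<in> {X0 -` A \<inter> space M | A. A \<in> sets (borel :: real measure)}"
        | "S \<in> (\<Union>V\<in>{W t | t. 0 \<le> t}. {V -` A \<inter> space M | A. A \<in> sets (borel :: real measure)})"
        by blast
      then have "S \<in> gen_sigma M {X0} \<union> gen_sigma M {W t | t. 0 \<le> t}"
        unfolding gen_sigma_def by cases (simp_all add: sigma_sets.Basic)
      then show "S \<in> sigma_sets (space M) (gen_sigma M {X0} \<union> gen_sigma M {W t | t. 0 \<le> t})"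
        by (rule sigma_sets.Basic)
    qed
    then show "case_bool (gen_sigma M (insert X0 {W t | t. 0 \<le> t})) (gen_sigma M {Z}) i
      \<subseteq> sigma_sets (space M) (\<Union>i\<in>?I i. ?E i)"
      by (cases i) (auto intro: sigma_sets.Basic simp: Un_commute)
  qed
qed

end

lemma data_law_unique:
  fixes M1 :: "'b measure" and M2 :: "'c measure"
  assumes d1: "data_setup \<rho>0 M1 F1 X01 W1 Z1" and d2: "data_setup \<rho>0 M2 F2 X02 W2 Z2"
  shows "distr M1 (PiM UNIV (\<lambda>_. borel)) (data_path X01 W1 Z1) = distr M2 (PiM UNIV (\<lambda>_. borel)) (data_path X02 W2 Z2)"
proof (rule measure_eqI_PiM_infinite)
  interpret M1: prob_space M1 using d1 by (simp add: data_setup_def)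
  show "finite_measure (distr M1 (PiM UNIV (\<lambda>_. borel)) (data_path X01 W1 Z1))"
    by (intro M1.finite_measure_distr measurable_data_path data_measurable[OF d1])
  fix A and J :: "real set" assume J: "finite J" and A: "\<And>i. i \<in> J \<Longrightarrow> A i \<in> sets (borel :: real measure)"
  have "distr M1 (PiM (insert 0 {i \<in> J. 0 \<le> i}) (\<lambda>_. borel)) (\<lambda>\<omega>. \<lambda>j\<in>insert 0 {i \<in> J. 0 \<le> i}. W1 j \<omega>)
      = distr M2 (PiM (insert 0 {i \<in> J. 0 \<le> i}) (\<lambda>_. borel)) (\<lambda>\<omega>. \<lambda>j\<in>insert 0 {i \<in> J. 0 \<le> i}. W2 j \<omega>)"
    using d1 d2 J by (intro brownian_motion_law_unique) (auto simp: data_setup_def)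
  then show "emeasure (distr M1 (PiM UNIV (\<lambda>_. borel)) (data_path X01 W1 Z1)) (prod_emb UNIV (\<lambda>_. borel) J (Pi\<^sub>E J A))
      = emeasure (distr M2 (PiM UNIV (\<lambda>_. borel)) (data_path X02 W2 Z2)) (prod_emb UNIV (\<lambda>_. borel) J (Pi\<^sub>E J A))"
    by (simp only: data_finite_dimensional[OF d1 J A] data_finite_dimensional[OF d2 J A])
qed auto

section \<open>Law of the killed process\<close>

lemma measurable_Some_Delta: "Some \<in> measurable borel borel_Delta"
  unfolding borel_Delta_def
proof (rule measurable_measure_of)
  fix B assume "B \<in> insert {None} ((`) Some ` sets (borel :: real measure))"
  then consider "B = {None}" | A where "A \<in> sets (borel :: real measure)" "B = Some ` A" by auto
  then show "Some -` B \<inter> space borel \<in> sets (borel :: real measure)"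
  proof cases
    case 1
    then have "Some -` B = {}" by auto
    then show ?thesis by simp
  next
    case 2
    then have "Some -` B \<inter> space borel = A" by auto
    then show ?thesis using 2 by simp
  qed
qed auto

lemma measurable_option_If:
  assumes "Measurable.pred N P" "f \<in> borel_measurable N"
  shows "(\<lambda>x. if P x then Some (f x) else None) \<in> measurable N borel_Delta"
  using assms(1) measurable_compose[OF assms(2) measurable_Some_Delta]
  by (intro measurable_If) (auto simp: borel_Delta_def pred_def)

context killed_mv
begin

definition alive_at :: "(real \<times> real \<Rightarrow> 'e) \<Rightarrow> real \<Rightarrow> (real \<Rightarrow> real) \<Rightarrow> bool" where
  "alive_at F r v \<longleftrightarrow> \<Lambda> F (v (- 2)) v r < v (- 1)"

definition killed_path :: "(real \<times> real \<Rightarrow> 'e) \<Rightarrow> (real \<Rightarrow> real) \<Rightarrow> real \<Rightarrow> real option" where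
  "killed_path F v = (\<lambda>t\<in>{0..T}. if alive_at F t v then Some (Y F (v (- 2)) v t) else None)"

lemma
  assumes "F \<in> adm" "r \<in> {0..T}"
  shows measurable_alive_at: "Measurable.pred (PiM UNIV (\<lambda>_. borel)) (alive_at F r)"
    and measurable_Y_coord: "(\<lambda>v. Y F (v (- 2)) v r) \<in> borel_measurable (PiM UNIV (\<lambda>_. borel))"
proof -
  have c: "(\<lambda>v. v i) \<in> borel_measurable (PiM UNIV (\<lambda>_. borel))" for i :: real
    by (rule measurable_component_singleton) simp
  show "(\<lambda>v. Y F (v (- 2)) v r) \<in> borel_measurable (PiM UNIV (\<lambda>_. borel))"
    by (rule measurable_Y[where ?X0.0="\<lambda>v. v (- 2)" and W="\<lambda>s v. v s", OF assms c c])
  have "(\<lambda>v. \<Lambda> F (v (- 2)) v r) \<in> borel_measurable (PiM UNIV (\<lambda>_. borel))"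
    by (rule measurable_\<Lambda>[where ?X0.0="\<lambda>v. v (- 2)" and W="\<lambda>s v. v s", OF assms c c])
  then show "Measurable.pred (PiM UNIV (\<lambda>_. borel)) (alive_at F r)"
    unfolding alive_at_def using c[of "- 1"] by measurable
qed

lemma killed_path_cong:
  assumes "\<And>t x. t \<in> {0..T} \<Longrightarrow> F (t, x) = G (t, x)"
  shows "killed_path F = killed_path G"
proof -
  have "alive_at F t v = alive_at G t v" "Y F (v (- 2)) v t = Y G (v (- 2)) v t" if "t \<in> {0..T}" for t v
    unfolding alive_at_def using that assms
      \<Lambda>_cong[of t v v F G "v (- 2)"] Y_cong[of t v v F G "v (- 2)"] by auto
  then show ?thesis by (auto simp: killed_path_def fun_eq_iff restrict_def)
qed

end

context killed_mv_data
begin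

abbreviation "V_path \<equiv> data_path X0 W Z"

definition data_law :: "(real \<Rightarrow> real) measure" where
  "data_law = distr M (PiM UNIV (\<lambda>_. borel)) V_path"

lemma
  assumes "0 \<le> r"
  shows alive_data_path: "alive_at F r (V_path \<omega>) = alive F r \<omega>"
    and Y_data_path: "Y F (V_path \<omega> (- 2)) (V_path \<omega>) r = state F r \<omega>"
proof -
  have "V_path \<omega> s = W_path \<omega> s" if "s \<in> {0..r}" for s using that by (simp add: data_path_def)
  then show "alive_at F r (V_path \<omega>) = alive F r \<omega>" "Y F (V_path \<omega> (- 2)) (V_path \<omega>) r = state F r \<omega>"
    using \<Lambda>_cong[OF assms, of "V_path \<omega>" "W_path \<omega>" F F "X0 \<omega>"] Y_cong[OF assms, of "V_path \<omega>" "W_path \<omega>" F F "X0 \<omega>"]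
    by (simp_all add: alive_at_def alive_def state_def data_path_def)
qed

lemma measurable_V_path: "V_path \<in> measurable M (PiM UNIV (\<lambda>_. borel))"
  by (intro measurable_data_path X0 W Z)

text \<open>Written as an integral against \<open>data_law\<close>, the map no longer refers to the
  probability space; this allows fixed points on different spaces to be compared.\<close>

lemma \<Phi>_data_law:
  assumes F: "F \<in> adm" and t: "t \<in> {0..T}"
  shows "\<Phi> F (t, x) = integral {0..t} (\<lambda>r. \<integral>v. (if alive_at F r v then \<kappa> (x - Y F (v (- 2)) v r) else 0) \<partial>data_law)"
proof -
  have "dens (alive F) (state F) r x = (\<integral>v. (if alive_at F r v then \<kappa> (x - Y F (v (- 2)) v r) else 0) \<partial>data_law)"
    if r: "r \<in> {0..t}" for r
  proof -
    have [measurable]: "Measurable.pred (PiM UNIV (\<lambda>_. borel)) (alive_at F r)"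
      "(\<lambda>v. Y F (v (- 2)) v r) \<in> borel_measurable (PiM UNIV (\<lambda>_. borel))"
      using r t by (auto intro: measurable_alive_at measurable_Y_coord F)
    have "(\<integral>v. (if alive_at F r v then \<kappa> (x - Y F (v (- 2)) v r) else 0) \<partial>data_law)
        = (\<integral>\<omega>. (if alive_at F r (V_path \<omega>) then \<kappa> (x - Y F (V_path \<omega> (- 2)) (V_path \<omega>) r) else 0) \<partial>M)"
      unfolding data_law_def by (rule integral_distr[OF measurable_V_path]) measurable
    then show ?thesis using r by (simp add: dens_def alive_data_path Y_data_path cong: if_cong)
  qed
  then show ?thesis by (auto simp: \<Phi>_def field_def intro!: Henstock_Kurzweil_Integration.integral_cong)
qed

text \<open>By \<open>sol_fixed_point\<close> the killed path is almost surely the functional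
  \<open>killed_path\<close> of the data, and the solution enters that functional only through its
  law field.\<close>

lemma path_law_data_law:
  assumes sol: "sol V \<tau>"
  shows "path_law T M \<tau> V = distr data_law (PiM {0..T} (\<lambda>_. borel_Delta)) (killed_path (law_field \<tau> V))"
proof -
  let ?F = "law_field \<tau> V" and ?P = "PiM {0..T} (\<lambda>_. borel_Delta)"
  note S = sol_fixed_point[OF sol]
  have [measurable]: "\<tau> \<in> borel_measurable M" and V: "\<And>t. t \<in> {0..T} \<Longrightarrow> V t \<in> borel_measurable M"
    using sol by (auto simp: sol_def)
  have k: "killed_path ?F \<in> measurable (PiM UNIV (\<lambda>_. borel)) ?P"
    unfolding killed_path_def
    by (intro measurable_restrict measurable_option_If measurable_alive_at measurable_Y_coord S(1))
  have "path_law T M \<tau> V = distr M ?P (killed_path ?F \<circ> V_path)"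
    unfolding path_law_def
  proof (rule distr_cong_AE)
    show "AE \<omega> in M. (\<lambda>t\<in>{0..T}. killed \<tau> V t \<omega>) = (killed_path ?F \<circ> V_path) \<omega>"
      using S(3)
    proof eventually_elim
      case (elim \<omega>)
      then show ?case
        by (auto simp: killed_path_def killed_def restrict_def fun_eq_iff alive_data_path Y_data_path)
    qed
    show "(\<lambda>\<omega>. \<lambda>t\<in>{0..T}. killed \<tau> V t \<omega>) \<in> measurable M ?P"
      unfolding killed_def by (intro measurable_restrict measurable_option_If V) measurable
    show "killed_path ?F \<circ> V_path \<in> measurable M ?P"
      using measurable_V_path k by (rule measurable_comp)
  qed auto
  then show ?thesis unfolding data_law_def by (simp add: distr_distr[OF k measurable_V_path])
qed

end

text \<open>The maps of both spaces agree, so the law field of the second solution is also a fixed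
  point on the first space, where uniqueness identifies it with the field of the first solution.
  Both path laws are then images of one data law under one functional.\<close>

lemma (in killed_mv) path_law_unique:
  fixes M1 :: "'b measure" and M2 :: "'c measure"
  assumes d1: "killed_mv_data T Lb Lh Lk CK b h \<kappa> M1 X01 Z1 W1"
    and d2: "killed_mv_data T Lb Lh Lk CK b h \<kappa> M2 X02 Z2 W2"
    and law: "distr M1 (PiM UNIV (\<lambda>_. borel)) (data_path X01 W1 Z1) = distr M2 (PiM UNIV (\<lambda>_. borel)) (data_path X02 W2 Z2)"
    and s1: "killed_mv_data.sol T b h \<kappa> M1 h0 X01 Z1 W1 V1 \<tau>1"
    and s2: "killed_mv_data.sol T b h \<kappa> M2 h0 X02 Z2 W2 V2 \<tau>2"
  shows "path_law T M1 \<tau>1 V1 = path_law T M2 \<tau>2 V2"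
proof -
  interpret D1: killed_mv_data T Lb Lh Lk CK b h \<kappa> M1 h0 X01 Z1 W1 by fact
  interpret D2: killed_mv_data T Lb Lh Lk CK b h \<kappa> M2 h0 X02 Z2 W2 by fact
  let ?F = "D1.law_field \<tau>1 V1" and ?G = "D2.law_field \<tau>2 V2"
  have law': "D1.data_law = D2.data_law" using law by (simp add: D1.data_law_def D2.data_law_def)
  note S1 = D1.sol_fixed_point[OF s1] and S2 = D2.sol_fixed_point[OF s2]
  have "D1.\<Phi> ?G (t, x) = ?G (t, x)" if "t \<in> {0..T}" for t x
    using S2(2)[OF that] by (simp add: D1.\<Phi>_data_law[OF S2(1) that] D2.\<Phi>_data_law[OF S2(1) that] law')
  then have "?F (t, x) = ?G (t, x)" if "t \<in> {0..T}" for t x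
    using D1.fixed_point_unique[OF S1(1,2) S2(1) _ that] by blast
  then have "killed_path ?F = killed_path ?G" by (rule killed_path_cong)
  then show ?thesis by (simp add: D1.path_law_data_law[OF s1] D2.path_law_data_law[OF s2] law')
qed

section \<open>The coefficients of the killed McKean--Vlasov equation\<close>

lemma exp_minus_lipschitz:
  fixes a b :: real
  assumes "0 \<le> a" "0 \<le> b"
  shows "\<bar>exp (- a) - exp (- b)\<bar> \<le> \<bar>a - b\<bar>"
proof -
  have *: "exp (- a) - exp (- b) \<le> b - a" if "0 \<le> a" "a \<le> b" for a b :: real
  proof -
    have "exp (- a) - exp (- b) = exp (- a) * (1 - exp (- (b - a)))"
      by (simp add: algebra_simps exp_add[symmetric])
    also have "\<dots> \<le> 1 * (b - a)"
    proof (rule mult_mono)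
      show "1 - exp (- (b - a)) \<le> b - a" using exp_ge_add_one_self[of "- (b - a)"] by linarith
    qed (use that in auto)
    finally show ?thesis by simp
  qed
  show ?thesis
  proof (cases "a \<le> b")
    case True
    then have "exp (- b) \<le> exp (- a)" by simp
    with *[of a b] True assms show ?thesis by simp
  next
    case False
    then have "exp (- a) \<le> exp (- b)" by simp
    with *[of b a] False assms show ?thesis by simp
  qed
qed

lemma fst_snd_le:
  fixes p q :: "real \<times> real"
  shows "\<bar>fst p - fst q\<bar> \<le> norm (p - q)" "\<bar>snd p - snd q\<bar> \<le> norm (p - q)"
  using dist_fst_le[of p q] dist_snd_le[of p q] by (simp_all add: dist_norm)

locale kmv_kernel =
  fixes T lam c0 \<phi>0 \<phi>1 MK MK' LK LK' m :: real and K :: "real \<Rightarrow> real"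
  assumes T_pos: "T > 0"
    and K_nonneg: "\<And>x. K x \<ge> 0"
    and K_bd: "\<And>x. \<bar>K x\<bar> \<le> MK"
    and DK_bd: "\<And>x. \<bar>deriv K x\<bar> \<le> MK'"
    and K_lip: "\<And>x y. \<bar>K x - K y\<bar> \<le> LK * \<bar>x - y\<bar>"
    and DK_lip: "\<And>x y. \<bar>deriv K x - deriv K y\<bar> \<le> LK' * \<bar>x - y\<bar>"
    and lam_pos: "lam > 0" and c0_pos: "c0 > 0" and phi0_pos: "\<phi>0 > 0"
    and m_pos: "0 < m" and denom: "\<And>x. x \<in> {0..MK * T} \<Longrightarrow> m \<le> \<phi>0 + \<phi>1 * c0 * exp (- lam * x)"
begin

lemma bounds_nonneg: "0 \<le> MK" "0 \<le> MK'" "0 \<le> LK" "0 \<le> LK'"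
  using order_trans[OF abs_ge_zero K_bd[of 0]] order_trans[OF abs_ge_zero DK_bd[of 0]]
    order_trans[OF abs_ge_zero K_lip[of 1 0]] order_trans[OF abs_ge_zero DK_lip[of 1 0]] by auto

definition kernel :: "real \<Rightarrow> real \<times> real" where "kernel x = (K x, deriv K x)"

text \<open>The arguments are clamped to the range which solutions can reach; this makes the coefficients
  globally Lipschitz without changing the equation.\<close>
definition clamp1 :: "real \<Rightarrow> real" where "clamp1 x = max 0 (min (MK * T) x)"
definition clamp2 :: "real \<Rightarrow> real" where "clamp2 y = max (- (MK' * T)) (min (MK' * T) y)"
definition bb :: "real \<times> real \<Rightarrow> real" where
  "bb p = drift lam c0 \<phi>0 \<phi>1 (clamp1 (fst p)) (clamp2 (snd p))"
definition hh :: "real \<times> real \<Rightarrow> real" where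
  "hh p = lam * c0 * exp (- lam * clamp1 (fst p))"

text \<open>\<open>\<phi>0 * lam / m\<^sup>2\<close> is a Lipschitz constant of the quotient of
  \<open>exp (- lam * x)\<close> by the denominator of the drift, and \<open>1 / m\<close> in
  \<open>Lip2\<close> is a bound of that quotient.\<close>

definition Lip1 :: real where "Lip1 = \<bar>\<phi>1\<bar> * lam * c0 * (MK' * T * (\<phi>0 * lam / m\<^sup>2))"
definition Lip2 :: real where "Lip2 = \<bar>\<phi>1\<bar> * lam * c0 * (1 / m)"

lemma Lip_nonneg: "0 \<le> Lip1" "0 \<le> Lip2"
  using bounds_nonneg lam_pos c0_pos phi0_pos m_pos T_pos by (auto simp: Lip1_def Lip2_def)

lemma clamp1: "clamp1 x \<in> {0..MK * T}" "\<bar>clamp1 x - clamp1 y\<bar> \<le> \<bar>x - y\<bar>" "x \<in> {0..MK * T} \<Longrightarrow> clamp1 x = x"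
  using bounds_nonneg T_pos by (auto simp: clamp1_def max_def min_def)

lemma clamp2: "\<bar>clamp2 x\<bar> \<le> MK' * T" "\<bar>clamp2 x - clamp2 y\<bar> \<le> \<bar>x - y\<bar>" "\<bar>x\<bar> \<le> MK' * T \<Longrightarrow> clamp2 x = x"
proof -
  have "0 \<le> MK' * T" using bounds_nonneg T_pos by simp
  then show "\<bar>clamp2 x\<bar> \<le> MK' * T" "\<bar>clamp2 x - clamp2 y\<bar> \<le> \<bar>x - y\<bar>" "\<bar>x\<bar> \<le> MK' * T \<Longrightarrow> clamp2 x = x"
    unfolding clamp2_def by linarith+
qed

text \<open>Over the common denominator the terms with \<open>\<phi>1\<close> cancel, so the
  quotient \<open>q\<close> inherits the Lipschitz bound of the exponential, divided by
  \<open>m\<^sup>2\<close>. The bound on \<open>y\<close> controls the factor of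
  \<open>q x - q x'\<close> in the product.\<close>

lemma drift_lipschitz:
  assumes x: "x \<in> {0..MK * T}" "x' \<in> {0..MK * T}" and y: "\<bar>y\<bar> \<le> MK' * T"
  shows "\<bar>drift lam c0 \<phi>0 \<phi>1 x y - drift lam c0 \<phi>0 \<phi>1 x' y'\<bar> \<le> Lip1 * \<bar>x - x'\<bar> + Lip2 * \<bar>y - y'\<bar>"
proof -
  define E where "E x = exp (- lam * x)" for x
  define D where "D x = \<phi>0 + \<phi>1 * c0 * E x" for x
  define q where "q x = E x / D x" for x
  have D: "m \<le> D x" "m \<le> D x'" using denom[OF x(1)] denom[OF x(2)] by (auto simp: D_def E_def)
  have D0: "0 < D x" "0 < D x'" using D m_pos by auto
  have E: "0 < E x'" "E x' \<le> 1" using x lam_pos by (auto simp: E_def)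
  have q': "\<bar>q x'\<bar> \<le> 1 / m"
  proof -
    have "q x' \<le> 1 / m" unfolding q_def using E D D0 m_pos by (intro frac_le) auto
    moreover have "0 \<le> q x'" using E D0 by (simp add: q_def)
    ultimately show ?thesis by simp
  qed
  have EE: "\<bar>E x - E x'\<bar> \<le> lam * \<bar>x - x'\<bar>"
    using exp_minus_lipschitz[of "lam * x" "lam * x'"] x lam_pos
    by (simp add: E_def right_diff_distrib[symmetric] abs_mult)
  have "q x - q x' = \<phi>0 * (E x - E x') / (D x * D x')"
    unfolding q_def using D0 by (simp add: field_simps) (simp add: D_def algebra_simps)
  then have "\<bar>q x - q x'\<bar> = \<phi>0 * \<bar>E x - E x'\<bar> / (D x * D x')"
    using D0 phi0_pos by (simp add: abs_mult)
  also have "\<dots> \<le> \<phi>0 * (lam * \<bar>x - x'\<bar>) / (m * m)"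
    using EE D D0 m_pos phi0_pos lam_pos by (intro frac_le mult_mono mult_left_mono mult_nonneg_nonneg mult_pos_pos) auto
  finally have qq: "\<bar>q x - q x'\<bar> \<le> \<phi>0 * lam / m\<^sup>2 * \<bar>x - x'\<bar>" by (simp add: power2_eq_square mult.assoc)
  have dr: "drift lam c0 \<phi>0 \<phi>1 x y = - (\<phi>1 * lam * c0) * (y * q x)" for x y
    by (simp add: drift_def q_def E_def D_def)
  have "\<bar>drift lam c0 \<phi>0 \<phi>1 x y - drift lam c0 \<phi>0 \<phi>1 x' y'\<bar> = \<bar>\<phi>1\<bar> * lam * c0 * \<bar>y * q x - y' * q x'\<bar>"
    unfolding dr using lam_pos c0_pos by (simp add: right_diff_distrib[symmetric] abs_mult abs_minus_commute)
  also have "\<bar>y * q x - y' * q x'\<bar> \<le> \<bar>y\<bar> * \<bar>q x - q x'\<bar> + \<bar>q x'\<bar> * \<bar>y - y'\<bar>"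
    unfolding abs_mult[symmetric]
    using abs_triangle_ineq[of "y * (q x - q x')" "q x' * (y - y')"] by (simp add: algebra_simps)
  also have "\<dots> \<le> MK' * T * (\<phi>0 * lam / m\<^sup>2 * \<bar>x - x'\<bar>) + 1 / m * \<bar>y - y'\<bar>"
    using y qq q' order_trans[OF abs_ge_zero y] m_pos by (intro add_mono mult_mono) auto
  finally have "\<bar>drift lam c0 \<phi>0 \<phi>1 x y - drift lam c0 \<phi>0 \<phi>1 x' y'\<bar>
      \<le> \<bar>\<phi>1\<bar> * lam * c0 * (MK' * T * (\<phi>0 * lam / m\<^sup>2 * \<bar>x - x'\<bar>) + 1 / m * \<bar>y - y'\<bar>)"
    using lam_pos c0_pos by (simp add: mult_left_mono)
  also have "\<dots> = Lip1 * \<bar>x - x'\<bar> + Lip2 * \<bar>y - y'\<bar>"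
    by (simp add: Lip1_def Lip2_def algebra_simps)
  finally show ?thesis .
qed

sublocale killed_mv T "Lip1 + Lip2" "lam * c0 * lam" "LK + LK'" "MK + MK'" bb hh kernel
proof
  show "0 < T" by (rule T_pos)
  show "\<bar>bb p - bb q\<bar> \<le> (Lip1 + Lip2) * norm (p - q)" for p q
  proof -
    have "\<bar>bb p - bb q\<bar> \<le> Lip1 * \<bar>clamp1 (fst p) - clamp1 (fst q)\<bar> + Lip2 * \<bar>clamp2 (snd p) - clamp2 (snd q)\<bar>"
      unfolding bb_def by (intro drift_lipschitz clamp1 clamp2)
    also have "\<dots> \<le> Lip1 * norm (p - q) + Lip2 * norm (p - q)"
      using Lip_nonneg fst_snd_le
      by (intro add_mono mult_left_mono order_trans[OF clamp1(2)] order_trans[OF clamp2(2)]) auto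
    finally show ?thesis by (simp add: distrib_right)
  qed
  show "\<bar>hh p - hh q\<bar> \<le> lam * c0 * lam * norm (p - q)" for p q
  proof -
    have "\<bar>exp (- lam * clamp1 (fst p)) - exp (- lam * clamp1 (fst q))\<bar> \<le> \<bar>lam * clamp1 (fst p) - lam * clamp1 (fst q)\<bar>"
      using exp_minus_lipschitz[of "lam * clamp1 (fst p)" "lam * clamp1 (fst q)"]
        clamp1(1)[of "fst p"] clamp1(1)[of "fst q"] lam_pos by simp
    also have "\<dots> = lam * \<bar>clamp1 (fst p) - clamp1 (fst q)\<bar>"
      using lam_pos by (simp add: right_diff_distrib[symmetric] abs_mult)
    also have "\<dots> \<le> lam * norm (p - q)"
      using lam_pos order_trans[OF clamp1(2) fst_snd_le(1)] by (intro mult_left_mono) auto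
    finally have "lam * c0 * \<bar>exp (- lam * clamp1 (fst p)) - exp (- lam * clamp1 (fst q))\<bar> \<le> lam * c0 * (lam * norm (p - q))"
      using lam_pos c0_pos by (intro mult_left_mono) auto
    moreover have "\<bar>hh p - hh q\<bar> = lam * c0 * \<bar>exp (- lam * clamp1 (fst p)) - exp (- lam * clamp1 (fst q))\<bar>"
      unfolding hh_def right_diff_distrib[symmetric] using lam_pos c0_pos by (simp only: abs_mult)
    ultimately show ?thesis by (simp add: mult.assoc)
  qed
  show "0 \<le> hh p" for p using lam_pos c0_pos by (simp add: hh_def)
  show "norm (kernel x - kernel y) \<le> (LK + LK') * \<bar>x - y\<bar>" for x y
    using norm_Pair_le[of "K x - K y" "deriv K x - deriv K y"] K_lip[of x y] DK_lip[of x y]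
    by (simp add: kernel_def distrib_right)
  show "norm (kernel x) \<le> MK + MK'" for x
    using norm_Pair_le[of "K x" "deriv K x"] K_bd[of x] DK_bd[of x] by (simp add: kernel_def)
qed (use Lip_nonneg bounds_nonneg lam_pos c0_pos in auto)

end

section \<open>Identification with the original killed equation\<close>

lemma conv_nu:
  assumes [measurable]: "f \<in> borel_measurable borel" "V r \<in> borel_measurable M" "\<tau> \<in> borel_measurable M"
  shows "conv f (nu M \<tau> V r) x = (\<integral>\<omega>. (if ereal r < \<tau> \<omega> then f (x - V r \<omega>) else 0) \<partial>M)"
proof -
  let ?A = "{\<omega> \<in> space M. ereal r < \<tau> \<omega>}"
  have "conv f (nu M \<tau> V r) x = (\<integral>\<omega>. f (x - V r \<omega>) \<partial>density M (\<lambda>\<omega>. ennreal (indicator ?A \<omega>)))"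
    unfolding conv_def nu_def by (subst integral_distr) (auto simp: ennreal_indicator)
  also have "\<dots> = (\<integral>\<omega>. indicator ?A \<omega> *\<^sub>R f (x - V r \<omega>) \<partial>M)"
    by (rule integral_density) auto
  also have "\<dots> = (\<integral>\<omega>. (if ereal r < \<tau> \<omega> then f (x - V r \<omega>) else 0) \<partial>M)"
    by (rule Bochner_Integration.integral_cong) (auto simp: indicator_def)
  finally show ?thesis .
qed

locale kmv_data = kmv_kernel T lam c0 \<phi>0 \<phi>1 MK MK' LK LK' m K
  for T lam c0 \<phi>0 \<phi>1 MK MK' LK LK' m :: real and K :: "real \<Rightarrow> real" +
  fixes \<rho>0 :: "real \<Rightarrow> real" and M :: "'a measure" and F and X0 Z :: "'a \<Rightarrow> real" and W
  assumes data: "data_setup \<rho>0 M F X0 W Z"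
begin

sublocale killed_mv_data T "Lip1 + Lip2" "lam * c0 * lam" "LK + LK'" "MK + MK'" bb hh kernel M "lam * c0" X0 Z W
proof (intro killed_mv_data.intro killed_mv_data_axioms.intro killed_mv_axioms)
  show "prob_space M" using data by (simp add: data_setup_def)
  have "AE \<omega> in M. continuous_on {0..} (\<lambda>t. W t \<omega>)" using data by (auto simp: data_setup_def brownian_motion_def)
  then show "AE \<omega> in M. continuous_on {0..T} (\<lambda>t. W t \<omega>)"
    by eventually_elim (auto intro: continuous_on_subset)
  show "distr M borel Z = density lborel (\<lambda>x. ennreal (exponential_density 1 x))"
    using data by (simp add: data_setup_def)
qed (use data_measurable[OF data] data_indep[OF data] in auto)

context
  fixes V \<tau>
  assumes V: "\<And>t. t \<in> {0..T} \<Longrightarrow> V t \<in> borel_measurable M" and \<tau>[measurable]: "\<tau> \<in> borel_measurable M"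
    and reg: "AE \<omega> in M. right_regular (\<lambda>r \<omega>. ereal r < \<tau> \<omega>) V \<omega>"
begin

lemma conv_dens:
  assumes r: "r \<in> {0..T}"
  shows "conv K (nu M \<tau> V r) x = fst (dens (\<lambda>r \<omega>. ereal r < \<tau> \<omega>) V r x)"
    and "conv (deriv K) (nu M \<tau> V r) x = snd (dens (\<lambda>r \<omega>. ereal r < \<tau> \<omega>) V r x)"
    and "conv K (nu M \<tau> V r) x \<in> {0..MK}" and "\<bar>conv (deriv K) (nu M \<tau> V r) x\<bar> \<le> MK'"
proof -
  have m: "meas (\<lambda>r \<omega>. ereal r < \<tau> \<omega>) V" using V by (auto simp: meas_def)
  note i = integrable_dens[OF m r, of x]
  have "continuous_on UNIV (\<lambda>x. fst (kernel x))" "continuous_on UNIV (\<lambda>x. snd (kernel x))"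
    by (intro continuous_intros cont_\<kappa>)+
  then have [measurable]: "K \<in> borel_measurable borel" "deriv K \<in> borel_measurable borel"
    unfolding kernel_def by (auto intro: borel_measurable_continuous_onI)
  note [measurable] = V[OF r]
  have K_eq: "conv K (nu M \<tau> V r) x = (\<integral>\<omega>. (if ereal r < \<tau> \<omega> then K (x - V r \<omega>) else 0) \<partial>M)"
    and D_eq: "conv (deriv K) (nu M \<tau> V r) x = (\<integral>\<omega>. (if ereal r < \<tau> \<omega> then deriv K (x - V r \<omega>) else 0) \<partial>M)"
    by (rule conv_nu; measurable)+
  show "conv K (nu M \<tau> V r) x = fst (dens (\<lambda>r \<omega>. ereal r < \<tau> \<omega>) V r x)"
    unfolding K_eq dens_def integral_bounded_linear[OF bounded_linear_fst i, symmetric]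
    by (intro Bochner_Integration.integral_cong) (auto simp: kernel_def)
  show "conv (deriv K) (nu M \<tau> V r) x = snd (dens (\<lambda>r \<omega>. ereal r < \<tau> \<omega>) V r x)"
    unfolding D_eq dens_def integral_bounded_linear[OF bounded_linear_snd i, symmetric]
    by (intro Bochner_Integration.integral_cong) (auto simp: kernel_def)
  have "norm (conv K (nu M \<tau> V r) x) \<le> MK"
    unfolding K_eq using K_bd bounds_nonneg by (intro norm_expectation_le) auto
  moreover have "0 \<le> conv K (nu M \<tau> V r) x"
    unfolding K_eq using K_nonneg by (intro integral_nonneg_AE) auto
  ultimately show "conv K (nu M \<tau> V r) x \<in> {0..MK}" by simp
  have "norm (conv (deriv K) (nu M \<tau> V r) x) \<le> MK'"
    unfolding D_eq using DK_bd bounds_nonneg by (intro norm_expectation_le) auto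
  then show "\<bar>conv (deriv K) (nu M \<tau> V r) x\<bar> \<le> MK'" by simp
qed

text \<open>The components are bounded linear images of one vector integral. Their ranges, from
  nonnegativity of \<open>K\<close> and mass at most one, are those which the clamps leave
  unchanged.\<close>

lemma law_field_conv:
  assumes s: "s \<in> {0..T}"
  shows "fst (law_field \<tau> V (s, x)) = integral {0..s} (\<lambda>r. conv K (nu M \<tau> V r) x)"
    and "snd (law_field \<tau> V (s, x)) = integral {0..s} (\<lambda>r. conv (deriv K) (nu M \<tau> V r) x)"
    and "fst (law_field \<tau> V (s, x)) \<in> {0..MK * T}" and "\<bar>snd (law_field \<tau> V (s, x))\<bar> \<le> MK' * T"
proof -
  let ?d = "\<lambda>r. dens (\<lambda>r \<omega>. ereal r < \<tau> \<omega>) V r x"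
  have m: "meas (\<lambda>r \<omega>. ereal r < \<tau> \<omega>) V" using V by (auto simp: meas_def)
  have i: "?d integrable_on {0..s}"
    by (rule integrable_on_subinterval[OF dens_integrable[OF m reg]]) (use s in auto)
  have eq: "(fst \<circ> ?d) r = conv K (nu M \<tau> V r) x" "(snd \<circ> ?d) r = conv (deriv K) (nu M \<tau> V r) x" if "r \<in> {0..s}" for r
    using conv_dens[of r x] that s by auto
  have "integral {0..s} (fst \<circ> ?d) = fst (law_field \<tau> V (s, x))" "integral {0..s} (snd \<circ> ?d) = snd (law_field \<tau> V (s, x))"
    unfolding law_field_def field_def
    using integral_linear[OF i bounded_linear_fst] integral_linear[OF i bounded_linear_snd] by auto
  then show f: "fst (law_field \<tau> V (s, x)) = integral {0..s} (\<lambda>r. conv K (nu M \<tau> V r) x)"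
    and g: "snd (law_field \<tau> V (s, x)) = integral {0..s} (\<lambda>r. conv (deriv K) (nu M \<tau> V r) x)"
    using Henstock_Kurzweil_Integration.integral_cong[OF eq(1), of "{0..s}" "\<lambda>r. r"]
      Henstock_Kurzweil_Integration.integral_cong[OF eq(2), of "{0..s}" "\<lambda>r. r"] by (simp_all only:)
  have iK: "(\<lambda>r. conv K (nu M \<tau> V r) x) integrable_on {0..s}"
    by (rule integrable_eq[OF integrable_linear[OF i bounded_linear_fst]]) (rule eq)
  have iD: "(\<lambda>r. conv (deriv K) (nu M \<tau> V r) x) integrable_on {0..s}"
    by (rule integrable_eq[OF integrable_linear[OF i bounded_linear_snd]]) (rule eq)
  have "norm (integral {0..s} (\<lambda>r. conv K (nu M \<tau> V r) x)) \<le> MK * (s - 0)"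
    using s bounds_nonneg conv_dens(3) by (intro norm_integral_le iK) auto
  also have "\<dots> \<le> MK * T" using s bounds_nonneg by (intro mult_left_mono) auto
  finally have "fst (law_field \<tau> V (s, x)) \<le> MK * T" unfolding f by simp
  moreover have "0 \<le> fst (law_field \<tau> V (s, x))"
    unfolding f using s conv_dens(3) by (intro Henstock_Kurzweil_Integration.integral_nonneg iK) auto
  ultimately show "fst (law_field \<tau> V (s, x)) \<in> {0..MK * T}" by simp
  have "norm (integral {0..s} (\<lambda>r. conv (deriv K) (nu M \<tau> V r) x)) \<le> MK' * (s - 0)"
    using s bounds_nonneg conv_dens(4) by (intro norm_integral_le iD) auto
  also have "\<dots> \<le> MK' * T" using s bounds_nonneg by (intro mult_left_mono) auto
  finally show "\<bar>snd (law_field \<tau> V (s, x))\<bar> \<le> MK' * T" unfolding g by simp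
qed

text \<open>The drift is compared only before \<tau>, the rate at all times: after killing
  \<open>conv_D\<close> is 0 and the rate becomes \<open>lam * c0\<close>, the value of
  \<open>h0\<close>.\<close>

lemma
  assumes s: "s \<in> {0..T}"
  shows drift_law_field: "ereal s < \<tau> \<omega> \<Longrightarrow>
      drift lam c0 \<phi>0 \<phi>1 (int_conv K M \<tau> V s \<omega>) (int_conv (deriv K) M \<tau> V s \<omega>) = bb (law_field \<tau> V (s, V s \<omega>))"
    and intensity_law_field: "lam * c0 * exp (- lam * int_conv K M \<tau> V s \<omega>) = intensity \<tau> V \<omega> s"
proof -
  note L = law_field_conv[OF s, of "V s \<omega>"]
  have "int_conv K M \<tau> V s \<omega> = fst (law_field \<tau> V (s, V s \<omega>))"
    "int_conv (deriv K) M \<tau> V s \<omega> = snd (law_field \<tau> V (s, V s \<omega>))" if "ereal s < \<tau> \<omega>"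
    using that L(1,2) by (simp_all add: int_conv_def killed_def conv_D_def)
  moreover have "int_conv K M \<tau> V s \<omega> = 0" if "\<not> ereal s < \<tau> \<omega>"
    using that by (simp add: int_conv_def killed_def conv_D_def)
  ultimately show "ereal s < \<tau> \<omega> \<Longrightarrow>
      drift lam c0 \<phi>0 \<phi>1 (int_conv K M \<tau> V s \<omega>) (int_conv (deriv K) M \<tau> V s \<omega>) = bb (law_field \<tau> V (s, V s \<omega>))"
    and "lam * c0 * exp (- lam * int_conv K M \<tau> V s \<omega>) = intensity \<tau> V \<omega> s"
    using clamp1(3)[OF L(3)] clamp2(3)[OF L(4)] by (auto simp: bb_def intensity_def hh_def)
qed

lemma kmv_solution_iff_sol: "kmv_solution T K lam c0 \<phi>0 \<phi>1 M X0 W Z V \<tau> \<longleftrightarrow> sol V \<tau>"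
proof -
  let ?b = "\<lambda>\<omega> s. drift lam c0 \<phi>0 \<phi>1 (int_conv K M \<tau> V s \<omega>) (int_conv (deriv K) M \<tau> V s \<omega>)"
  let ?h = "\<lambda>\<omega> s. lam * c0 * exp (- lam * int_conv K M \<tau> V s \<omega>)"
  have "?b \<omega> s = bb (law_field \<tau> V (s, V s \<omega>))" if "t \<in> {0..T}" "ereal t < \<tau> \<omega>" "s \<in> {0..t}" for t s \<omega>
    using that le_less_trans[of "ereal s" "ereal t" "\<tau> \<omega>"] by (intro drift_law_field) auto
  then have b: "?b \<omega> integrable_on {0..t} \<longleftrightarrow> (\<lambda>s. bb (law_field \<tau> V (s, V s \<omega>))) integrable_on {0..t}"
    "integral {0..t} (?b \<omega>) = integral {0..t} (\<lambda>s. bb (law_field \<tau> V (s, V s \<omega>)))"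
    if "t \<in> {0..T}" "ereal t < \<tau> \<omega>" for t \<omega>
    using that by (auto intro!: integrable_cong Henstock_Kurzweil_Integration.integral_cong)
  have h: "?h \<omega> integrable_on {0..t} \<longleftrightarrow> intensity \<tau> V \<omega> integrable_on {0..t}"
    "integral {0..t} (?h \<omega>) = integral {0..t} (intensity \<tau> V \<omega>)" if "t \<in> {0..T}" for t \<omega>
    using that
    by (intro integrable_cong Henstock_Kurzweil_Integration.integral_cong intensity_law_field; auto)+
  have P: "Inf {ereal t | t. t \<in> {0..T} \<and> Z \<omega> \<le> integral {0..t} (?h \<omega>)} = passage T (\<lambda>t. integral {0..t} (intensity \<tau> V \<omega>)) (Z \<omega>)" for \<omega>
    unfolding passage_def using h(2) by (intro arg_cong[where f=Inf]) auto
  have "(\<forall>t\<in>{0..T}. ereal t < \<tau> \<omega> \<longrightarrow> ?b \<omega> integrable_on {0..t} \<and> V t \<omega> = X0 \<omega> + integral {0..t} (?b \<omega>) + sqrt 2 * W t \<omega>)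
    \<longleftrightarrow> (\<forall>t\<in>{0..T}. ereal t < \<tau> \<omega> \<longrightarrow> (\<lambda>s. bb (law_field \<tau> V (s, V s \<omega>))) integrable_on {0..t} \<and>
        V t \<omega> = X0 \<omega> + integral {0..t} (\<lambda>s. bb (law_field \<tau> V (s, V s \<omega>))) + sqrt 2 * W t \<omega>)" for \<omega>
    using b by (intro ball_cong refl imp_cong) simp
  moreover have "(\<forall>t\<in>{0..T}. ?h \<omega> integrable_on {0..t}) \<longleftrightarrow> (\<forall>t\<in>{0..T}. intensity \<tau> V \<omega> integrable_on {0..t})" for \<omega>
    using h(1) by (intro ball_cong refl) simp
  ultimately show ?thesis unfolding kmv_solution_def sol_def P by (simp only:)
qed

end

text \<open>Identifying the coefficients requires right regularity, which neither notion of solution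
  contains; each implies it through its own integral equation, with the drift in which it is
  written.\<close>

lemma kmv_solution_eq_sol: "kmv_solution T K lam c0 \<phi>0 \<phi>1 M X0 W Z V \<tau> \<longleftrightarrow> sol V \<tau>"
proof
  assume k: "kmv_solution T K lam c0 \<phi>0 \<phi>1 M X0 W Z V \<tau>"
  then have "AE \<omega> in M. right_regular (\<lambda>r \<omega>. ereal r < \<tau> \<omega>) V \<omega>"
    unfolding kmv_solution_def
    by (intro integral_process_right_regular[where g="\<lambda>\<omega> s. drift lam c0 \<phi>0 \<phi>1 (int_conv K M \<tau> V s \<omega>) (int_conv (deriv K) M \<tau> V s \<omega>)"]) blast
  with k show "sol V \<tau>" using kmv_solution_iff_sol[of V \<tau>] by (simp add: kmv_solution_def)
next
  assume k: "sol V \<tau>"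
  then have "AE \<omega> in M. right_regular (\<lambda>r \<omega>. ereal r < \<tau> \<omega>) V \<omega>"
    unfolding sol_def
    by (intro integral_process_right_regular[where g="\<lambda>\<omega> s. bb (law_field \<tau> V (s, V s \<omega>))"]) blast
  with k show "kmv_solution T K lam c0 \<phi>0 \<phi>1 M X0 W Z V \<tau>" using kmv_solution_iff_sol[of V \<tau>] by (simp add: sol_def)
qed

text \<open>State and clock at time \<open>t\<close> are measurable functionals of \<open>X0\<close>
  and the path up to \<open>t\<close>; the exceptional set \<open>N\<close> is measurable for the
  natural filtration because null sets are among its generators.\<close>

lemma ex_strong_solution: "\<exists>V \<tau>. strong_kmv_solution T K lam c0 \<phi>0 \<phi>1 M X0 W Z V \<tau>"
proof -
  obtain G where G: "G \<in> adm" "\<And>t x. t \<in> {0..T} \<Longrightarrow> \<Phi> G (t, x) = G (t, x)"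
    using ex_fixed_point by blast
  obtain \<tau> N where sol: "sol (state G) \<tau>" and N: "N \<in> null_sets M"
    and \<tau>: "\<And>t. t \<in> {0..T} \<Longrightarrow> {\<omega> \<in> space M. \<tau> \<omega> \<le> ereal t} = {\<omega> \<in> space M. Z \<omega> \<le> \<Lambda> G (X0 \<omega>) (W_path \<omega>) t} - N"
    using fixed_point_sol[OF G] by blast
  have "state G t -` A \<inter> space M \<in> natural_filtration M X0 W Z t \<and>
      {\<omega> \<in> space M. \<tau> \<omega> \<le> ereal t} \<in> natural_filtration M X0 W Z t"
    if t: "t \<in> {0..T}" and A: "A \<in> sets borel" for t A
  proof -
    let ?G = "(\<Union>V\<in>{X0, Z} \<union> {W s | s. 0 \<le> s \<and> s \<le> t}. {V -` A \<inter> space M | A. A \<in> sets borel}) \<union> null_sets M"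
    define N' where "N' = sigma (space M) ?G"
    have Gs: "?G \<subseteq> Pow (space M)" using sets.sets_into_space by (auto simp: null_sets_def)
    have sN: "sets N' = natural_filtration M X0 W Z t" and sp: "space N' = space M"
      unfolding N'_def natural_filtration_def sets_measure_of[OF Gs] by (auto simp: space_measure_of_conv)
    have meas: "V \<in> borel_measurable N'" if "V \<in> {X0, Z} \<union> {W s | s. 0 \<le> s \<and> s \<le> t}" for V
    proof (rule measurableI)
      fix A :: "real set" assume "A \<in> sets borel"
      then have "V -` A \<inter> space M \<in> ?G" using that by blast
      then show "V -` A \<inter> space N' \<in> sets N'"
        unfolding sN sp natural_filtration_def by (rule sigma_sets.Basic)
    qed simp
    have "(\<lambda>\<omega>. Y G (X0 \<omega>) (W_path \<omega>) t) \<in> borel_measurable N'"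
      by (intro measurable_Y G t meas) auto
    then have "state G t -` A \<inter> space N' \<in> sets N'" unfolding state_def by (rule measurable_sets[OF _ A])
    moreover have [measurable]: "(\<lambda>\<omega>. \<Lambda> G (X0 \<omega>) (W_path \<omega>) t) \<in> borel_measurable N'"
      by (intro measurable_\<Lambda> G t meas) auto
    have [measurable]: "Z \<in> borel_measurable N'" by (intro meas) auto
    have [measurable]: "N \<in> sets N'"
      unfolding sN natural_filtration_def using N by (intro sigma_sets.Basic) auto
    have "{\<omega> \<in> space N'. Z \<omega> \<le> \<Lambda> G (X0 \<omega>) (W_path \<omega>) t} - N \<in> sets N'" by measurable
    ultimately show ?thesis unfolding \<tau>[OF t] sN sp by blast
  qed
  \<comment> \<open>The event of \<tau> was shown together with an arbitrary Borel set
    \<open>A\<close>; the empty set supplies one.\<close>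
  then have "strong_kmv_solution T K lam c0 \<phi>0 \<phi>1 M X0 W Z (state G) \<tau>"
    using sol unfolding strong_kmv_solution_def kmv_solution_eq_sol by (metis sets.empty_sets)
  then show ?thesis by blast
qed

lemma kmv_unique:
  assumes "kmv_solution T K lam c0 \<phi>0 \<phi>1 M X0 W Z V1 \<tau>1" "kmv_solution T K lam c0 \<phi>0 \<phi>1 M X0 W Z V2 \<tau>2"
  shows "AE \<omega> in M. \<forall>t\<in>{0..T}. killed \<tau>1 V1 t \<omega> = killed \<tau>2 V2 t \<omega>"
  using assms unfolding kmv_solution_eq_sol by (rule sol_unique)

end

lemma (in kmv_kernel) weak_solution_unique_law:
  fixes M1 :: "'b measure" and M2 :: "'c measure"
  assumes w1: "weak_kmv_solution T K lam c0 \<phi>0 \<phi>1 \<rho>0 M1 F1 X01 W1 Z1 V1 \<tau>1"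
    and w2: "weak_kmv_solution T K lam c0 \<phi>0 \<phi>1 \<rho>0 M2 F2 X02 W2 Z2 V2 \<tau>2"
  shows "path_law T M1 \<tau>1 V1 = path_law T M2 \<tau>2 V2"
proof -
  have d: "data_setup \<rho>0 M1 F1 X01 W1 Z1" "data_setup \<rho>0 M2 F2 X02 W2 Z2"
    and k: "kmv_solution T K lam c0 \<phi>0 \<phi>1 M1 X01 W1 Z1 V1 \<tau>1" "kmv_solution T K lam c0 \<phi>0 \<phi>1 M2 X02 W2 Z2 V2 \<tau>2"
    using w1 w2 by (auto simp: weak_kmv_solution_def)
  interpret D1: kmv_data T lam c0 \<phi>0 \<phi>1 MK MK' LK LK' m K \<rho>0 M1 F1 X01 Z1 W1 by unfold_locales (fact d)
  interpret D2: kmv_data T lam c0 \<phi>0 \<phi>1 MK MK' LK LK' m K \<rho>0 M2 F2 X02 Z2 W2 by unfold_locales (fact d)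
  show ?thesis
    using k unfolding D1.kmv_solution_eq_sol D2.kmv_solution_eq_sol
    by (rule path_law_unique[OF D1.killed_mv_data_axioms D2.killed_mv_data_axioms data_law_unique[OF d]])
qed

theorem theorem2p8:
  fixes T lam c0 \<phi>0 \<phi>1 MK MK' MK'' LK LK' :: real
    and K \<rho>0 :: "real \<Rightarrow> real"
    and M :: "'a measure" and F :: "real \<Rightarrow> 'a measure"
    and X0 Z :: "'a \<Rightarrow> real" and W :: "real \<Rightarrow> 'a \<Rightarrow> real"
  assumes T_pos: "T > 0"
    and data: "data_setup \<rho>0 M F X0 W Z"
    and rho0_L2: "integrable lborel (\<lambda>x. (\<rho>0 x)\<^sup>2)"
    and rho0_Cb: "continuous_on UNIV \<rho>0" "bounded (range \<rho>0)"
    and K_smooth: "\<And>n x. ((deriv ^^ n) K) differentiable (at x)"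
    and K_nonneg: "\<And>x. K x \<ge> 0"
    and K_bd: "\<And>x. \<bar>K x\<bar> \<le> MK"
    and DK_bd: "\<And>x. \<bar>deriv K x\<bar> \<le> MK'"
    and D2K_bd: "\<And>x. \<bar>deriv (deriv K) x\<bar> \<le> MK''"
    and K_lip: "\<And>x y. \<bar>K x - K y\<bar> \<le> LK * \<bar>x - y\<bar>"
    and DK_lip: "\<And>x y. \<bar>deriv K x - deriv K y\<bar> \<le> LK' * \<bar>x - y\<bar>"
    and K_int: "integrable lborel K" "integral\<^sup>L lborel K = 1"
    and lam_pos: "lam > 0" and c0_pos: "c0 > 0" and phi0_pos: "\<phi>0 > 0"
    and denom_bd: "\<exists>m Mc. 0 < m \<and> m \<le> Mc \<and>
        (\<forall>x\<in>{0..MK * T}. m \<le> \<phi>0 + \<phi>1 * c0 * exp (- lam * x) \<and>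
                           \<phi>0 + \<phi>1 * c0 * exp (- lam * x) \<le> Mc)"
  shows
    \<comment> \<open>existence of a strong solution\<close>
    "(\<exists>Y \<tau>. strong_kmv_solution T K lam c0 \<phi>0 \<phi>1 M X0 W Z Y \<tau>)
     \<comment> \<open>pathwise uniqueness\<close>
     \<and> (\<forall>Y1 \<tau>1 Y2 \<tau>2. kmv_solution T K lam c0 \<phi>0 \<phi>1 M X0 W Z Y1 \<tau>1 \<longrightarrow>
          kmv_solution T K lam c0 \<phi>0 \<phi>1 M X0 W Z Y2 \<tau>2 \<longrightarrow>
          (AE \<omega> in M. \<forall>t\<in>{0..T}. killed \<tau>1 Y1 t \<omega> = killed \<tau>2 Y2 t \<omega>))
     \<comment> \<open>existence of a weak solution\<close>
     \<and> (\<exists>(M'::'a measure) F' X0' W' Z' Y' \<tau>'.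
          weak_kmv_solution T K lam c0 \<phi>0 \<phi>1 \<rho>0 M' F' X0' W' Z' Y' \<tau>')
     \<comment> \<open>uniqueness in law (weak solutions on arbitrary probability spaces)\<close>
     \<and> (\<forall>(M1::'b measure) F1 X01 W1 Z1 Y1 \<tau>1 (M2::'c measure) F2 X02 W2 Z2 Y2 \<tau>2.
          weak_kmv_solution T K lam c0 \<phi>0 \<phi>1 \<rho>0 M1 F1 X01 W1 Z1 Y1 \<tau>1 \<longrightarrow>
          weak_kmv_solution T K lam c0 \<phi>0 \<phi>1 \<rho>0 M2 F2 X02 W2 Z2 Y2 \<tau>2 \<longrightarrow>
          path_law T M1 \<tau>1 Y1 = path_law T M2 \<tau>2 Y2)"
proof -
  obtain m where m: "0 < m" "\<And>x. x \<in> {0..MK * T} \<Longrightarrow> m \<le> \<phi>0 + \<phi>1 * c0 * exp (- lam * x)"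
    using denom_bd by blast
  interpret kmv_data T lam c0 \<phi>0 \<phi>1 MK MK' LK LK' m K \<rho>0 M F X0 Z W
    by unfold_locales (fact T_pos K_nonneg K_bd DK_bd K_lip DK_lip lam_pos c0_pos phi0_pos m data)+
  \<comment> \<open>The given space already carries the data, so its strong solution is also a weak
    one.\<close>
  have "\<exists>(M'::'a measure) F' X0' W' Z' Y' \<tau>'. weak_kmv_solution T K lam c0 \<phi>0 \<phi>1 \<rho>0 M' F' X0' W' Z' Y' \<tau>'"
    using ex_strong_solution data unfolding weak_kmv_solution_def strong_kmv_solution_def by blast
  with ex_strong_solution kmv_unique weak_solution_unique_law show ?thesis by blast
qed

end
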